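(* The restriction of the map $N\colon \operatorname{Aut}\mathbb{C}\mathbf{Q}_r\to \mathrm{GL}_r(\mathcal{A}_1)$, $\psi\mapsto N^\psi$, to the subgroup $P_r'$ induces an isomorphism of groups $P_r'\to \mathrm{GL}_r(\mathbb{C}[a^*])\subseteq\mathrm{GL}_r(\mathcal{A}_1)$. Moreover, if $r\geq 2$, then $P_r'\subseteq\mathcal{P}_r$, and $\mathcal{P}_r$ can equivalently be defined as the semidirect product $P_r'\rtimes\operatorname{Aut}(\mathbb{C}\mathbf{Q}_0;c_0)$.
   Context: Let $r\geq1$. $\mathbf{Q}_r$ is the quiver with two vertices $1,2$, two loops $a,a^*$ at $1$, $r$ arrows $b_1,\dots,b_r\colon 1\to 2$ and $r$ arrows $d_1,\dots,d_r\colon 2\to 1$. $\mathbb{C}\mathbf{Q}_r$ is its complex path algebra, with paths composed like linear maps (right to left), so that $d_\alpha b_\beta$ is a cycle at $1$; $e_1,e_2$ are the trivial paths. $\operatorname{Aut}\mathbb{C}\mathbf{Q}_r$ is the group of $\mathbb{C}$-algebra automorphisms of $\mathbb{C}\mathbf{Q}_r$ fixing $e_1$ and $e_2$, with product $\sigma\psi=\sigma\circ\psi$. $\mathcal{A}_1=e_1\mathbb{C}\mathbf{Q}_re_1$ is the free associative algebra (with unit $e_1$) on $a$, $a^*$ and $e_{\alpha\beta}=d_\alpha b_\beta$, and $e_2\mathbb{C}\mathbf{Q}_re_1$ is a free right $\mathcal{A}_1$-module with basis $b_1,\dots,b_r$. For $\psi\in\operatorname{Aut}\mathbb{C}\mathbf{Q}_r$,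 $N^\psi\in\mathrm{GL}_r(\mathcal{A}_1)$ is the unique matrix such that $\psi(b_\alpha)=\sum_{\beta} b_\beta N^\psi_{\beta\alpha}$ for all $\alpha$. Notation: $x_i=-d_{2i-1}$, $x_i^*=b_{2i-1}$ for $i=1,\dots,\lceil r/2\rceil$; $y_j=b_{2j}$, $y_j^*=d_{2j}$ for $j=1,\dots,\lfloor r/2\rfloor$. Let $c_r=[a,a^*]+\sum_i[x_i,x_i^*]+\sum_j[y_j,y_j^*]$; an automorphism is symplectic if it fixes $c_r$; these form the group $\operatorname{Aut}(\mathbb{C}\mathbf{Q}_r;c_r)$. Let $\mathcal{I}_r$ be the two-sided ideal generated by $e_2$, all $d_\alpha$ and all $b_\alpha$; then $\mathbb{C}\mathbf{Q}_r/\mathcal{I}_r\simeq\mathbb{C}\langle a,a^*\rangle=\mathbb{C}\mathbf{Q}_0$. An automorphism is reduced if it induces the identity on this quotient. Let $\operatorname{Aut}(\mathbb{C}\mathbf{Q}_0;c_0)$ be the group of $\mathbb{C}$-algebra automorphisms of $\mathbb{C}\langle a,a^*\rangle$ fixing $c_0=[a,a^*]$, embedded in $\operatorname{Aut}(\mathbb{C}\mathbf{Q}_r;c_r)$ by letting them act as the identity on all $b_\alpha,d_\alpha$. Then $\operatorname{Aut}(\mathbb{C}\mathbf{Q}_r;c_r)=K_{c_r}\rtimes\operatorname{Aut}(\mathbb{C}\mathbf{Q}_0;c_0)$, where $K_{c_r}$ is the normal subgroup of reduced symplectic automorphisms. An automorphism is affine if it sends each arrow to a polynomial which is at most linear in each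 arrow; $\mathrm{Aff}_c^{\mathrm{red}}$ is the group of reduced affine symplectic automorphisms, which consists of the automorphisms fixing $a,a^*$ and acting by $b_\alpha\mapsto\sum_\beta b_\beta T_{\beta\alpha}$, $d_\alpha\mapsto\sum_\beta (T^{-1})_{\alpha\beta}d_\beta$ for $T\in\mathrm{GL}_r(\mathbb{C})$. For a letter $g$, the necklace derivative $\frac{\partial}{\partial g}$ is linear and on a cyclic word $\eta_1\cdots\eta_\ell$ equals $\sum_{k:\eta_k=g}\eta_{k+1}\cdots\eta_\ell\eta_1\cdots\eta_{k-1}$. For $p\in\mathbb{C}[a]$, with $b_{11}=x_1y_1$, $\Lambda(p(a)b_{11})$ is the symplectic automorphism $a^*\mapsto a^*+\frac{\partial}{\partial a}(p(a)b_{11})$, $x_1^*\mapsto x_1^*+y_1p(a)$, $y_1^*\mapsto y_1^*+p(a)x_1$, fixing all other arrows (the derivative is taken of words in the letters $a,b_{11}$). For $p\in\mathbb{C}[a^*]$, with $b_{11}^*=y_1^*x_1^*$, $\Lambda'(p(a^* )b_{11}^* )$ is the symplectic automorphism $a\mapsto a+\frac{\partial}{\partial a^*}(p(a^* )b_{11}^* )$, $x_1\mapsto x_1+p(a^* )y_1^*$, $y_1\mapsto y_1+x_1^*p(a^* )$, fixing all other arrows (the derivative is taken of words in the letters $a^*,b_{11}^*$). $P_r\subseteq K_{c_r}$ is the group generated by $\mathrm{Aff}_c^{\mathrm{red}}$ and all $\Lambda(p(a)b_{11})$, $p\in\mathbb{C}[a]$; $P_r'$ is the group generated by $\mathrm{Aff}_c^{\mathrm{red}}$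 and all $\Lambda'(p(a^* )b_{11}^* )$, $p\in\mathbb{C}[a^*]$ (for $r=1$ there are no arrows $y_1,y_1^*$, and both groups are just $\mathrm{Aff}_c^{\mathrm{red}}$). $\mathcal{P}_r$ is the subgroup of $\operatorname{Aut}(\mathbb{C}\mathbf{Q}_r;c_r)$ obtained by replacing, in the semidirect product $K_{c_r}\rtimes\operatorname{Aut}(\mathbb{C}\mathbf{Q}_0;c_0)$, the group $K_{c_r}$ with its subgroup $P_r$; thus every element of $\mathcal{P}_r$ can be written in a unique way as $\psi_0\circ\psi$ with $\psi_0\in\operatorname{Aut}(\mathbb{C}\mathbf{Q}_0;c_0)$ and $\psi\in P_r$.
   Formalization: For r≥2 neither P_r nor P_r' is normalized by Aut(CQ_0;c_0), so 𝒫_r is taken as the subgroup generated by Aut(CQ_0;c_0) and P_r (equivalently P_r'); the normal factor of the semidirect product is the group generated by all Aut(CQ_0;c_0)-conjugates of P_r'. *)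

theory Defs
  imports
    "HOL-Library.Poly_Mapping"
    "HOL-Algebra.Bij"
    "HOL-Algebra.Coset"
    "HOL-Algebra.Generated_Groups"
    "HOL-Algebra.Ideal"
    "HOL-Algebra.RingHom"
    "HOL-Computational_Algebra.Polynomial"
    "Jordan_Normal_Form.Matrix"
begin

hide_const (open) Multiset.mult Ring_Hom.ring_hom

datatype vertex = V1 | V2

datatype arrow = Arr_a | Arr_as | Arr_b nat | Arr_d nat

fun src :: "arrow \<Rightarrow> vertex" where
  "src Arr_a = V1" | "src Arr_as = V1" | "src (Arr_b _) = V1" | "src (Arr_d _) = V2"

fun tgt :: "arrow \<Rightarrow> vertex" where
  "tgt Arr_a = V1" | "tgt Arr_as = V1" | "tgt (Arr_b _) = V2" | "tgt (Arr_d _) = V1"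

definition arrows :: "nat \<Rightarrow> arrow set" where
  "arrows r = {Arr_a, Arr_as} \<union> Arr_b ` {1..r} \<union> Arr_d ` {1..r}"

text \<open>
  The triple \<open>(t, w, s)\<close> stands for the path from \<open>s\<close> to \<open>t\<close> with arrows \<open>w\<close>, written right to
  left: the last letter of \<open>w\<close> is traversed first.  The end points are recorded so that the two
  trivial paths \<open>(V1, [], V1)\<close> and \<open>(V2, [], V2)\<close> differ.
\<close>

type_synonym path = "vertex \<times> arrow list \<times> vertex"

fun is_path :: "nat \<Rightarrow> path \<Rightarrow> bool" where
  "is_path r (t, [], s) \<longleftrightarrow> t = s"
| "is_path r (t, g # w, s) \<longleftrightarrow> g \<in> arrows r \<and> tgt g = t \<and> is_path r (src g, w, s)"

text \<open>
  The type \<open>palg\<close> is an ambient ring for all the path algebras: it is spanned by \<^emph>\<open>all\<close> triples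
  \<open>(t, w, s)\<close>, including those that are not paths, and \<open>(t, w, s) (t', w', s')\<close> is
  \<open>(t, w @ w', s')\<close> if \<open>s = t'\<close> and \<open>0\<close> otherwise (in other words it is the ring of two by two
  matrices over the free algebra on all arrows).  The path algebra is the subring spanned by the
  paths, see \<open>CQ_carrier\<close> below.
\<close>

typedef palg = "UNIV :: (path \<Rightarrow>\<^sub>0 complex) set"
  morphisms coeffs Palg ..

setup_lifting type_definition_palg

definition conv_at :: "(path \<Rightarrow>\<^sub>0 complex) \<Rightarrow> (path \<Rightarrow>\<^sub>0 complex) \<Rightarrow> path \<Rightarrow> path \<Rightarrow> (path \<Rightarrow>\<^sub>0 complex)"
  where "conv_at f g p q =
    (if snd (snd p) = fst q
     then Poly_Mapping.single (fst p, fst (snd p) @ fst (snd q), snd (snd q))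
            (Poly_Mapping.lookup f p * Poly_Mapping.lookup g q)
     else 0)"

definition path_conv :: "(path \<Rightarrow>\<^sub>0 complex) \<Rightarrow> (path \<Rightarrow>\<^sub>0 complex) \<Rightarrow> (path \<Rightarrow>\<^sub>0 complex)" where
  "path_conv f g = (\<Sum>p\<in>Poly_Mapping.keys f. \<Sum>q\<in>Poly_Mapping.keys g. conv_at f g p q)"

lemma path_conv_superset:
  assumes "finite A" "finite B" "Poly_Mapping.keys f \<subseteq> A" "Poly_Mapping.keys g \<subseteq> B"
  shows "path_conv f g = (\<Sum>p\<in>A. \<Sum>q\<in>B. conv_at f g p q)"
proof -
  have "path_conv f g = (\<Sum>p\<in>Poly_Mapping.keys f. \<Sum>q\<in>B. conv_at f g p q)"
    unfolding path_conv_def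
    by (intro sum.cong sum.mono_neutral_left refl) (use assms in \<open>auto simp: conv_at_def in_keys_iff\<close>)
  also have "\<dots> = (\<Sum>p\<in>A. \<Sum>q\<in>B. conv_at f g p q)"
    by (intro sum.mono_neutral_left ballI sum.neutral)
       (use assms in \<open>auto simp: conv_at_def in_keys_iff\<close>)
  finally show ?thesis .
qed

lemma path_conv_add_left: "path_conv (f + g) h = path_conv f h + path_conv g h"
proof -
  let ?A = "Poly_Mapping.keys f \<union> Poly_Mapping.keys g"
  have "Poly_Mapping.keys (f + g) \<subseteq> ?A" by (rule Poly_Mapping.keys_add)
  then show ?thesis
    by (subst (1 2 3) path_conv_superset[where A = ?A and B = "Poly_Mapping.keys h"])
       (auto simp: sum.distrib[symmetric] conv_at_def lookup_add distrib_right single_add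
             intro!: sum.cong)
qed

lemma path_conv_add_right: "path_conv h (f + g) = path_conv h f + path_conv h g"
proof -
  let ?A = "Poly_Mapping.keys f \<union> Poly_Mapping.keys g"
  have "Poly_Mapping.keys (f + g) \<subseteq> ?A" by (rule Poly_Mapping.keys_add)
  then show ?thesis
    by (subst (1 2 3) path_conv_superset[where B = ?A and A = "Poly_Mapping.keys h"])
       (auto simp: sum.distrib[symmetric] conv_at_def lookup_add distrib_left single_add
             intro!: sum.cong)
qed

lemma path_conv_single:
  "path_conv (Poly_Mapping.single (t, w, s) c) (Poly_Mapping.single (t', w', s') c') =
     (if s = t' then Poly_Mapping.single (t, w @ w', s') (c * c') else 0)"
  by (subst path_conv_superset[where A = "{(t, w, s)}" and B = "{(t', w', s')}"])
     (auto simp: conv_at_def)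

lemma path_mapping_induct [case_names single add]:
  fixes f :: "path \<Rightarrow>\<^sub>0 complex"
  assumes single: "\<And>t w s c. P (Poly_Mapping.single (t, w, s) c)"
    and add: "\<And>f g. P f \<Longrightarrow> P g \<Longrightarrow> P (f + g)"
  shows "P f"
proof (induction f rule: update_induct)
  case const
  have "P (Poly_Mapping.single (V1, [], V1) 0)" by (rule single)
  then show ?case by simp
next
  case (update f k c)
  have "Poly_Mapping.update k c f = f + Poly_Mapping.single k c"
    using update(1)
    by (intro poly_mapping_eqI)
       (auto simp: lookup_update lookup_add lookup_single when_def in_keys_iff)
  moreover have "P (Poly_Mapping.single k c)" by (cases k) (simp add: single)
  ultimately show ?case using update add by simp
qed

lemma path_conv_0 [simp]: "path_conv 0 f = 0" "path_conv f 0 = 0"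
  by (simp_all add: path_conv_def)

lemma path_conv_assoc: "path_conv (path_conv f g) h = path_conv f (path_conv g h)"
proof (induction f rule: path_mapping_induct)
  case (single t w s c)
  show ?case
  proof (induction g rule: path_mapping_induct)
    case (single t' w' s' c')
    show ?case
      by (induction h rule: path_mapping_induct)
         (auto simp: path_conv_single path_conv_add_right mult.assoc split: if_splits)
  qed (simp add: path_conv_add_left path_conv_add_right)
qed (simp add: path_conv_add_left)

definition path_unit :: "path \<Rightarrow>\<^sub>0 complex" where
  "path_unit = Poly_Mapping.single (V1, [], V1) 1 + Poly_Mapping.single (V2, [], V2) 1"

lemma path_conv_unit: "path_conv path_unit f = f" "path_conv f path_unit = f"
proof -
  show "path_conv path_unit f = f"
  proof (induction f rule: path_mapping_induct)
    case (single t w s c)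
    then show ?case
      by (cases t) (auto simp: path_unit_def path_conv_add_left path_conv_single)
  qed (simp add: path_conv_add_right)
  show "path_conv f path_unit = f"
  proof (induction f rule: path_mapping_induct)
    case (single t w s c)
    then show ?case
      by (cases s) (auto simp: path_unit_def path_conv_add_right path_conv_single)
  qed (simp add: path_conv_add_left)
qed

instantiation palg :: ring_1
begin

lift_definition zero_palg :: palg is 0 .
lift_definition one_palg :: palg is path_unit .
lift_definition plus_palg :: "palg \<Rightarrow> palg \<Rightarrow> palg" is "(+)" .
lift_definition minus_palg :: "palg \<Rightarrow> palg \<Rightarrow> palg" is "(-)" .
lift_definition uminus_palg :: "palg \<Rightarrow> palg" is uminus .
lift_definition times_palg :: "palg \<Rightarrow> palg \<Rightarrow> palg" is path_conv .

instance
proof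
  show "(0 :: palg) \<noteq> 1"
  proof transfer
    have "Poly_Mapping.lookup path_unit (V1, [], V1) = 1"
      by (simp add: path_unit_def lookup_add lookup_single)
    then show "0 \<noteq> path_unit" by auto
  qed
qed (transfer; simp add: algebra_simps path_conv_assoc path_conv_unit path_conv_add_left
       path_conv_add_right)+

end

lift_definition cscale :: "complex \<Rightarrow> palg \<Rightarrow> palg" (infixr \<open>*\<^sub>C\<close> 75)
  is "\<lambda>c. Poly_Mapping.map ((*) c)" .

definition coeff_at :: "palg \<Rightarrow> path \<Rightarrow> complex" where
  "coeff_at x = Poly_Mapping.lookup (coeffs x)"

definition supp :: "palg \<Rightarrow> path set" where
  "supp x = Poly_Mapping.keys (coeffs x)"

definition of_path :: "path \<Rightarrow> palg" where
  "of_path p = Palg (Poly_Mapping.single p 1)"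

definition ee :: "vertex \<Rightarrow> palg" where
  "ee v = of_path (v, [], v)"

definition arr :: "arrow \<Rightarrow> palg" where
  "arr g = of_path (tgt g, [g], src g)"

abbreviation "e1 \<equiv> ee V1"
abbreviation "e2 \<equiv> ee V2"
abbreviation "aa \<equiv> arr Arr_a"
abbreviation "as \<equiv> arr Arr_as"
abbreviation bb :: "nat \<Rightarrow> palg" where "bb \<alpha> \<equiv> arr (Arr_b \<alpha>)"
abbreviation dd :: "nat \<Rightarrow> palg" where "dd \<alpha> \<equiv> arr (Arr_d \<alpha>)"

definition CQ_carrier :: "nat \<Rightarrow> palg set" where
  "CQ_carrier r = {x. \<forall>p\<in>supp x. is_path r p}"

definition CQ :: "nat \<Rightarrow> palg ring" where
  "CQ r = \<lparr>carrier = CQ_carrier r, mult = (*), one = 1, zero = 0, add = (+)\<rparr>"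

definition clinear_on :: "palg set \<Rightarrow> (palg \<Rightarrow> palg) \<Rightarrow> bool" where
  "clinear_on S f \<longleftrightarrow> (\<forall>c. \<forall>x\<in>S. f (c *\<^sub>C x) = c *\<^sub>C f x)"

text \<open>As in \<open>HOL-Algebra.Bij\<close>, automorphisms are extensional, i.e. \<open>undefined\<close> off the carrier.\<close>

definition alg_auto :: "palg ring \<Rightarrow> (palg \<Rightarrow> palg) set" where
  "alg_auto R = {\<psi> \<in> Bij (carrier R). \<psi> \<in> ring_hom R R \<and> clinear_on (carrier R) \<psi>}"

definition Aut :: "nat \<Rightarrow> (palg \<Rightarrow> palg) set" where
  "Aut r = {\<psi> \<in> alg_auto (CQ r). \<psi> e1 = e1 \<and> \<psi> e2 = e2}"

definition comm :: "palg \<Rightarrow> palg \<Rightarrow> palg" where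
  "comm x y = x * y - y * x"

definition xx :: "nat \<Rightarrow> palg" where "xx i = - dd (2 * i - 1)"
definition xs :: "nat \<Rightarrow> palg" where "xs i = bb (2 * i - 1)"
definition yy :: "nat \<Rightarrow> palg" where "yy j = bb (2 * j)"
definition ys :: "nat \<Rightarrow> palg" where "ys j = dd (2 * j)"

definition c_elem :: "nat \<Rightarrow> palg" where
  "c_elem r = comm aa as + (\<Sum>i = 1..(r + 1) div 2. comm (xx i) (xs i))
                         + (\<Sum>j = 1..r div 2. comm (yy j) (ys j))"

definition Symp :: "nat \<Rightarrow> (palg \<Rightarrow> palg) set" where
  "Symp r = {\<psi> \<in> Aut r. \<psi> (c_elem r) = c_elem r}"

definition SympGrp :: "nat \<Rightarrow> (palg \<Rightarrow> palg) monoid" where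
  "SympGrp r = (BijGroup (CQ_carrier r))\<lparr>carrier := Symp r\<rparr>"

definition I_ideal :: "nat \<Rightarrow> palg set" where
  "I_ideal r = Idl\<^bsub>CQ r\<^esub> ({e2} \<union> dd ` {1..r} \<union> bb ` {1..r})"

definition is_reduced :: "nat \<Rightarrow> (palg \<Rightarrow> palg) \<Rightarrow> bool" where
  "is_reduced r \<psi> \<longleftrightarrow> (\<forall>x\<in>CQ_carrier r. \<psi> x - x \<in> I_ideal r)"

definition K_c :: "nat \<Rightarrow> (palg \<Rightarrow> palg) set" where
  "K_c r = {\<psi> \<in> Symp r. is_reduced r \<psi>}"

text \<open>
  ``At most linear'' is meant in the arrows jointly (total degree at most one): monomials that are
  linear in each arrow separately, like \<open>b_2 a\<close>, would let non-constant matrices in.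
\<close>

definition is_affine :: "nat \<Rightarrow> (palg \<Rightarrow> palg) \<Rightarrow> bool" where
  "is_affine r \<psi> \<longleftrightarrow> (\<forall>g\<in>arrows r. \<forall>(t, w, s)\<in>supp (\<psi> (arr g)). length w \<le> 1)"

definition Aff_red :: "nat \<Rightarrow> (palg \<Rightarrow> palg) set" where
  "Aff_red r = {\<psi> \<in> K_c r. is_affine r \<psi>}"

text \<open>
  \<open>subst_end r \<sigma>\<close> is the endomorphism of the path algebra that fixes \<open>e1\<close>, \<open>e2\<close> and sends each arrow
  \<open>g\<close> to \<open>\<sigma> g\<close>; it is meant for \<open>\<sigma>\<close> with \<open>\<sigma> g = ee (tgt g) * \<sigma> g * ee (src g)\<close>.
\<close>

definition subst_path :: "(arrow \<Rightarrow> palg) \<Rightarrow> path \<Rightarrow> palg" where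
  "subst_path \<sigma> = (\<lambda>(t, w, s). ee t * prod_list (map \<sigma> w) * ee s)"

definition subst_end :: "nat \<Rightarrow> (arrow \<Rightarrow> palg) \<Rightarrow> palg \<Rightarrow> palg" where
  "subst_end r \<sigma> = (\<lambda>x\<in>CQ_carrier r. \<Sum>p\<in>supp x. coeff_at x p *\<^sub>C subst_path \<sigma> p)"

definition Free2 :: "palg ring" where
  "Free2 = \<lparr>carrier = {x. \<forall>p\<in>supp x. \<exists>w\<in>lists {Arr_a, Arr_as}. p = (V1, w, V1)},
            mult = (*), one = e1, zero = 0, add = (+)\<rparr>"

definition Aut_Free2 :: "(palg \<Rightarrow> palg) set" where
  "Aut_Free2 = {\<phi> \<in> alg_auto Free2. \<phi> (comm aa as) = comm aa as}"

definition embed0 :: "nat \<Rightarrow> (palg \<Rightarrow> palg) \<Rightarrow> palg \<Rightarrow> palg" where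
  "embed0 r \<phi> = subst_end r (\<lambda>g. if g \<in> {Arr_a, Arr_as} then \<phi> (arr g) else arr g)"

definition Aut0 :: "nat \<Rightarrow> (palg \<Rightarrow> palg) set" where
  "Aut0 r = embed0 r ` Aut_Free2"

text \<open>
  Cyclic words in two formal letters: \<open>La\<close> stands for \<open>a\<close> (resp. \<open>a*\<close>) and \<open>Lb\<close> for \<open>b_11\<close>
  (resp. \<open>b_11*\<close>).  The derivative is evaluated at once by replacing letters through \<open>v\<close>.
\<close>

datatype letter = La | Lb

definition word_val :: "(letter \<Rightarrow> palg) \<Rightarrow> letter list \<Rightarrow> palg" where
  "word_val v w = e1 * prod_list (map v w)"

definition necklace_word :: "(letter \<Rightarrow> palg) \<Rightarrow> letter \<Rightarrow> letter list \<Rightarrow> palg" where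
  "necklace_word v g w =
     (\<Sum>k\<in>{k. k < length w \<and> w ! k = g}. word_val v (drop (Suc k) w @ take k w))"

definition necklace_deriv :: "(letter \<Rightarrow> palg) \<Rightarrow> letter \<Rightarrow> (letter list \<Rightarrow>\<^sub>0 complex) \<Rightarrow> palg" where
  "necklace_deriv v g f =
     (\<Sum>w\<in>Poly_Mapping.keys f. Poly_Mapping.lookup f w *\<^sub>C necklace_word v g w)"

definition poly_times_Lb :: "complex poly \<Rightarrow> (letter list \<Rightarrow>\<^sub>0 complex)" where
  "poly_times_Lb p =
     (\<Sum>k\<le>degree p. Poly_Mapping.single (replicate k La @ [Lb]) (Polynomial.coeff p k))"

text \<open>Evaluation in the algebra of cycles at vertex 1, whose unit is \<open>e1\<close>.\<close>

definition peval :: "complex poly \<Rightarrow> palg \<Rightarrow> palg" where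
  "peval p x = (\<Sum>k\<le>degree p. Polynomial.coeff p k *\<^sub>C (e1 * x ^ k))"

definition Lam_arrow :: "complex poly \<Rightarrow> arrow \<Rightarrow> palg" where
  "Lam_arrow p g =
     (if g = Arr_as then
        as + necklace_deriv (\<lambda>l. case l of La \<Rightarrow> aa | Lb \<Rightarrow> xx 1 * yy 1) La (poly_times_Lb p)
      else if g = Arr_b 1 then xs 1 + yy 1 * peval p aa
      else if g = Arr_d 2 then ys 1 + peval p aa * xx 1
      else arr g)"

text \<open>Here \<open>Arr_d 1\<close> is sent to minus the image of \<open>x_1\<close>, because \<open>x_1 = - d_1\<close>.\<close>

definition Lam'_arrow :: "complex poly \<Rightarrow> arrow \<Rightarrow> palg" where
  "Lam'_arrow p g =
     (if g = Arr_a then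
        aa + necklace_deriv (\<lambda>l. case l of La \<Rightarrow> as | Lb \<Rightarrow> ys 1 * xs 1) La (poly_times_Lb p)
      else if g = Arr_d 1 then - (xx 1 + peval p as * ys 1)
      else if g = Arr_b 2 then yy 1 + xs 1 * peval p as
      else arr g)"

definition Lam :: "nat \<Rightarrow> complex poly \<Rightarrow> palg \<Rightarrow> palg" where
  "Lam r p = subst_end r (Lam_arrow p)"

definition Lam' :: "nat \<Rightarrow> complex poly \<Rightarrow> palg \<Rightarrow> palg" where
  "Lam' r p = subst_end r (Lam'_arrow p)"

definition P_grp :: "nat \<Rightarrow> (palg \<Rightarrow> palg) set" where
  "P_grp r = generate (SympGrp r) (Aff_red r \<union> (if r \<ge> 2 then range (Lam r) else {}))"

definition P'_grp :: "nat \<Rightarrow> (palg \<Rightarrow> palg) set" where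
  "P'_grp r = generate (SympGrp r) (Aff_red r \<union> (if r \<ge> 2 then range (Lam' r) else {}))"

definition A1 :: "nat \<Rightarrow> palg set" where
  "A1 r = {e1 * x * e1 | x. x \<in> CQ_carrier r}"

definition poly_subring :: "palg \<Rightarrow> palg set" where
  "poly_subring x = range (\<lambda>p. peval p x)"

text \<open>
  The unit of the matrix ring has \<open>e1\<close>, not \<open>1 = e1 + e2\<close>, on the diagonal.
\<close>

definition Mat_monoid :: "nat \<Rightarrow> palg set \<Rightarrow> palg mat monoid" where
  "Mat_monoid r A = \<lparr>carrier = {M \<in> carrier_mat r r. \<forall>i<r. \<forall>j<r. M $$ (i, j) \<in> A},
                     mult = (*), one = mat r r (\<lambda>(i, j). if i = j then e1 else 0)\<rparr>"

definition GL :: "nat \<Rightarrow> palg set \<Rightarrow> palg mat monoid" where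
  "GL r A = units_of (Mat_monoid r A)"

text \<open>Matrix indices start at 0, arrow indices at 1.\<close>

definition N_mat :: "nat \<Rightarrow> (palg \<Rightarrow> palg) \<Rightarrow> palg mat" where
  "N_mat r \<psi> = (THE M. M \<in> carrier (Mat_monoid r (A1 r)) \<and>
     (\<forall>\<alpha><r. \<psi> (bb (\<alpha> + 1)) = (\<Sum>\<beta><r. bb (\<beta> + 1) * M $$ (\<beta>, \<alpha>))))"

text \<open>
  \<open>replaced r H\<close> is the subgroup obtained from the semidirect product of \<open>K_c r\<close> and \<open>Aut0 r\<close> by
  replacing \<open>K_c r\<close> with a subgroup \<open>H\<close>, i.e. the subgroup of all symplectic automorphisms
  generated by the products \<open>\<psi>0 \<circ> \<psi>\<close> with \<open>\<psi>0\<close> in \<open>Aut0 r\<close> and \<open>\<psi>\<close> in \<open>H\<close>.  Taking the generated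
  subgroup matters: \<open>P_grp r\<close> and \<open>P'_grp r\<close> are not stable under conjugation by \<open>Aut0 r\<close> when
  \<open>r \<ge> 2\<close> (the Fourier automorphism with \<open>a \<mapsto> - a*\<close> and \<open>a* \<mapsto> a\<close> exchanges them), so these
  products alone do not form a subgroup.  The kernel that is complemented by \<open>Aut0 r\<close> is the
  \<open>Aut0 r\<close>-stable hull of \<open>H\<close>.
\<close>

definition replaced :: "nat \<Rightarrow> (palg \<Rightarrow> palg) set \<Rightarrow> (palg \<Rightarrow> palg) set" where
  "replaced r H = generate (SympGrp r) (Aut0 r <#>\<^bsub>SympGrp r\<^esub> H)"

definition stable_hull :: "nat \<Rightarrow> (palg \<Rightarrow> palg) set \<Rightarrow> (palg \<Rightarrow> palg) set" where
  "stable_hull r H = generate (SympGrp r)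
     {\<psi>0 \<otimes>\<^bsub>SympGrp r\<^esub> \<psi> \<otimes>\<^bsub>SympGrp r\<^esub> inv\<^bsub>SympGrp r\<^esub> \<psi>0 | \<psi>0 \<psi>. \<psi>0 \<in> Aut0 r \<and> \<psi> \<in> H}"

definition internal_semidirect :: "('g, 'm) monoid_scheme \<Rightarrow> 'g set \<Rightarrow> 'g set \<Rightarrow> 'g set \<Rightarrow> bool" where
  "internal_semidirect G L N H \<longleftrightarrow>
     subgroup L G \<and> N \<lhd> G\<lparr>carrier := L\<rparr> \<and> subgroup H (G\<lparr>carrier := L\<rparr>) \<and>
     N \<inter> H = {\<one>\<^bsub>G\<^esub>} \<and> H <#>\<^bsub>G\<^esub> N = L"

definition P_cal :: "nat \<Rightarrow> (palg \<Rightarrow> palg) set" where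
  "P_cal r = replaced r (P_grp r)"

end

theory Submission
  imports Defs "HOL-Combinatorics.Permutations" "Jordan_Normal_Form.Gauss_Jordan_Elimination"
    "Jordan_Normal_Form.Determinant"
begin

text \<open>
  The element \<open>c_r\<close> equals \<open>[a, a*] + (\<Sum>\<alpha>. b_\<alpha> d_\<alpha> - d_\<alpha> b_\<alpha>)\<close>.  Its \<open>e2\<close>-component shows that a symplectic
  automorphism \<open>\<psi>\<close> fixing all \<open>b_\<alpha>\<close> fixes all \<open>d_\<alpha>\<close>; if \<open>\<psi>\<close> also fixes \<open>a*\<close>, the \<open>e1\<close>-component shows that
  \<open>\<psi>(a) - a\<close> centralizes \<open>a*\<close>, so it is a polynomial in \<open>a*\<close>, and it vanishes if \<open>\<psi>\<close> is reduced.  Hence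
  \<open>N\<close> is injective on the reduced symplectic automorphisms fixing \<open>a*\<close>.  It is onto because
  polynomial matrices with a left inverse reduce to the identity by row operations, and these are
  realised by affine conjugates of the \<open>\<Lambda>'(p(a*) b_11*)\<close>.

  The Fourier automorphism \<open>a \<mapsto> a*\<close>, \<open>a* \<mapsto> - a\<close> composed with the exchange of the indices 1 and 2
  conjugates \<open>\<Lambda>(p(a) b_11)\<close> to \<open>\<Lambda>'(p(a*) b_11*)\<close>; so \<open>P_r\<close> and \<open>P_r'\<close> generate the same group together
  with the automorphisms of the free algebra on the loops.
\<close>

section \<open>The ambient ring of paths\<close>

text \<open>On all automorphisms \<open>N\<close> is only a crossed homomorphism: the matrix of
  \<psi> \<circ> \<phi> is that of \<psi> times the image under \<psi> of that of \<phi>. Elements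
  of \<open>P'_grp r\<close> fix \<open>as\<close>, hence also every polynomial in
  \<open>as\<close>. For matrices with such entries the twist disappears and \<open>N\<close> is
  multiplicative. That all elements of \<open>P'_grp r\<close> have such matrices is checked on the
  generators and carried along by the subgroup \<open>poly_type r\<close>. Row reduction succeeds
  because C[a*] is Euclidean: a column with a left inverse is reduced by division with remainder to
  a single unit, and the units are the nonzero constants, which affine automorphisms supply. In the
  last claim the products of \<open>Aut0 r\<close> and \<open>P'_grp r\<close> need not form a
  subgroup, so the normal factor is the hull of \<open>P'_grp r\<close> under conjugation. It still
  meets \<open>Aut0 r\<close> trivially because it stays inside the normal subgroup
  \<open>K_c r\<close>.\<close>

lemma palg_eqI: "(\<And>p. coeff_at x p = coeff_at y p) \<Longrightarrow> x = y"
  unfolding coeff_at_def by (metis coeffs_inject poly_mapping_eqI)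

lemma coeff_at_add [simp]: "coeff_at (x + y) p = coeff_at x p + coeff_at y p"
  unfolding coeff_at_def by transfer (simp add: lookup_add)

lemma coeff_at_0 [simp]: "coeff_at 0 p = 0"
  unfolding coeff_at_def by transfer simp

lemma coeff_at_uminus [simp]: "coeff_at (- x) p = - coeff_at x p"
  unfolding coeff_at_def by transfer simp

lemma coeff_at_minus [simp]: "coeff_at (x - y) p = coeff_at x p - coeff_at y p"
  unfolding coeff_at_def by transfer (simp add: lookup_minus)

lemma coeff_at_cscale [simp]: "coeff_at (c *\<^sub>C x) p = c * coeff_at x p"
  unfolding coeff_at_def by transfer (simp add: Poly_Mapping.map.rep_eq when_def)

lemma coeff_at_sum [simp]: "coeff_at (sum f A) p = (\<Sum>i\<in>A. coeff_at (f i) p)"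
  by (induction A rule: infinite_finite_induct) auto

lemma coeff_at_of_path: "coeff_at (of_path q) p = (if p = q then 1 else 0)"
  unfolding coeff_at_def of_path_def by (auto simp: Palg_inverse lookup_single when_def)

lemma supp_iff: "p \<in> supp x \<longleftrightarrow> coeff_at x p \<noteq> 0"
  by (simp add: supp_def coeff_at_def in_keys_iff)

lemma finite_supp [simp]: "finite (supp x)"
  by (simp add: supp_def)

interpretation cs: vector_space cscale
  by unfold_locales (auto intro!: palg_eqI simp: algebra_simps)

lemma palg_expand: "x = (\<Sum>p\<in>supp x. coeff_at x p *\<^sub>C of_path p)"
  by (rule palg_eqI) (auto simp: coeff_at_of_path if_distrib sum.If_cases supp_iff cong: if_cong)

text \<open>The \<open>path\<close> case remembers that \<open>p\<close> lies in the support of the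
  element at the start, so support conditions such as membership in \<open>CQ_carrier r\<close> stay
  available inside the induction.\<close>

lemma palg_induct [case_names zero path add]:
  assumes "P 0" "\<And>c p. p \<in> supp x \<Longrightarrow> P (c *\<^sub>C of_path p)" "\<And>x y. P x \<Longrightarrow> P y \<Longrightarrow> P (x + y)"
  shows "P x"
proof -
  have "P (\<Sum>p\<in>A. coeff_at x p *\<^sub>C of_path p)" if "finite A" "A \<subseteq> supp x" for A
    using that by (induction A rule: finite_induct) (auto intro: assms)
  from this[OF _ subset_refl] show ?thesis using palg_expand[of x] by simp
qed

lemma of_path_mult:
  "of_path (t, w, s) * of_path (t', w', s') = (if s = t' then of_path (t, w @ w', s') else 0)"
  unfolding of_path_def
  by (simp add: times_palg.abs_eq eq_onp_def path_conv_single zero_palg_def)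

lemma cscale_Palg: "c *\<^sub>C Palg (Poly_Mapping.single p d) = Palg (Poly_Mapping.single p (c * d))"
  by (rule palg_eqI) (auto simp: coeff_at_def Palg_inverse lookup_single when_def cscale.rep_eq Poly_Mapping.map.rep_eq)

lemma cscale_mult_left [simp]: "(c *\<^sub>C x) * y = c *\<^sub>C (x * y)"
proof (induction x rule: palg_induct)
  case (path d p)
  show ?case
  proof (induction y rule: palg_induct)
    case (path d' q)
    show ?case
      by (cases p; cases q)
        (simp add: of_path_def cscale_Palg times_palg.abs_eq eq_onp_def path_conv_single
          zero_palg_def[symmetric] mult.assoc)
  qed (auto simp: algebra_simps cs.scale_right_distrib simp del: cs.scale_scale)
qed (auto simp: algebra_simps cs.scale_right_distrib)

lemma cscale_mult_right [simp]: "x * (c *\<^sub>C y) = c *\<^sub>C (x * y)"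
proof (induction x rule: palg_induct)
  case (path d p)
  show ?case
  proof (induction y rule: palg_induct)
    case (path d' q)
    show ?case
      by (cases p; cases q)
        (simp add: of_path_def cscale_Palg times_palg.abs_eq eq_onp_def path_conv_single
          zero_palg_def[symmetric] mult.left_commute)
  qed (auto simp: algebra_simps cs.scale_right_distrib simp del: cs.scale_scale)
qed (auto simp: algebra_simps cs.scale_right_distrib)

lemma one_eq_ee: "1 = e1 + e2"
  by (simp add: ee_def of_path_def one_palg_def plus_palg.abs_eq path_unit_def)

lemma ee_ee [simp]: "ee u * ee v = (if u = v then ee u else 0)"
  by (simp add: ee_def of_path_mult)

lemma ee_ee_mult [simp]: "ee u * (ee v * x) = (if u = v then ee u * x else 0)"
  by (simp add: mult.assoc[symmetric])

lemma ee_arr [simp]: "ee v * arr g = (if v = tgt g then arr g else 0)"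
  by (simp add: ee_def arr_def of_path_mult)

lemma arr_ee [simp]: "arr g * ee v = (if v = src g then arr g else 0)"
  by (simp add: ee_def arr_def of_path_mult)

lemma ee_arr_mult [simp]: "ee v * (arr g * x) = (if v = tgt g then arr g * x else 0)"
  by (simp add: mult.assoc[symmetric])

lemma arr_ee_mult [simp]: "arr g * (ee v * x) = (if v = src g then arr g * x else 0)"
  by (simp add: mult.assoc[symmetric])

lemma arr_arr [simp]: "src g \<noteq> tgt h \<Longrightarrow> arr g * arr h = 0"
  by (simp add: arr_def of_path_mult)

lemma arr_arr_mult [simp]: "src g \<noteq> tgt h \<Longrightarrow> arr g * (arr h * x) = 0"
  by (simp add: mult.assoc[symmetric])

lemma of_path_Cons: "of_path (tgt g, g # w, s) = arr g * of_path (src g, w, s)"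
  by (simp add: arr_def of_path_mult)

lemma of_path_Nil: "of_path (v, [], v) = ee v"
  by (simp add: ee_def)

lemma coeff_ee_mult: "coeff_at (ee v * x) (t, w, s) = (if v = t then coeff_at x (t, w, s) else 0)"
proof (induction x rule: palg_induct)
  case (path c p)
  then show ?case by (cases p) (auto simp: ee_def of_path_mult coeff_at_of_path)
qed (auto simp: algebra_simps)

lemma coeff_mult_ee: "coeff_at (x * ee v) (t, w, s) = (if v = s then coeff_at x (t, w, s) else 0)"
proof (induction x rule: palg_induct)
  case (path c p)
  then show ?case by (cases p) (auto simp: ee_def of_path_mult coeff_at_of_path)
qed (auto simp: algebra_simps)

text \<open>Prepending a letter to words is injective, so a product with an arrow can be read
  backwards. Freeness of the module on the \<open>bb \<alpha>\<close> and the centralizer argument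
  for \<open>as\<close> both come down to rules of this kind.\<close>

lemma coeff_arr_mult_Cons:
  "coeff_at (arr g * x) (t, h # w, s) =
     (if h = g \<and> t = tgt g then coeff_at x (src g, w, s) else 0)"
proof (induction x rule: palg_induct)
  case (path c p)
  then show ?case by (cases p) (auto simp: arr_def of_path_mult coeff_at_of_path)
qed (auto simp: algebra_simps)

lemma coeff_arr_mult_Nil: "coeff_at (arr g * x) (t, [], s) = 0"
proof (induction x rule: palg_induct)
  case (path c p)
  then show ?case by (cases p) (auto simp: arr_def of_path_mult coeff_at_of_path)
qed (auto simp: algebra_simps)

lemma coeff_mult_arr_snoc:
  "coeff_at (x * arr g) (t, w @ [h], s) =
     (if h = g \<and> s = src g then coeff_at x (t, w, tgt g) else 0)"
proof (induction x rule: palg_induct)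
  case (path c p)
  then show ?case by (cases p) (auto simp: arr_def of_path_mult coeff_at_of_path)
qed (auto simp: algebra_simps)

lemma coeff_mult_arr_Nil: "coeff_at (x * arr g) (t, [], s) = 0"
proof (induction x rule: palg_induct)
  case (path c p)
  then show ?case by (cases p) (auto simp: arr_def of_path_mult coeff_at_of_path)
qed (auto simp: algebra_simps)

lemma ee_left_iff: "ee v * x = x \<longleftrightarrow> (\<forall>(t, w, s)\<in>supp x. t = v)"
proof
  assume *: "ee v * x = x"
  show "\<forall>(t, w, s)\<in>supp x. t = v"
  proof clarify
    fix t w s assume "(t, w, s) \<in> supp x"
    then show "t = v" using coeff_ee_mult[of v x t w s, unfolded *] by (metis supp_iff)
  qed
next
  assume *: "\<forall>(t, w, s)\<in>supp x. t = v"
  show "ee v * x = x"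
  proof (rule palg_eqI)
    fix p show "coeff_at (ee v * x) p = coeff_at x p"
      using * by (cases p) (fastforce simp: coeff_ee_mult supp_iff)
  qed
qed

lemma ee_right_iff: "x * ee v = x \<longleftrightarrow> (\<forall>(t, w, s)\<in>supp x. s = v)"
proof
  assume *: "x * ee v = x"
  show "\<forall>(t, w, s)\<in>supp x. s = v"
  proof clarify
    fix t w s assume "(t, w, s) \<in> supp x"
    then show "s = v" using coeff_mult_ee[of x v t w s, unfolded *] by (metis supp_iff)
  qed
next
  assume *: "\<forall>(t, w, s)\<in>supp x. s = v"
  show "x * ee v = x"
  proof (rule palg_eqI)
    fix p show "coeff_at (x * ee v) p = coeff_at x p"
      using * by (cases p) (fastforce simp: coeff_mult_ee supp_iff)
  qed
qed

section \<open>The path algebra\<close>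

lemma CQ_iff: "x \<in> CQ_carrier r \<longleftrightarrow> (\<forall>p. coeff_at x p \<noteq> 0 \<longrightarrow> is_path r p)"
  by (auto simp: CQ_carrier_def supp_iff)

lemma CQ_0 [simp]: "0 \<in> CQ_carrier r"
  by (simp add: CQ_iff)

lemma CQ_add [simp]: "x \<in> CQ_carrier r \<Longrightarrow> y \<in> CQ_carrier r \<Longrightarrow> x + y \<in> CQ_carrier r"
  unfolding CQ_iff coeff_at_add by (metis add.right_neutral)

lemma CQ_uminus [simp]: "x \<in> CQ_carrier r \<Longrightarrow> - x \<in> CQ_carrier r"
  by (simp add: CQ_iff)

lemma CQ_minus [simp]: "x \<in> CQ_carrier r \<Longrightarrow> y \<in> CQ_carrier r \<Longrightarrow> x - y \<in> CQ_carrier r"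
  unfolding CQ_iff coeff_at_minus by (metis diff_zero)

lemma CQ_cscale [simp]: "x \<in> CQ_carrier r \<Longrightarrow> c *\<^sub>C x \<in> CQ_carrier r"
  by (simp add: CQ_iff)

lemma CQ_sum [simp]: "(\<And>i. i \<in> A \<Longrightarrow> f i \<in> CQ_carrier r) \<Longrightarrow> sum f A \<in> CQ_carrier r"
  by (induction A rule: infinite_finite_induct) auto

lemma CQ_of_path [simp]: "of_path p \<in> CQ_carrier r \<longleftrightarrow> is_path r p"
  by (simp add: CQ_iff coeff_at_of_path del: split_paired_All)

lemma CQ_ee [simp]: "ee v \<in> CQ_carrier r"
  by (simp add: ee_def)

lemma CQ_arr [simp]: "arr g \<in> CQ_carrier r \<longleftrightarrow> g \<in> arrows r"
  by (cases g) (auto simp: arr_def)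

lemma is_path_append: "is_path r (t, u, s) \<Longrightarrow> is_path r (s, v, s') \<Longrightarrow> is_path r (t, u @ v, s')"
  by (induction u arbitrary: t) auto

lemma CQ_mult [simp]:
  assumes "x \<in> CQ_carrier r" "y \<in> CQ_carrier r"
  shows "x * y \<in> CQ_carrier r"
proof (induction x rule: palg_induct)
  case (path c p)
  then have p: "is_path r p" using assms by (auto simp: CQ_carrier_def)
  show ?case
  proof (induction y rule: palg_induct)
    case (path d q)
    then have "is_path r q" using assms by (auto simp: CQ_carrier_def)
    with p show ?case by (cases p; cases q) (auto simp: of_path_mult is_path_append)
  qed (auto simp: algebra_simps)
qed (auto simp: algebra_simps)

lemma CQ_1 [simp]: "1 \<in> CQ_carrier r"
  by (simp add: one_eq_ee)

lemma CQ_power [simp]: "x \<in> CQ_carrier r \<Longrightarrow> x ^ n \<in> CQ_carrier r"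
  by (induction n) auto

lemma arrows_iff [simp]:
  "Arr_a \<in> arrows r" "Arr_as \<in> arrows r"
  "Arr_b i \<in> arrows r \<longleftrightarrow> 1 \<le> i \<and> i \<le> r" "Arr_d i \<in> arrows r \<longleftrightarrow> 1 \<le> i \<and> i \<le> r"
  by (auto simp: arrows_def)

lemma arrows_cases [consumes 1, case_names a as b d]:
  assumes "g \<in> arrows r"
  obtains "g = Arr_a" | "g = Arr_as" | i where "g = Arr_b i" "1 \<le> i" "i \<le> r"
    | i where "g = Arr_d i" "1 \<le> i" "i \<le> r"
  using assms by (auto simp: arrows_def)

lemma CQ_induct [consumes 1, case_names ee arr add mult scale]:
  assumes "x \<in> CQ_carrier r" "\<And>v. P (ee v)" "\<And>g. g \<in> arrows r \<Longrightarrow> P (arr g)"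
    "\<And>x y. x \<in> CQ_carrier r \<Longrightarrow> y \<in> CQ_carrier r \<Longrightarrow> P x \<Longrightarrow> P y \<Longrightarrow> P (x + y)"
    "\<And>x y. x \<in> CQ_carrier r \<Longrightarrow> y \<in> CQ_carrier r \<Longrightarrow> P x \<Longrightarrow> P y \<Longrightarrow> P (x * y)"
    "\<And>c x. x \<in> CQ_carrier r \<Longrightarrow> P x \<Longrightarrow> P (c *\<^sub>C x)"
  shows "P x"
proof -
  have pth: "P (of_path (t, w, s))" if "is_path r (t, w, s)" for t w s
    using that
  proof (induction w arbitrary: t)
    case Nil
    then show ?case using assms(2)[of s] by (simp add: ee_def)
  next
    case (Cons g w)
    then show ?case using assms(3)[of g] assms(5)[of "arr g" "of_path (src g, w, s)"]
      by (auto simp: of_path_Cons)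
  qed
  have P0: "P 0" using assms(6)[of e1 0] assms(2) by simp
  have "x \<in> CQ_carrier r \<and> P x"
  proof (induction x rule: palg_induct)
    case (path c p)
    then have "is_path r p" using assms(1) by (auto simp: CQ_carrier_def)
    then show ?case using path.hyps pth assms(6)[of "of_path p" c] by (cases p) auto
  qed (auto intro: P0 assms(4))
  then show ?thesis ..
qed

lemma ring_CQ: "ring (CQ r)"
proof (intro ringI abelian_groupI monoidI)
  fix x assume "x \<in> carrier (CQ r)"
  then show "\<exists>y\<in>carrier (CQ r). y \<oplus>\<^bsub>CQ r\<^esub> x = \<zero>\<^bsub>CQ r\<^esub>"
    by (intro bexI[of _ "- x"]) (auto simp: CQ_def)
qed (auto simp: CQ_def algebra_simps)

section \<open>Endomorphisms fixing the trivial paths\<close>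

text \<open>Bijectivity is left out so that substitutions can be studied before an inverse is known;
  \<open>Aut_iff\<close> adds it back. Extensionality turns agreement on the arrows into equality of
  functions.\<close>

definition is_end :: "nat \<Rightarrow> (palg \<Rightarrow> palg) \<Rightarrow> bool" where
  "is_end r \<psi> \<longleftrightarrow> \<psi> \<in> extensional (CQ_carrier r) \<and> \<psi> \<in> CQ_carrier r \<rightarrow> CQ_carrier r \<and>
     (\<forall>x\<in>CQ_carrier r. \<forall>y\<in>CQ_carrier r. \<psi> (x + y) = \<psi> x + \<psi> y \<and> \<psi> (x * y) = \<psi> x * \<psi> y) \<and>
     (\<forall>c. \<forall>x\<in>CQ_carrier r. \<psi> (c *\<^sub>C x) = c *\<^sub>C \<psi> x) \<and> \<psi> e1 = e1 \<and> \<psi> e2 = e2"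

lemma is_endD:
  assumes "is_end r \<psi>"
  shows "\<psi> \<in> extensional (CQ_carrier r)"
    and "\<And>x. x \<in> CQ_carrier r \<Longrightarrow> \<psi> x \<in> CQ_carrier r"
    and "\<And>x y. x \<in> CQ_carrier r \<Longrightarrow> y \<in> CQ_carrier r \<Longrightarrow> \<psi> (x + y) = \<psi> x + \<psi> y"
    and "\<And>x y. x \<in> CQ_carrier r \<Longrightarrow> y \<in> CQ_carrier r \<Longrightarrow> \<psi> (x * y) = \<psi> x * \<psi> y"
    and "\<And>c x. x \<in> CQ_carrier r \<Longrightarrow> \<psi> (c *\<^sub>C x) = c *\<^sub>C \<psi> x"
    and "\<psi> (ee v) = ee v" and "\<psi> 1 = 1" and "\<psi> 0 = 0"
    and "\<And>x. x \<in> CQ_carrier r \<Longrightarrow> \<psi> (- x) = - \<psi> x"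
    and "\<And>x y. x \<in> CQ_carrier r \<Longrightarrow> y \<in> CQ_carrier r \<Longrightarrow> \<psi> (x - y) = \<psi> x - \<psi> y"
proof -
  show "\<psi> \<in> extensional (CQ_carrier r)"
    and closed: "\<And>x. x \<in> CQ_carrier r \<Longrightarrow> \<psi> x \<in> CQ_carrier r"
    and add: "\<And>x y. x \<in> CQ_carrier r \<Longrightarrow> y \<in> CQ_carrier r \<Longrightarrow> \<psi> (x + y) = \<psi> x + \<psi> y"
    and "\<And>x y. x \<in> CQ_carrier r \<Longrightarrow> y \<in> CQ_carrier r \<Longrightarrow> \<psi> (x * y) = \<psi> x * \<psi> y"
    and scale: "\<And>c x. x \<in> CQ_carrier r \<Longrightarrow> \<psi> (c *\<^sub>C x) = c *\<^sub>C \<psi> x"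
    and e: "\<And>v. \<psi> (ee v) = ee v"
    subgoal using assms by (simp add: is_end_def)
    subgoal using assms by (auto simp: is_end_def)
    subgoal using assms by (simp add: is_end_def)
    subgoal using assms by (simp add: is_end_def)
    subgoal using assms by (simp add: is_end_def)
    subgoal for v using assms by (cases v) (simp_all add: is_end_def)
    done
  show "\<psi> 1 = 1" by (simp add: one_eq_ee add e)
  show "\<psi> 0 = 0" using scale[of 0 0] by simp
  show uminus: "\<psi> (- x) = - \<psi> x" if "x \<in> CQ_carrier r" for x
    using scale[of x "- 1"] that by simp
  show "\<psi> (x - y) = \<psi> x - \<psi> y" if "x \<in> CQ_carrier r" "y \<in> CQ_carrier r" for x y
    using add[of x "- y"] uminus[of y] that by simp
qed

lemma is_end_sum:
  assumes "is_end r \<psi>" "\<And>i. i \<in> A \<Longrightarrow> f i \<in> CQ_carrier r"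
  shows "\<psi> (sum f A) = (\<Sum>i\<in>A. \<psi> (f i))"
  using assms(2) by (induction A rule: infinite_finite_induct) (auto simp: is_endD[OF assms(1)])

lemma is_end_power:
  assumes "is_end r \<psi>" "x \<in> CQ_carrier r"
  shows "\<psi> (x ^ n) = \<psi> x ^ n"
  by (induction n) (auto simp: is_endD[OF assms(1)] assms(2))

lemma is_end_eqI:
  assumes "is_end r \<psi>" "is_end r \<phi>" "\<And>g. g \<in> arrows r \<Longrightarrow> \<psi> (arr g) = \<phi> (arr g)"
  shows "\<psi> = \<phi>"
proof (rule extensionalityI)
  fix x assume "x \<in> CQ_carrier r"
  then show "\<psi> x = \<phi> x"
    by (induction x rule: CQ_induct) (auto simp: is_endD[OF assms(1)] is_endD[OF assms(2)] assms(3))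
qed (use assms is_endD in auto)

lemma is_end_id: "is_end r (\<lambda>x\<in>CQ_carrier r. x)"
  by (simp add: is_end_def)

lemma is_end_compose:
  assumes "is_end r \<psi>" "is_end r \<phi>"
  shows "is_end r (compose (CQ_carrier r) \<psi> \<phi>)"
  using is_endD[OF assms(1)] is_endD[OF assms(2)] by (simp add: is_end_def compose_eq Pi_iff)

lemma Aut_iff: "\<psi> \<in> Aut r \<longleftrightarrow> is_end r \<psi> \<and> bij_betw \<psi> (CQ_carrier r) (CQ_carrier r)"
proof
  assume "\<psi> \<in> Aut r"
  then show "is_end r \<psi> \<and> bij_betw \<psi> (CQ_carrier r) (CQ_carrier r)"
    by (auto simp: Aut_def alg_auto_def is_end_def Bij_def CQ_def Ring.ring_hom_def clinear_on_def)
next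
  assume *: "is_end r \<psi> \<and> bij_betw \<psi> (CQ_carrier r) (CQ_carrier r)"
  then show "\<psi> \<in> Aut r"
    using is_endD[OF *[THEN conjunct1]]
    by (auto simp: Aut_def alg_auto_def Bij_def CQ_def Ring.ring_hom_def clinear_on_def)
qed

text \<open>Both composites agree with the identity on the generators, hence everywhere.\<close>

lemma AutI:
  assumes "is_end r \<psi>" "is_end r \<phi>"
    and "\<And>g. g \<in> arrows r \<Longrightarrow> \<psi> (\<phi> (arr g)) = arr g"
    and "\<And>g. g \<in> arrows r \<Longrightarrow> \<phi> (\<psi> (arr g)) = arr g"
  shows "\<psi> \<in> Aut r"
proof -
  have "compose (CQ_carrier r) \<psi> \<phi> = (\<lambda>x\<in>CQ_carrier r. x)"
    by (rule is_end_eqI[OF is_end_compose is_end_id]) (use assms in \<open>auto simp: compose_eq\<close>)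
  then have 1: "\<psi> (\<phi> x) = x" if "x \<in> CQ_carrier r" for x
    using that by (metis compose_eq restrict_apply')
  have "compose (CQ_carrier r) \<phi> \<psi> = (\<lambda>x\<in>CQ_carrier r. x)"
    by (rule is_end_eqI[OF is_end_compose is_end_id]) (use assms in \<open>auto simp: compose_eq\<close>)
  then have 2: "\<phi> (\<psi> x) = x" if "x \<in> CQ_carrier r" for x
    using that by (metis compose_eq restrict_apply')
  show ?thesis unfolding Aut_iff
    using assms(1,2) by (auto intro!: bij_betwI[where g = \<phi>] simp: 1 2 is_endD)
qed

section \<open>Extending an assignment on arrows to an endomorphism\<close>

definition good_subst :: "nat \<Rightarrow> (arrow \<Rightarrow> palg) \<Rightarrow> bool" where
  "good_subst r \<sigma> \<longleftrightarrow> (\<forall>g\<in>arrows r. \<sigma> g \<in> CQ_carrier r \<and> ee (tgt g) * \<sigma> g = \<sigma> g \<and> \<sigma> g * ee (src g) = \<sigma> g)"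

text \<open>A commutation rule instead of an absorption rule, because for the empty word the product
  is \<open>1\<close>, and \<open>ee t * 1\<close> is not \<open>1\<close>.\<close>

lemma subst_prod_ee:
  assumes "good_subst r \<sigma>" "is_path r (t, w, s)"
  shows "ee t * prod_list (map \<sigma> w) = prod_list (map \<sigma> w) * ee s"
  using assms(2)
proof (induction w arbitrary: t)
  case (Cons g w)
  then have g: "g \<in> arrows r" "tgt g = t" and IH: "ee (src g) * prod_list (map \<sigma> w) = prod_list (map \<sigma> w) * ee s"
    by auto
  have "ee t * prod_list (map \<sigma> (g # w)) = (ee t * \<sigma> g) * prod_list (map \<sigma> w)"
    by (simp add: mult.assoc)
  also have "ee t * \<sigma> g = \<sigma> g * ee (src g)" using assms(1) g by (auto simp: good_subst_def)
  finally show ?case by (simp add: mult.assoc IH)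
qed auto

lemma subst_path_ee: "ee t * subst_path \<sigma> (t, w, s) = subst_path \<sigma> (t, w, s)"
  "subst_path \<sigma> (t, w, s) * ee s = subst_path \<sigma> (t, w, s)"
  by (simp_all add: subst_path_def mult.assoc)

lemma subst_path_append:
  assumes "good_subst r \<sigma>" "is_path r (t, u, s)" "is_path r (s, v, s')"
  shows "subst_path \<sigma> (t, u @ v, s') = subst_path \<sigma> (t, u, s) * subst_path \<sigma> (s, v, s')"
proof -
  let ?P = "\<lambda>w. prod_list (map \<sigma> w)"
  have "subst_path \<sigma> (t, u, s) * subst_path \<sigma> (s, v, s') = ee t * ?P u * ee s * ?P v * ee s'"
    by (simp add: subst_path_def mult.assoc)
  also have "ee t * ?P u * ee s = ee t * ?P u"
    by (simp add: subst_prod_ee[OF assms(1,2)] mult.assoc)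
  finally show ?thesis by (simp add: subst_path_def mult.assoc)
qed

text \<open>The formula of \<open>subst_end\<close> without the restriction to the carrier:
  linearity then holds on the whole ambient ring, and only multiplicativity asks for paths.\<close>

definition subst_lin :: "(arrow \<Rightarrow> palg) \<Rightarrow> palg \<Rightarrow> palg" where
  "subst_lin \<sigma> x = (\<Sum>p\<in>supp x. coeff_at x p *\<^sub>C subst_path \<sigma> p)"

lemma subst_lin_superset:
  "finite A \<Longrightarrow> supp x \<subseteq> A \<Longrightarrow> subst_lin \<sigma> x = (\<Sum>p\<in>A. coeff_at x p *\<^sub>C subst_path \<sigma> p)"
  unfolding subst_lin_def by (rule sum.mono_neutral_left) (auto simp: supp_iff simp del: split_paired_All)

lemma subst_lin_add: "subst_lin \<sigma> (x + y) = subst_lin \<sigma> x + subst_lin \<sigma> y"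
proof -
  have "supp (x + y) \<subseteq> supp x \<union> supp y" by (auto simp: supp_iff)
  then show ?thesis
    by (subst (1 2 3) subst_lin_superset[where A = "supp x \<union> supp y"])
       (auto simp: sum.distrib cs.scale_left_distrib)
qed

lemma subst_lin_cscale: "subst_lin \<sigma> (c *\<^sub>C x) = c *\<^sub>C subst_lin \<sigma> x"
proof -
  have "supp (c *\<^sub>C x) \<subseteq> supp x" by (auto simp: supp_iff)
  then show ?thesis
    by (subst (1 2) subst_lin_superset[where A = "supp x"]) (auto simp: cs.scale_sum_right)
qed

lemma subst_lin_0: "subst_lin \<sigma> 0 = 0"
  by (simp add: subst_lin_def supp_iff)

lemma subst_lin_of_path: "subst_lin \<sigma> (of_path p) = subst_path \<sigma> p"
  by (subst subst_lin_superset[where A = "{p}"]) (auto simp: supp_iff coeff_at_of_path split: if_splits)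

lemma CQ_prod_list: "(\<And>x. x \<in> set l \<Longrightarrow> x \<in> CQ_carrier r) \<Longrightarrow> prod_list l \<in> CQ_carrier r"
  by (induction l) auto

lemma is_path_letters: "is_path r (t, w, s) \<Longrightarrow> g \<in> set w \<Longrightarrow> g \<in> arrows r"
  by (induction w arbitrary: t) auto

text \<open>The path algebra is free on its arrows over the span of \<open>e1\<close> and
  \<open>e2\<close>, so respecting end points is the only condition on \<sigma>. Composable paths
  multiply by \<open>subst_path_append\<close>; for other pairs both products vanish, as distinct
  trivial paths are orthogonal.\<close>

lemma is_end_subst_end:
  assumes "good_subst r \<sigma>"
  shows "is_end r (subst_end r \<sigma>)"
proof -
  have eq: "subst_end r \<sigma> x = subst_lin \<sigma> x" if "x \<in> CQ_carrier r" for x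
    using that by (simp add: subst_end_def subst_lin_def)
  have mult: "subst_lin \<sigma> (x * y) = subst_lin \<sigma> x * subst_lin \<sigma> y"
    if "x \<in> CQ_carrier r" "y \<in> CQ_carrier r" for x y
  proof (induction x rule: palg_induct)
    case (path c p)
    then have p: "is_path r p" using that by (auto simp: CQ_carrier_def)
    show ?case
    proof (induction y rule: palg_induct)
      case (path d q)
      then have q: "is_path r q" using that by (auto simp: CQ_carrier_def)
      obtain t u s where p': "p = (t, u, s)" by (cases p)
      obtain s' v m where q': "q = (s', v, m)" by (cases q)
      have zero: "subst_path \<sigma> p * subst_path \<sigma> q = 0" if "s \<noteq> s'"
      proof -
        have "subst_path \<sigma> p * subst_path \<sigma> q = (subst_path \<sigma> p * ee s) * (ee s' * subst_path \<sigma> q)"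
          by (simp only: p' q' subst_path_ee)
        also have "\<dots> = subst_path \<sigma> p * (ee s * (ee s' * subst_path \<sigma> q))"
          by (simp only: mult.assoc)
        finally show ?thesis using that by simp
      qed
      then show ?case using subst_path_append[OF assms, of t u s v m] p q zero[unfolded p' q']
        by (auto simp: p' q' of_path_mult subst_lin_cscale subst_lin_of_path subst_lin_0)
    qed (auto simp: algebra_simps subst_lin_add subst_lin_0)
  qed (auto simp: algebra_simps subst_lin_add subst_lin_0)
  have path: "subst_path \<sigma> p \<in> CQ_carrier r" if "is_path r p" for p
  proof -
    obtain t w s where p: "p = (t, w, s)" by (cases p)
    have "\<sigma> g \<in> CQ_carrier r" if "g \<in> set w" for g
      using is_path_letters[of r t w s g] that assms \<open>is_path r p\<close> by (simp add: p good_subst_def)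
    then show ?thesis unfolding p by (auto simp: subst_path_def intro!: CQ_mult CQ_prod_list)
  qed
  have closed: "subst_lin \<sigma> x \<in> CQ_carrier r" if "x \<in> CQ_carrier r" for x
  proof -
    have "is_path r p" if "p \<in> supp x" for p
      using that \<open>x \<in> CQ_carrier r\<close> unfolding CQ_carrier_def by blast
    then show ?thesis unfolding subst_lin_def by (intro CQ_sum CQ_cscale path)
  qed
  have ee: "subst_lin \<sigma> (ee v) = ee v" for v
    by (simp add: ee_def subst_lin_of_path) (simp add: subst_path_def of_path_Nil)
  show ?thesis unfolding is_end_def
    by (auto simp: eq mult closed ee subst_lin_add subst_lin_cscale) (auto simp: subst_end_def)
qed

lemma subst_end_arr:
  assumes "good_subst r \<sigma>" "g \<in> arrows r"
  shows "subst_end r \<sigma> (arr g) = \<sigma> g"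
proof -
  have "subst_end r \<sigma> (arr g) = subst_lin \<sigma> (arr g)"
    using assms(2) by (simp add: subst_end_def subst_lin_def)
  also have "\<dots> = \<sigma> g"
    using assms by (simp add: arr_def subst_lin_of_path) (simp add: subst_path_def good_subst_def)
  finally show ?thesis .
qed

text \<open>An endomorphism fixing \<open>e1\<close> and \<open>e2\<close> respects end points by
  itself, so \<open>good_subst\<close> is a conclusion here. This identifies a substitution with an
  automorphism obtained in another way, as is done for \<open>Lam'\<close> and for
  \<open>Aut0 r\<close>.\<close>

lemma subst_end_eqI:
  assumes "is_end r \<psi>" "\<And>g. g \<in> arrows r \<Longrightarrow> \<psi> (arr g) = \<sigma> g"
  shows "subst_end r \<sigma> = \<psi>" "good_subst r \<sigma>"
proof -
  show good: "good_subst r \<sigma>"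
    unfolding good_subst_def
  proof (intro ballI conjI)
    fix g assume g: "g \<in> arrows r"
    show "\<sigma> g \<in> CQ_carrier r" using g is_endD(2)[OF assms(1), of "arr g"] assms(2) by simp
    show "ee (tgt g) * \<sigma> g = \<sigma> g" using g is_endD(4,6)[OF assms(1)] assms(2)[OF g, symmetric]
      by (metis CQ_arr CQ_ee ee_arr)
    show "\<sigma> g * ee (src g) = \<sigma> g" using g is_endD(4,6)[OF assms(1)] assms(2)[OF g, symmetric]
      by (metis CQ_arr CQ_ee arr_ee)
  qed
  show "subst_end r \<sigma> = \<psi>"
    by (rule is_end_eqI[OF is_end_subst_end[OF good] assms(1)]) (simp add: subst_end_arr good assms(2))
qed

section \<open>Symplectic automorphisms\<close>

text \<open>The sign in \<open>xx\<close> gives the odd indices the same summand as the even ones.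
  Passing from \<open>r\<close> to \<open>Suc r\<close> lengthens exactly one of the two sums: the
  first if \<open>r\<close> is even, the second if \<open>r\<close> is odd.\<close>

lemma c_elem_eq:
  "c_elem r = comm aa as + (\<Sum>\<alpha>\<in>{1..r}. bb \<alpha> * dd \<alpha> - dd \<alpha> * bb \<alpha>)"
proof -
  let ?f = "\<lambda>\<alpha>. bb \<alpha> * dd \<alpha> - dd \<alpha> * bb \<alpha>"
  have "(\<Sum>i = 1..(r + 1) div 2. comm (xx i) (xs i)) + (\<Sum>j = 1..r div 2. comm (yy j) (ys j)) = sum ?f {1..r}"
  proof (induction r)
    case (Suc r)
    show ?case
    proof (cases "even r")
      case True
      then obtain m where "r = 2 * m" by (elim evenE)
      then show ?thesis using Suc by (simp add: comm_def xx_def xs_def)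
    next
      case False
      then obtain m where "r = 2 * m + 1" by (elim oddE)
      then show ?thesis using Suc by (simp add: comm_def yy_def ys_def add.assoc)
    qed
  qed simp
  then show ?thesis by (simp add: c_elem_def add.assoc)
qed

lemma CQ_c_elem [simp]: "c_elem r \<in> CQ_carrier r"
  by (auto simp: c_elem_eq comm_def intro!: CQ_add CQ_minus CQ_sum CQ_mult)

lemma is_end_c_elem:
  assumes "is_end r \<psi>"
  shows "\<psi> (c_elem r) = comm (\<psi> aa) (\<psi> as)
    + (\<Sum>\<alpha>\<in>{1..r}. \<psi> (bb \<alpha>) * \<psi> (dd \<alpha>) - \<psi> (dd \<alpha>) * \<psi> (bb \<alpha>))"
proof -
  have "\<psi> (\<Sum>\<alpha>\<in>{1..r}. bb \<alpha> * dd \<alpha> - dd \<alpha> * bb \<alpha>) = (\<Sum>\<alpha>\<in>{1..r}. \<psi> (bb \<alpha> * dd \<alpha> - dd \<alpha> * bb \<alpha>))"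
    by (rule is_end_sum[OF assms]) auto
  also have "\<dots> = (\<Sum>\<alpha>\<in>{1..r}. \<psi> (bb \<alpha>) * \<psi> (dd \<alpha>) - \<psi> (dd \<alpha>) * \<psi> (bb \<alpha>))"
    by (intro sum.cong refl) (simp add: is_endD[OF assms])
  finally show ?thesis
    unfolding c_elem_eq comm_def
    by (subst is_endD(3)[OF assms]) (auto simp: is_endD[OF assms] intro!: CQ_sum)
qed

lemma Symp_iff:
  "\<psi> \<in> Symp r \<longleftrightarrow> is_end r \<psi> \<and> bij_betw \<psi> (CQ_carrier r) (CQ_carrier r) \<and> \<psi> (c_elem r) = c_elem r"
  by (auto simp: Symp_def Aut_iff)

lemma is_end_inv_into:
  assumes "is_end r \<psi>" "bij_betw \<psi> (CQ_carrier r) (CQ_carrier r)"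
  shows "is_end r (restrict (inv_into (CQ_carrier r) \<psi>) (CQ_carrier r))"
proof -
  let ?i = "inv_into (CQ_carrier r) \<psi>"
  have i: "?i y \<in> CQ_carrier r" "\<psi> (?i y) = y" if "y \<in> CQ_carrier r" for y
    using assms(2) that by (auto simp: bij_betw_def inv_into_into f_inv_into_f)
  have inv: "?i y = x" if "\<psi> x = y" "x \<in> CQ_carrier r" for x y
    using assms(2) that by (auto simp: bij_betw_def)
  show ?thesis unfolding is_end_def
    by (auto simp: i is_endD[OF assms(1)] intro!: inv)
qed

lemma Symp_subgroup: "subgroup (Symp r) (BijGroup (CQ_carrier r))"
proof (rule group.subgroupI[OF group_BijGroup])
  show "Symp r \<subseteq> carrier (BijGroup (CQ_carrier r))"
    by (auto simp: Symp_iff BijGroup_def Bij_def is_endD)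
  have "(\<lambda>x\<in>CQ_carrier r. x) \<in> Symp r"
    using id_Bij[of "CQ_carrier r"] by (auto simp: Symp_iff is_end_id Bij_def)
  then show "Symp r \<noteq> {}" by blast
next
  fix \<psi> assume \<psi>: "\<psi> \<in> Symp r"
  then have B: "\<psi> \<in> Bij (CQ_carrier r)" by (auto simp: Symp_iff Bij_def is_endD)
  have "inv\<^bsub>BijGroup (CQ_carrier r)\<^esub> \<psi> = restrict (inv_into (CQ_carrier r) \<psi>) (CQ_carrier r)"
    by (rule inv_BijGroup[OF B])
  moreover have "inv_into (CQ_carrier r) \<psi> (c_elem r) = c_elem r"
    using \<psi> by (metis (no_types) CQ_c_elem Symp_iff bij_betw_def inv_into_f_f)
  ultimately show "inv\<^bsub>BijGroup (CQ_carrier r)\<^esub> \<psi> \<in> Symp r"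
    using restrict_inv_into_Bij[OF B] \<psi> is_end_inv_into[of r \<psi>] by (auto simp: Symp_iff Bij_def)
next
  fix \<psi> \<phi> assume *: "\<psi> \<in> Symp r" "\<phi> \<in> Symp r"
  then have B: "\<psi> \<in> Bij (CQ_carrier r)" "\<phi> \<in> Bij (CQ_carrier r)" by (auto simp: Symp_iff Bij_def is_endD)
  then show "\<psi> \<otimes>\<^bsub>BijGroup (CQ_carrier r)\<^esub> \<phi> \<in> Symp r"
    using * compose_Bij[OF B] by (auto simp: BijGroup_def Symp_iff is_end_compose compose_eq Bij_def)
qed

lemma carrier_SympGrp [simp]: "carrier (SympGrp r) = Symp r"
  by (simp add: SympGrp_def)

lemma group_SympGrp: "group (SympGrp r)"
  unfolding SympGrp_def by (rule subgroup.subgroup_is_group[OF Symp_subgroup group_BijGroup])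

lemma one_SympGrp: "\<one>\<^bsub>SympGrp r\<^esub> = (\<lambda>x\<in>CQ_carrier r. x)"
  by (simp add: SympGrp_def BijGroup_def)

lemma Symp_end: "\<psi> \<in> Symp r \<Longrightarrow> is_end r \<psi>"
  by (simp add: Symp_iff)

lemma mult_SympGrp:
  assumes "\<psi> \<in> Symp r" "\<phi> \<in> Symp r"
  shows "\<psi> \<otimes>\<^bsub>SympGrp r\<^esub> \<phi> = compose (CQ_carrier r) \<psi> \<phi>"
proof -
  have "\<psi> \<in> Bij (CQ_carrier r)" "\<phi> \<in> Bij (CQ_carrier r)"
    using assms by (auto simp: Symp_iff Bij_def is_endD)
  then show ?thesis by (simp add: SympGrp_def BijGroup_def)
qed

lemma mult_SympGrp_apply:
  "\<lbrakk>\<psi> \<in> Symp r; \<phi> \<in> Symp r; x \<in> CQ_carrier r\<rbrakk> \<Longrightarrow> (\<psi> \<otimes>\<^bsub>SympGrp r\<^esub> \<phi>) x = \<psi> (\<phi> x)"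
  by (simp add: mult_SympGrp compose_eq)

lemma inv_SympGrp_apply:
  assumes "\<psi> \<in> Symp r" "x \<in> CQ_carrier r"
  shows "(inv\<^bsub>SympGrp r\<^esub> \<psi>) (\<psi> x) = x" "\<psi> ((inv\<^bsub>SympGrp r\<^esub> \<psi>) x) = x"
proof -
  interpret group "SympGrp r" by (rule group_SympGrp)
  have i: "inv\<^bsub>SympGrp r\<^esub> \<psi> \<in> Symp r" using assms inv_closed by simp
  show "(inv\<^bsub>SympGrp r\<^esub> \<psi>) (\<psi> x) = x"
    using mult_SympGrp_apply[OF i assms(1,2)] assms l_inv[of \<psi>] by (simp add: one_SympGrp)
  show "\<psi> ((inv\<^bsub>SympGrp r\<^esub> \<psi>) x) = x"
    using mult_SympGrp_apply[OF assms(1) i assms(2)] assms r_inv[of \<psi>] by (simp add: one_SympGrp)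
qed

lemma inv_Symp: "\<psi> \<in> Symp r \<Longrightarrow> inv\<^bsub>SympGrp r\<^esub> \<psi> \<in> Symp r"
  using group.inv_closed[OF group_SympGrp, of \<psi> r] by simp

lemma mult_Symp: "\<psi> \<in> Symp r \<Longrightarrow> \<phi> \<in> Symp r \<Longrightarrow> \<psi> \<otimes>\<^bsub>SympGrp r\<^esub> \<phi> \<in> Symp r"
  using monoid.m_closed[OF group.is_monoid[OF group_SympGrp], of \<psi> r \<phi>] by simp

section \<open>Reduced automorphisms\<close>

lemma ideal_CQI:
  assumes "S \<subseteq> CQ_carrier r" "0 \<in> S" "\<And>x y. x \<in> S \<Longrightarrow> y \<in> S \<Longrightarrow> x + y \<in> S"
    and "\<And>x y. x \<in> S \<Longrightarrow> y \<in> CQ_carrier r \<Longrightarrow> x * y \<in> S \<and> y * x \<in> S"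
  shows "ideal S (CQ r)"
proof (rule idealI[OF ring_CQ])
  interpret ring "CQ r" by (rule ring_CQ)
  have uminus: "inv\<^bsub>add_monoid (CQ r)\<^esub> x = - x" if "x \<in> S" for x
    using minus_equality[of "- x" x] that assms(1) by (auto simp: CQ_def a_inv_def)
  have "- x \<in> S" if "x \<in> S" for x
    using assms(4)[OF that, of "- 1"] by simp
  with uminus assms(1-3) show "subgroup S (add_monoid (CQ r))"
    by (intro subgroup.intro) (auto simp: CQ_def)
qed (use assms in \<open>auto simp: CQ_def\<close>)

text \<open>The coefficients at words in the two loops describe the image of \<open>x\<close> in the
  quotient by \<open>I_ideal r\<close>, a free algebra.\<close>

abbreviation free_part_zero :: "palg \<Rightarrow> bool" where
  "free_part_zero x \<equiv> \<forall>w\<in>lists {Arr_a, Arr_as}. coeff_at x (V1, w, V1) = 0"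

text \<open>A prefix or suffix of a word in the loops is again such a word, so no other words of
  \<open>x\<close> contribute. \<open>x\<close> is generalised because the case of a product applies
  the hypotheses to \<open>x * y\<close> and \<open>z * x\<close>.\<close>

lemma free_part_zero_mult:
  assumes "y \<in> CQ_carrier r" "free_part_zero x"
  shows "free_part_zero (x * y) \<and> free_part_zero (y * x)"
  using assms
proof (induction y arbitrary: x rule: CQ_induct)
  case (ee v)
  then show ?case by (auto simp: coeff_ee_mult coeff_mult_ee)
next
  case (arr g)
  show ?case
  proof (intro conjI ballI)
    fix w assume w: "w \<in> lists {Arr_a, Arr_as}"
    show "coeff_at (x * arr g) (V1, w, V1) = 0"
      using w arr by (cases w rule: rev_cases) (auto simp: coeff_mult_arr_Nil coeff_mult_arr_snoc)
    show "coeff_at (arr g * x) (V1, w, V1) = 0"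
      using w arr by (cases w) (auto simp: coeff_arr_mult_Nil coeff_arr_mult_Cons)
  qed
next
  case (mult y z)
  have "free_part_zero ((x * y) * z)" "free_part_zero (y * (z * x))"
    using mult by blast+
  then show ?case by (simp add: mult.assoc)
qed (simp_all add: algebra_simps)

text \<open>One inclusion holds because the right-hand side is an ideal containing the generators.
  For the other, a path that is not a word in the loops at \<open>V1\<close> is trivial at
  \<open>V2\<close> or has some \<open>bb i\<close> or \<open>dd i\<close> as a factor.\<close>

lemma I_ideal_iff: "x \<in> I_ideal r \<longleftrightarrow> x \<in> CQ_carrier r \<and> free_part_zero x"
proof -
  interpret ring "CQ r" by (rule ring_CQ)
  let ?G = "{e2} \<union> dd ` {1..r} \<union> bb ` {1..r}" and ?J = "{x \<in> CQ_carrier r. free_part_zero x}"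
  have G: "?G \<subseteq> carrier (CQ r)" by (auto simp: CQ_def)
  interpret I: ideal "I_ideal r" "CQ r" unfolding I_ideal_def by (rule genideal_ideal[OF G])
  have gen: "?G \<subseteq> I_ideal r" unfolding I_ideal_def by (rule genideal_self[OF G])
  have add: "x + y \<in> I_ideal r" if "x \<in> I_ideal r" "y \<in> I_ideal r" for x y
    using I.a_closed[OF that] by (simp add: CQ_def)
  have mult: "x * y \<in> I_ideal r" "y * x \<in> I_ideal r" if "x \<in> I_ideal r" "y \<in> CQ_carrier r" for x y
    using I.I_r_closed[of x y] I.I_l_closed[of x y] that by (auto simp: CQ_def)
  have scale: "c *\<^sub>C x \<in> I_ideal r" if "x \<in> I_ideal r" for c x
    using mult(2)[OF that, of "c *\<^sub>C 1"] by simp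
  have path: "of_path (t, w, s) \<in> I_ideal r"
    if "is_path r (t, w, s)" "\<not> (t = V1 \<and> s = V1 \<and> w \<in> lists {Arr_a, Arr_as})" for t w s
    using that
  proof (induction w arbitrary: t)
    case Nil
    then have "t = V2" "s = V2" using vertex.exhaust by auto
    then show ?case using gen by (simp add: of_path_Nil)
  next
    case (Cons g w)
    then have g: "g \<in> arrows r" "t = tgt g" "is_path r (src g, w, s)" by auto
    show ?case
    proof (cases "g \<in> {Arr_a, Arr_as}")
      case True
      then have "of_path (src g, w, s) \<in> I_ideal r" using Cons g by auto
      then show ?thesis using mult(2)[of _ "arr g"] g by (simp add: of_path_Cons)
    next
      case False
      then have "arr g \<in> I_ideal r" using g(1) gen by (auto elim!: arrows_cases)
      then show ?thesis using mult(1)[of "arr g" "of_path (src g, w, s)"] g by (simp add: of_path_Cons)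
    qed
  qed
  have "ideal ?J (CQ r)"
    by (rule ideal_CQI) (use free_part_zero_mult in auto)
  moreover have "?G \<subseteq> ?J"
    by (auto simp: ee_def arr_def coeff_at_of_path)
  ultimately have "I_ideal r \<subseteq> ?J" unfolding I_ideal_def by (rule genideal_minimal)
  moreover have "x \<in> I_ideal r" if x: "x \<in> ?J" for x
  proof -
    have op: "of_path p \<in> I_ideal r" if p: "p \<in> supp x" for p
    proof -
      obtain t w s where [simp]: "p = (t, w, s)" by (cases p)
      show ?thesis unfolding \<open>p = _\<close>
      proof (rule path)
        show "is_path r (t, w, s)" using x p unfolding CQ_carrier_def by auto
        show "\<not> (t = V1 \<and> s = V1 \<and> w \<in> lists {Arr_a, Arr_as})" using x p by (auto simp: supp_iff)
      qed
    qed
    have "(\<Sum>p\<in>A. coeff_at x p *\<^sub>C of_path p) \<in> I_ideal r" if "A \<subseteq> supp x" "finite A" for A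
      using that(2,1) I.zero_closed
      by (induction A rule: finite_induct) (auto simp: CQ_def intro!: add scale op)
    from this[OF subset_refl] show ?thesis using palg_expand[of x] by simp
  qed
  ultimately show ?thesis by blast
qed

lemma I_ideal_mult:
  "x \<in> I_ideal r \<Longrightarrow> y \<in> CQ_carrier r \<Longrightarrow> x * y \<in> I_ideal r"
  "x \<in> I_ideal r \<Longrightarrow> y \<in> CQ_carrier r \<Longrightarrow> y * x \<in> I_ideal r"
  using free_part_zero_mult by (auto simp: I_ideal_iff)

lemma I_ideal_add: "x \<in> I_ideal r \<Longrightarrow> y \<in> I_ideal r \<Longrightarrow> x + y \<in> I_ideal r"
  by (auto simp: I_ideal_iff)

text \<open>As \<psi> fixes \<open>e2\<close>, the images of \<open>bb i = e2 * bb i\<close> and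
  \<open>dd i = dd i * e2\<close> stay in the ideal generated by \<open>e2\<close>.\<close>

lemma is_end_I_ideal:
  assumes "is_end r \<psi>" "x \<in> I_ideal r"
  shows "\<psi> x \<in> I_ideal r"
proof -
  interpret ring "CQ r" by (rule ring_CQ)
  note * = is_endD[OF assms(1)]
  let ?S = "{x \<in> CQ_carrier r. \<psi> x \<in> I_ideal r}"
  have e2: "e2 \<in> I_ideal r" by (simp add: I_ideal_iff) (simp add: ee_def coeff_at_of_path)
  have "ideal ?S (CQ r)"
    by (rule ideal_CQI) (auto simp: * I_ideal_mult, auto simp: I_ideal_iff)
  moreover have "{e2} \<union> dd ` {1..r} \<union> bb ` {1..r} \<subseteq> ?S"
  proof -
    have "\<psi> (bb i) = e2 * \<psi> (bb i)" "\<psi> (dd i) = \<psi> (dd i) * e2" if "i \<in> {1..r}" for i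
      using *(4)[of e2 "bb i"] *(4)[of "dd i" e2] that by (auto simp: *)
    then have "\<psi> (bb i) \<in> I_ideal r" "\<psi> (dd i) \<in> I_ideal r" if "i \<in> {1..r}" for i
      using I_ideal_mult[OF e2] that *(2) by (metis CQ_arr arrows_iff(3,4) atLeastAtMost_iff)+
    then show ?thesis using e2 by (auto simp: *)
  qed
  ultimately show ?thesis
    using genideal_minimal assms(2) unfolding I_ideal_def by blast
qed

text \<open>Congruence to the identity modulo an ideal passes to sums and products, so it can be
  tested on arrows; the arrows \<open>bb i\<close>, \<open>dd i\<close> and their images lie in the
  ideal anyway.\<close>

lemma is_reduced_iff:
  assumes "is_end r \<psi>"
  shows "is_reduced r \<psi> \<longleftrightarrow> \<psi> aa - aa \<in> I_ideal r \<and> \<psi> as - as \<in> I_ideal r"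
proof
  note * = is_endD[OF assms]
  assume red: "\<psi> aa - aa \<in> I_ideal r \<and> \<psi> as - as \<in> I_ideal r"
  show "is_reduced r \<psi>"
    unfolding is_reduced_def
  proof
    fix x assume "x \<in> CQ_carrier r"
    then show "\<psi> x - x \<in> I_ideal r"
    proof (induction x rule: CQ_induct)
      case (ee v)
      then show ?case by (simp add: * I_ideal_iff)
    next
      case (arr g)
      have gen: "arr g \<in> I_ideal r" if "src g = V2 \<or> tgt g = V2"
        using that arr by (auto simp: I_ideal_iff arr_def coeff_at_of_path)
      have "\<psi> (arr g) - arr g \<in> I_ideal r" if "src g = V2 \<or> tgt g = V2"
        using gen[OF that] is_end_I_ideal[OF assms gen[OF that]] by (auto simp: I_ideal_iff)
      then show ?case using red arr by (cases g) auto
    next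
      case (add x y)
      then show ?case by (auto simp: * I_ideal_iff)
    next
      case (mult x y)
      have "\<psi> (x * y) - x * y = (\<psi> x - x) * \<psi> y + x * (\<psi> y - y)"
        using mult by (simp add: * algebra_simps)
      moreover have "(\<psi> x - x) * \<psi> y \<in> I_ideal r" "x * (\<psi> y - y) \<in> I_ideal r"
        using mult.hyps mult.IH by (simp_all add: I_ideal_mult *(2))
      ultimately show ?case by (auto simp: I_ideal_iff)
    next
      case (scale c x)
      then show ?case by (auto simp: * I_ideal_iff)
    qed
  qed
qed (auto simp: is_reduced_def)

lemma K_c_subgroup: "subgroup (K_c r) (SympGrp r)"
proof (rule group.subgroupI[OF group_SympGrp])
  have "\<one>\<^bsub>SympGrp r\<^esub> \<in> K_c r"
    using monoid.one_closed[OF group.is_monoid[OF group_SympGrp[of r]]]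
    by (auto simp: K_c_def is_reduced_def one_SympGrp I_ideal_iff)
  then show "K_c r \<noteq> {}" by blast
next
  fix \<psi> assume \<psi>: "\<psi> \<in> K_c r"
  then have S: "\<psi> \<in> Symp r" by (simp add: K_c_def)
  let ?\<phi> = "inv\<^bsub>SympGrp r\<^esub> \<psi>"
  have "?\<phi> x - x \<in> I_ideal r" if "x \<in> CQ_carrier r" for x
  proof -
    have c: "?\<phi> x \<in> CQ_carrier r" using is_endD(2)[OF Symp_end[OF inv_Symp[OF S]]] that .
    then have "\<psi> (?\<phi> x) - ?\<phi> x \<in> I_ideal r" using \<psi> by (auto simp: K_c_def is_reduced_def)
    then show ?thesis using inv_SympGrp_apply(2)[OF S that] CQ_minus[OF c that] by (auto simp: I_ideal_iff)
  qed
  then show "?\<phi> \<in> K_c r" using inv_Symp[OF S] by (simp add: K_c_def is_reduced_def)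
next
  fix \<psi> \<phi> assume *: "\<psi> \<in> K_c r" "\<phi> \<in> K_c r"
  then have S: "\<psi> \<in> Symp r" "\<phi> \<in> Symp r" by (auto simp: K_c_def)
  have "(\<psi> \<otimes>\<^bsub>SympGrp r\<^esub> \<phi>) x - x \<in> I_ideal r" if "x \<in> CQ_carrier r" for x
  proof -
    have "\<phi> x \<in> CQ_carrier r" using is_endD(2)[OF Symp_end[OF S(2)]] that .
    then have "\<psi> (\<phi> x) - \<phi> x \<in> I_ideal r" "\<phi> x - x \<in> I_ideal r"
      using * that by (auto simp: K_c_def is_reduced_def)
    from I_ideal_add[OF this] show ?thesis using mult_SympGrp_apply[OF S that] by simp
  qed
  then show "\<psi> \<otimes>\<^bsub>SympGrp r\<^esub> \<phi> \<in> K_c r" using mult_Symp[OF S] by (simp add: K_c_def is_reduced_def)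
qed (auto simp: K_c_def)

text \<open>Normality of \<open>K_c r\<close> holds because \<psi>0 maps the ideal into itself: with
  \<open>y\<close> the preimage of \<open>x\<close>, the difference at \<open>x\<close> is the image
  under \<psi>0 of the difference at \<open>y\<close>. This keeps the conjugates of
  \<open>P'_grp r\<close> inside \<open>K_c r\<close>.\<close>

lemma K_c_conj:
  assumes "\<psi>0 \<in> Symp r" "\<psi> \<in> K_c r"
  shows "\<psi>0 \<otimes>\<^bsub>SympGrp r\<^esub> \<psi> \<otimes>\<^bsub>SympGrp r\<^esub> inv\<^bsub>SympGrp r\<^esub> \<psi>0 \<in> K_c r" (is "?c \<in> _")
proof -
  have S: "\<psi> \<in> Symp r" "inv\<^bsub>SympGrp r\<^esub> \<psi>0 \<in> Symp r" "\<psi>0 \<otimes>\<^bsub>SympGrp r\<^esub> \<psi> \<in> Symp r"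
    using assms by (auto simp: K_c_def inv_Symp mult_Symp)
  have "?c x - x \<in> I_ideal r" if x: "x \<in> CQ_carrier r" for x
  proof -
    define y where "y = (inv\<^bsub>SympGrp r\<^esub> \<psi>0) x"
    have y: "y \<in> CQ_carrier r" unfolding y_def using is_endD(2)[OF Symp_end[OF S(2)]] x .
    have py: "\<psi> y \<in> CQ_carrier r" using is_endD(2)[OF Symp_end[OF S(1)]] y .
    have "?c x = \<psi>0 (\<psi> y)"
      using S assms x y by (simp add: mult_SympGrp_apply y_def)
    moreover have "\<psi>0 y = x" unfolding y_def using assms(1) x by (rule inv_SympGrp_apply)
    ultimately have "?c x - x = \<psi>0 (\<psi> y - y)"
      using is_endD(10)[OF Symp_end[OF assms(1)] py y] by simp
    moreover have "\<psi> y - y \<in> I_ideal r" using assms(2) y by (auto simp: K_c_def is_reduced_def)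
    ultimately show ?thesis using is_end_I_ideal[OF Symp_end[OF assms(1)]] by simp
  qed
  then show ?thesis using mult_Symp[OF S(3,2)] by (simp add: K_c_def is_reduced_def)
qed

section \<open>Rigidity of reduced symplectic automorphisms\<close>

text \<open>Commuting with \<open>a*\<close> lets a trailing \<open>a*\<close> of a word be moved to its front without changing the coefficient.\<close>

lemma centralizer_as:
  assumes comm: "as * z = z * as" and z: "e1 * z = z" "z * e1 = z"
    and zero: "\<And>n. coeff_at z (V1, replicate n Arr_as, V1) = 0"
  shows "z = 0"
proof -
  have *: "coeff_at z (V1, u @ g # replicate k Arr_as, V1) = 0" if "g \<noteq> Arr_as" for u g k
  proof (induction k arbitrary: u)
    case 0
    \<comment> \<open>Base of the induction: all words of \<open>z * as\<close> end in
      \<open>Arr_as\<close>, so this coefficient vanishes.\<close>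
    have "coeff_at z (V1, u @ [g], V1) = coeff_at (as * z) (V1, Arr_as # u @ [g], V1)"
      by (simp add: coeff_arr_mult_Cons)
    also have "\<dots> = 0"
      unfolding comm using coeff_mult_arr_snoc[of z Arr_as V1 "Arr_as # u" g V1] that by simp
    finally show ?case by simp
  next
    case (Suc k)
    let ?v = "u @ g # replicate k Arr_as"
    have "u @ g # replicate (Suc k) Arr_as = ?v @ [Arr_as]"
      by (simp add: replicate_append_same)
    then have "coeff_at z (V1, u @ g # replicate (Suc k) Arr_as, V1)
        = coeff_at (as * z) (V1, Arr_as # ?v @ [Arr_as], V1)"
      by (simp add: coeff_arr_mult_Cons)
    also have "\<dots> = coeff_at z (V1, Arr_as # ?v, V1)"
      unfolding comm using coeff_mult_arr_snoc[of z Arr_as V1 "Arr_as # ?v" Arr_as V1] by simp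
    also have "\<dots> = 0" using Suc[of "Arr_as # u"] by simp
    finally show ?case .
  qed
  have words: "(\<exists>n. w = replicate n Arr_as) \<or> (\<exists>u g k. g \<noteq> Arr_as \<and> w = u @ g # replicate k Arr_as)" for w
  proof (induction w)
    case (Cons h w)
    then show ?case
    proof (elim disjE exE conjE)
      fix n assume w: "w = replicate n Arr_as"
      show ?thesis
      proof (cases "h = Arr_as")
        case True
        then show ?thesis using w by (intro disjI1 exI[of _ "Suc n"]) simp
      next
        case False
        then show ?thesis using w by (intro disjI2 exI[of _ "[]"] exI[of _ h] exI[of _ n]) simp
      qed
    next
      fix u g k assume "g \<noteq> Arr_as" "w = u @ g # replicate k Arr_as"
      then show ?thesis by (intro disjI2 exI[of _ "h # u"] exI[of _ g] exI[of _ k]) simp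
    qed
  qed (auto intro: exI[of _ 0])
  show ?thesis
  proof (rule palg_eqI)
    fix p :: path
    obtain t w s where p: "p = (t, w, s)" by (cases p)
    have "coeff_at z p = 0" if "t = V1" "s = V1"
      using words[of w] * zero by (auto simp: p that)
    moreover have "coeff_at z p = 0" if "t \<noteq> V1" "e1 * z = z"
      using coeff_ee_mult[of V1 z t w s] that by (simp add: p)
    moreover have "coeff_at z p = 0" if "s \<noteq> V1" "z * e1 = z"
      using coeff_mult_ee[of z V1 t w s] that by (simp add: p)
    ultimately show "coeff_at z p = coeff_at 0 p" using z by fastforce
  qed
qed

lemma is_end_ee_left: "is_end r \<psi> \<Longrightarrow> g \<in> arrows r \<Longrightarrow> ee v * \<psi> (arr g) = (if v = tgt g then \<psi> (arr g) else 0)"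
  using is_endD(4)[of r \<psi> "ee v" "arr g"] by (cases "v = tgt g") (simp_all add: is_endD)

lemma is_end_ee_right: "is_end r \<psi> \<Longrightarrow> g \<in> arrows r \<Longrightarrow> \<psi> (arr g) * ee v = (if v = src g then \<psi> (arr g) else 0)"
  using is_endD(4)[of r \<psi> "arr g" "ee v"] by (cases "v = src g") (simp_all add: is_endD)

lemma coeff_sum_bb:
  assumes "finite A" "\<beta> \<in> A"
  shows "coeff_at (\<Sum>\<alpha>\<in>A. bb \<alpha> * f \<alpha>) (V2, Arr_b \<beta> # w, s) = coeff_at (f \<beta>) (V1, w, s)"
  using assms by (simp add: coeff_arr_mult_Cons)

text \<open>The \<open>bb \<alpha>\<close> are free generators of a right module. Left
  multiplication by \<open>bb \<alpha>\<close> sees only the part \<open>e1 * x\<close> of a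
  coefficient \<open>x\<close>, hence the two conditions with \<open>e1\<close>.\<close>

lemma sum_bb_inj:
  assumes "(\<Sum>\<alpha>\<in>A. bb \<alpha> * f \<alpha>) = (\<Sum>\<alpha>\<in>A. bb \<alpha> * h \<alpha>)" "finite A" "\<beta> \<in> A"
    and "e1 * f \<beta> = f \<beta>" "e1 * h \<beta> = h \<beta>"
  shows "f \<beta> = h \<beta>"
proof (rule palg_eqI)
  fix p :: path
  obtain t w s where p: "p = (t, w, s)" by (cases p)
  show "coeff_at (f \<beta>) p = coeff_at (h \<beta>) p"
  proof (cases "t = V1")
    case True
    then show ?thesis
      using coeff_sum_bb[OF assms(2,3), of f w s] coeff_sum_bb[OF assms(2,3), of h w s] assms(1) p by simp
  next
    case False
    then show ?thesis
      using coeff_ee_mult[of V1 "f \<beta>" t w s] coeff_ee_mult[of V1 "h \<beta>" t w s] assms(4,5) p by simp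
  qed
qed

lemma Symp_bd:
  assumes "\<psi> \<in> Symp r"
  shows "(\<Sum>\<alpha>\<in>{1..r}. \<psi> (bb \<alpha>) * \<psi> (dd \<alpha>)) = (\<Sum>\<alpha>\<in>{1..r}. bb \<alpha> * dd \<alpha>)"
proof -
  have e: "is_end r \<psi>" using assms by (rule Symp_end)
  \<comment> \<open>The family \<open>f\<close> on the arrows is arbitrary so that one computation
    serves both the images under \<psi> and the arrows themselves. Among all summands only the
    products of a \<open>b\<close> with a \<open>d\<close> end at vertex 2.\<close>
  have e2: "e2 * (comm (f Arr_a) (f Arr_as) + (\<Sum>\<alpha>\<in>{1..r}. f (Arr_b \<alpha>) * f (Arr_d \<alpha>) - f (Arr_d \<alpha>) * f (Arr_b \<alpha>)))
      = (\<Sum>\<alpha>\<in>{1..r}. f (Arr_b \<alpha>) * f (Arr_d \<alpha>))"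
    if f: "\<And>g. g \<in> arrows r \<Longrightarrow> e2 * f g = (if V2 = tgt g then f g else 0)" for f
  proof -
    have "e2 * (\<Sum>\<alpha>\<in>{1..r}. f (Arr_b \<alpha>) * f (Arr_d \<alpha>) - f (Arr_d \<alpha>) * f (Arr_b \<alpha>)) = (\<Sum>\<alpha>\<in>{1..r}. f (Arr_b \<alpha>) * f (Arr_d \<alpha>))"
      unfolding sum_distrib_left
      by (intro sum.cong refl) (simp add: right_diff_distrib f mult.assoc[symmetric])
    then show ?thesis
      by (simp add: comm_def distrib_left right_diff_distrib f mult.assoc[symmetric])
  qed
  have eq: "e2 * \<psi> (c_elem r) = e2 * c_elem r" using assms by (simp add: Symp_iff)
  show ?thesis
    using eq[unfolded is_end_c_elem[OF e], unfolded c_elem_eq] e2[of "\<lambda>g. \<psi> (arr g)"] e2[of arr]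
    by (simp add: is_end_ee_left[OF e])
qed

lemma K_c_trivial:
  assumes "\<psi> \<in> K_c r" "\<psi> as = as" "\<And>\<alpha>. \<alpha> \<in> {1..r} \<Longrightarrow> \<psi> (bb \<alpha>) = bb \<alpha>"
  shows "\<psi> = \<one>\<^bsub>SympGrp r\<^esub>"
proof -
  have e: "is_end r \<psi>" and red: "\<psi> aa - aa \<in> I_ideal r" and symp: "\<psi> (c_elem r) = c_elem r"
    using assms(1) by (auto simp: K_c_def Symp_iff is_reduced_def)
  note L = is_end_ee_left[OF e] and R = is_end_ee_right[OF e]
  let ?S = "\<lambda>f. \<Sum>\<alpha>\<in>{1..r}. bb \<alpha> * f \<alpha> - f \<alpha> * bb \<alpha>"
  have "?S (\<lambda>\<alpha>. \<psi> (dd \<alpha>)) = (\<Sum>\<alpha>\<in>{1..r}. \<psi> (bb \<alpha>) * \<psi> (dd \<alpha>) - \<psi> (dd \<alpha>) * \<psi> (bb \<alpha>))"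
    using assms(3) by (intro sum.cong) auto
  then have eq: "comm (\<psi> aa) as + ?S (\<lambda>\<alpha>. \<psi> (dd \<alpha>)) = comm aa as + ?S dd"
    using is_end_c_elem[OF e] symp assms(2) by (simp add: c_elem_eq)
  have "(\<Sum>\<alpha>\<in>{1..r}. bb \<alpha> * \<psi> (dd \<alpha>)) = (\<Sum>\<alpha>\<in>{1..r}. bb \<alpha> * dd \<alpha>)"
    using Symp_bd[of \<psi> r] assms(1,3) by (simp add: K_c_def)
  then have d: "\<psi> (dd \<alpha>) = dd \<alpha>" if "\<alpha> \<in> {1..r}" for \<alpha>
    by (rule sum_bb_inj) (use that L in auto)
  have "?S (\<lambda>\<alpha>. \<psi> (dd \<alpha>)) = ?S dd"
    using d by (intro sum.cong) auto
  then have "comm (\<psi> aa) as = comm aa as" using eq by simp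
  then have "as * (\<psi> aa - aa) = (\<psi> aa - aa) * as"
    by (simp add: comm_def algebra_simps)
  moreover have "coeff_at (\<psi> aa - aa) (V1, replicate n Arr_as, V1) = 0" for n
    using red by (auto simp: I_ideal_iff in_lists_conv_set)
  ultimately have "\<psi> aa - aa = 0"
    using L R by (intro centralizer_as) (simp_all add: right_diff_distrib left_diff_distrib)
  then have a: "\<psi> aa = aa" by simp
  show ?thesis unfolding one_SympGrp
  proof (rule is_end_eqI[OF e is_end_id])
    fix g assume "g \<in> arrows r"
    then show "\<psi> (arr g) = restrict (\<lambda>x. x) (CQ_carrier r) (arr g)"
      by (cases rule: arrows_cases) (auto simp: a d assms)
  qed
qed

text \<open>Rigidity, applied to the product of the inverse of \<psi> with \<phi>. This is the
  source of the injectivity of \<open>N\<close>.\<close>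

lemma K_c_eqI:
  assumes "\<psi> \<in> K_c r" "\<phi> \<in> K_c r" "\<psi> as = as" "\<phi> as = as"
    and "\<And>\<alpha>. \<alpha> \<in> {1..r} \<Longrightarrow> \<psi> (bb \<alpha>) = \<phi> (bb \<alpha>)"
  shows "\<psi> = \<phi>"
proof -
  interpret G: group "SympGrp r" by (rule group_SympGrp)
  interpret K: subgroup "K_c r" "SympGrp r" by (rule K_c_subgroup)
  have S: "\<psi> \<in> Symp r" "\<phi> \<in> Symp r" "inv\<^bsub>SympGrp r\<^esub> \<psi> \<in> Symp r"
    using assms(1,2) by (auto simp: K_c_def inv_Symp)
  have "inv\<^bsub>SympGrp r\<^esub> \<psi> \<otimes>\<^bsub>SympGrp r\<^esub> \<phi> = \<one>\<^bsub>SympGrp r\<^esub>"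
  proof (rule K_c_trivial)
    show "inv\<^bsub>SympGrp r\<^esub> \<psi> \<otimes>\<^bsub>SympGrp r\<^esub> \<phi> \<in> K_c r" using assms by blast
    show "(inv\<^bsub>SympGrp r\<^esub> \<psi> \<otimes>\<^bsub>SympGrp r\<^esub> \<phi>) as = as"
      using S inv_SympGrp_apply(1)[OF S(1), of as] assms by (simp add: mult_SympGrp_apply)
    show "(inv\<^bsub>SympGrp r\<^esub> \<psi> \<otimes>\<^bsub>SympGrp r\<^esub> \<phi>) (bb \<alpha>) = bb \<alpha>" if "\<alpha> \<in> {1..r}" for \<alpha>
      using S inv_SympGrp_apply(1)[OF S(1), of "bb \<alpha>"] assms(5)[OF that] that by (simp add: mult_SympGrp_apply)
  qed
  then show ?thesis
    using S by (metis G.inv_equality G.inv_inv G.inv_solve_left carrier_SympGrp G.r_one G.one_closed)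
qed

section \<open>Polynomials in a loop\<close>

lemma peval_superset: "degree p \<le> n \<Longrightarrow> peval p x = (\<Sum>k\<le>n. Polynomial.coeff p k *\<^sub>C (e1 * x ^ k))"
  unfolding peval_def by (rule sum.mono_neutral_left) (auto simp: coeff_eq_0)

lemma peval_add: "peval (p + q) x = peval p x + peval q x"
  by (subst (1 2 3) peval_superset[where n = "max (degree p) (degree q)"])
    (auto simp: degree_add_le_max sum.distrib cs.scale_left_distrib)

lemma peval_smult: "peval (Polynomial.smult c p) x = c *\<^sub>C peval p x"
  by (subst (1 2) peval_superset[where n = "degree p"]) (auto simp: cs.scale_sum_right)

lemma peval_0 [simp]: "peval 0 x = 0"
  by (simp add: peval_def)

lemma peval_1 [simp]: "peval 1 x = e1"
  by (simp add: peval_def)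

lemma peval_uminus: "peval (- p) x = - peval p x"
  using peval_add[of p "- p" x] by (simp add: eq_neg_iff_add_eq_0 add.commute)

lemma peval_e1: "e1 * peval p x = peval p x"
  by (simp add: peval_def sum_distrib_left)

text \<open>The constant term of \<open>peval\<close> is a multiple of \<open>e1\<close> and not of
  \<open>1\<close>, so \<open>y\<close> has to commute with \<open>e1\<close> as well.\<close>

lemma peval_commute: "x * y = y * x \<Longrightarrow> e1 * y = y * e1 \<Longrightarrow> peval p x * y = y * peval p x"
proof -
  assume *: "x * y = y * x" "e1 * y = y * e1"
  have "x ^ k * y = y * x ^ k" for k
    by (rule power_commuting_commutes[OF *(1)])
  then have "e1 * x ^ k * y = y * (e1 * x ^ k)" for k
    by (metis *(2) mult.assoc)
  then show ?thesis by (simp add: peval_def sum_distrib_left sum_distrib_right)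
qed

lemma peval_pCons:
  assumes "e1 * x = x" "x * e1 = x"
  shows "peval (pCons c p) x = c *\<^sub>C e1 + x * peval p x"
proof -
  have "peval (pCons c p) x = (\<Sum>k\<le>Suc (degree p). Polynomial.coeff (pCons c p) k *\<^sub>C (e1 * x ^ k))"
    by (rule peval_superset) (rule degree_pCons_le)
  also have "\<dots> = c *\<^sub>C e1 + (\<Sum>k\<le>degree p. Polynomial.coeff p k *\<^sub>C (e1 * (x * x ^ k)))"
    by (subst sum.atMost_Suc_shift) simp
  also have "(\<Sum>k\<le>degree p. Polynomial.coeff p k *\<^sub>C (e1 * (x * x ^ k))) = x * peval p x"
    unfolding peval_def sum_distrib_left
  proof (intro sum.cong refl)
    fix k
    have "e1 * (x * x ^ k) = x * (e1 * x ^ k)"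
      using assms by (metis mult.assoc)
    then show "Polynomial.coeff p k *\<^sub>C (e1 * (x * x ^ k)) = x * (Polynomial.coeff p k *\<^sub>C (e1 * x ^ k))"
      by simp
  qed
  finally show ?thesis .
qed

lemma peval_mult:
  assumes "e1 * x = x" "x * e1 = x"
  shows "peval (p * q) x = peval p x * peval q x"
  by (induction p)
    (simp_all add: peval_add peval_smult peval_pCons[OF assms] distrib_right peval_e1 mult.assoc)

lemma peval_sum: "peval (sum f A) x = (\<Sum>i\<in>A. peval (f i) x)"
  by (induction A rule: infinite_finite_induct) (auto simp: peval_add)

lemma peval_CQ [simp]: "x \<in> CQ_carrier r \<Longrightarrow> peval p x \<in> CQ_carrier r"
  by (auto simp: peval_def intro!: CQ_sum CQ_mult CQ_cscale CQ_power)

lemma is_end_peval: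
  assumes "is_end r \<psi>" "x \<in> CQ_carrier r"
  shows "\<psi> (peval p x) = peval p (\<psi> x)"
  unfolding peval_def
  by (subst is_end_sum[OF assms(1)])
    (auto simp: assms is_endD[OF assms(1)] is_end_power[OF assms] intro!: CQ_mult CQ_power)

lemma coeff_as_power: "coeff_at (e1 * as ^ k) (V1, replicate n Arr_as, V1) = (if k = n then 1 else 0)"
proof (induction k arbitrary: n)
  case 0
  then show ?case by (auto simp: ee_def coeff_at_of_path)
next
  case (Suc k)
  have "e1 * as ^ Suc k = as * (e1 * as ^ k)"
    by simp
  then show ?case
    using Suc by (cases n) (simp_all add: coeff_arr_mult_Nil coeff_arr_mult_Cons del: arr_ee_mult)
qed

text \<open>The word of \<open>n\<close> letters \<open>Arr_as\<close> occurs only in the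
  \<open>n\<close>-th power, so the coefficients recover the polynomial: \<open>as\<close> is
  transcendental, and identities between evaluated matrices can be pulled back to
  polynomials.\<close>

lemma coeff_peval_as: "coeff_at (peval p as) (V1, replicate n Arr_as, V1) = Polynomial.coeff p n"
proof -
  have "coeff_at (peval p as) (V1, replicate n Arr_as, V1)
      = (\<Sum>k\<le>degree p. if k = n then Polynomial.coeff p k else 0)"
    unfolding peval_def coeff_at_sum coeff_at_cscale coeff_as_power by (intro sum.cong) auto
  then show ?thesis by (auto simp: coeff_eq_0)
qed

lemma peval_as_inj: "peval p as = peval q as \<longleftrightarrow> p = q"
  by (metis coeff_peval_as poly_eqI)

section \<open>Matrices over corner rings\<close>

lemma mat_mult_index:
  "\<lbrakk>M \<in> carrier_mat r r; N \<in> carrier_mat r r; i < r; j < r\<rbrakk> \<Longrightarrow>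
     (M * N) $$ (i, j) = (\<Sum>k<r. M $$ (i, k) * N $$ (k, j))"
  by (simp add: scalar_prod_def lessThan_atLeast0)

text \<open>The unit is \<open>e1\<close>, so these sets are not subrings of the ambient ring with
  unit \<open>1\<close>. The notion covers \<open>A1 r\<close> and \<open>poly_subring as\<close> at
  once.\<close>

definition corner_ring :: "palg set \<Rightarrow> bool" where
  "corner_ring A \<longleftrightarrow> 0 \<in> A \<and> e1 \<in> A \<and> (\<forall>x\<in>A. \<forall>y\<in>A. x + y \<in> A \<and> x * y \<in> A) \<and>
     (\<forall>x\<in>A. e1 * x = x \<and> x * e1 = x)"

lemma corner_ring_sum: "corner_ring A \<Longrightarrow> (\<And>i. i \<in> B \<Longrightarrow> f i \<in> A) \<Longrightarrow> sum f B \<in> A"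
  by (induction B rule: infinite_finite_induct) (auto simp: corner_ring_def)

lemma monoid_Mat:
  assumes "corner_ring A"
  shows "monoid (Mat_monoid r A)"
proof (rule monoidI)
  let ?M = "Mat_monoid r A"
  have closed: "x + y \<in> A" "x * y \<in> A" if "x \<in> A" "y \<in> A" for x y
    using assms that by (auto simp: corner_ring_def)
  have unit: "e1 * x = x" "x * e1 = x" if "x \<in> A" for x
    using assms that by (auto simp: corner_ring_def)
  have zero: "0 \<in> A" "e1 \<in> A" using assms by (auto simp: corner_ring_def)
  show "x \<otimes>\<^bsub>?M\<^esub> y \<in> carrier ?M" if "x \<in> carrier ?M" "y \<in> carrier ?M" for x y
    using that by (auto simp: Mat_monoid_def mat_mult_index[where r = r] simp del: index_mult_mat(1)
      intro!: corner_ring_sum[OF assms] closed)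
  show "\<one>\<^bsub>?M\<^esub> \<in> carrier ?M"
    using zero by (auto simp: Mat_monoid_def)
  show "x \<otimes>\<^bsub>?M\<^esub> y \<otimes>\<^bsub>?M\<^esub> z = x \<otimes>\<^bsub>?M\<^esub> (y \<otimes>\<^bsub>?M\<^esub> z)"
    if "x \<in> carrier ?M" "y \<in> carrier ?M" "z \<in> carrier ?M" for x y z
    using that by (auto simp: Mat_monoid_def)
  let ?I = "mat r r (\<lambda>(i, j). if i = j then e1 else 0)"
  have "?I * x = x" "x * ?I = x" if "x \<in> carrier_mat r r" "\<forall>i<r. \<forall>j<r. x $$ (i, j) \<in> A" for x
    using that unit
    by (auto intro!: eq_matI simp: mat_mult_index[where r = r] if_distrib[of "\<lambda>c. c * _"] if_distrib[of "\<lambda>c. _ * c"]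
        simp del: index_mult_mat(1) cong: if_cong)
  then show "\<one>\<^bsub>?M\<^esub> \<otimes>\<^bsub>?M\<^esub> x = x" "x \<otimes>\<^bsub>?M\<^esub> \<one>\<^bsub>?M\<^esub> = x" if "x \<in> carrier ?M" for x
    using that by (auto simp: Mat_monoid_def)
qed

lemma A1_iff: "x \<in> A1 r \<longleftrightarrow> x \<in> CQ_carrier r \<and> e1 * x = x \<and> x * e1 = x"
proof
  assume "x \<in> A1 r"
  then show "x \<in> CQ_carrier r \<and> e1 * x = x \<and> x * e1 = x"
    by (auto simp: A1_def mult.assoc)
next
  assume *: "x \<in> CQ_carrier r \<and> e1 * x = x \<and> x * e1 = x"
  then have "x = e1 * x * e1" by simp
  with * show "x \<in> A1 r" unfolding A1_def by blast
qed

lemma corner_A1: "corner_ring (A1 r)"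
proof -
  have "e1 * (x * y) = x * y" "x * y * e1 = x * y" if "e1 * x = x" "y * e1 = y" for x y :: palg
    using that by (metis mult.assoc)+
  then show ?thesis by (auto simp: corner_ring_def A1_iff distrib_left distrib_right)
qed

lemma poly_subring_subset_A1:
  "poly_subring as \<subseteq> A1 r"
proof
  fix x assume "x \<in> poly_subring as"
  then obtain p where p: "x = peval p as" by (auto simp: poly_subring_def)
  have "x * e1 = x" using peval_commute[of "as" e1 p] by (simp add: p peval_e1)
  then have "x = e1 * x * e1" by (simp add: p peval_e1)
  moreover have "x \<in> CQ_carrier r" by (simp add: p)
  ultimately show "x \<in> A1 r" by (auto simp: A1_def)
qed

lemma corner_poly: "corner_ring (poly_subring as)"
proof -
  have "\<forall>x\<in>poly_subring as. e1 * x = x \<and> x * e1 = x"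
    using poly_subring_subset_A1[of 0] by (auto simp: A1_iff)
  moreover have "0 = peval 0 as" "e1 = peval 1 as" by simp_all
  moreover have "peval p as + peval q as = peval (p + q) as" "peval p as * peval q as = peval (p * q) as" for p q
    by (simp_all add: peval_add peval_mult)
  ultimately show ?thesis unfolding corner_ring_def poly_subring_def by blast
qed

text \<open>The two matrix monoids share multiplication and unit, so an inverse over C[a*] is an
  inverse over \<open>A1 r\<close>; uniqueness of inverses then gives closure under
  inversion.\<close>

lemma GL_subgroup: "subgroup (carrier (GL r (poly_subring as))) (GL r (A1 r))"
proof -
  let ?P = "Mat_monoid r (poly_subring as)" and ?A = "Mat_monoid r (A1 r)"
  interpret P: monoid ?P by (rule monoid_Mat[OF corner_poly])
  interpret A: monoid ?A by (rule monoid_Mat[OF corner_A1])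
  interpret GA: group "GL r (A1 r)" unfolding GL_def by (rule A.units_group)
  interpret GP: group "GL r (poly_subring as)" unfolding GL_def by (rule P.units_group)
  have eq: "monoid.mult ?P = monoid.mult ?A" "\<one>\<^bsub>?P\<^esub> = \<one>\<^bsub>?A\<^esub>" by (auto simp: Mat_monoid_def)
  have sub: "carrier ?P \<subseteq> carrier ?A"
    using poly_subring_subset_A1 by (fastforce simp: Mat_monoid_def)
  have U: "Units ?P \<subseteq> Units ?A"
    using sub unfolding Units_def eq by blast
  show ?thesis
  proof (rule GA.subgroupI)
    show "carrier (GL r (poly_subring as)) \<subseteq> carrier (GL r (A1 r))"
      using U by (simp add: GL_def units_of_def)
    show "carrier (GL r (poly_subring as)) \<noteq> {}" using GP.one_closed by blast
  next
    fix M assume M: "M \<in> carrier (GL r (poly_subring as))"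
    then have "inv\<^bsub>GL r (poly_subring as)\<^esub> M \<in> carrier (GL r (poly_subring as))" by simp
    moreover have "inv\<^bsub>GL r (A1 r)\<^esub> M = inv\<^bsub>GL r (poly_subring as)\<^esub> M"
      using GP.l_inv[OF M] M GP.inv_closed[OF M] U
      by (intro GA.inv_equality) (auto simp: GL_def units_of_def eq)
    ultimately show "inv\<^bsub>GL r (A1 r)\<^esub> M \<in> carrier (GL r (poly_subring as))" by simp
  next
    fix M N assume "M \<in> carrier (GL r (poly_subring as))" "N \<in> carrier (GL r (poly_subring as))"
    from GP.m_closed[OF this] show "M \<otimes>\<^bsub>GL r (A1 r)\<^esub> N \<in> carrier (GL r (poly_subring as))"
      by (simp add: GL_def units_of_def eq)
  qed
qed

section \<open>The matrix of an automorphism\<close>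

text \<open>The relation behind \<open>N_mat\<close> without the definite description: a matrix is
  exhibited first, and \<open>N_mat_eq\<close> then yields the value.\<close>

definition acts :: "nat \<Rightarrow> (palg \<Rightarrow> palg) \<Rightarrow> palg mat \<Rightarrow> bool" where
  "acts r \<psi> M \<longleftrightarrow> M \<in> carrier (Mat_monoid r (A1 r)) \<and>
     (\<forall>\<alpha><r. \<psi> (bb (\<alpha> + 1)) = (\<Sum>\<beta><r. bb (\<beta> + 1) * M $$ (\<beta>, \<alpha>)))"

lemma acts_unique:
  assumes "acts r \<psi> M" "acts r \<psi> N"
  shows "M = N"
proof (rule eq_matI)
  have M: "M \<in> carrier_mat r r" "N \<in> carrier_mat r r"
    using assms by (auto simp: acts_def Mat_monoid_def)
  fix i j assume "i < dim_row N" "j < dim_col N"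
  then have ij: "i < r" "j < r" using M by auto
  have eq: "(\<Sum>\<beta><r. bb (\<beta> + 1) * M $$ (\<beta>, j)) = (\<Sum>\<beta><r. bb (\<beta> + 1) * N $$ (\<beta>, j))"
  proof -
    have "\<psi> (bb (j + 1)) = (\<Sum>\<beta><r. bb (\<beta> + 1) * M $$ (\<beta>, j))"
      using assms(1) ij(2) unfolding acts_def by blast
    moreover have "\<psi> (bb (j + 1)) = (\<Sum>\<beta><r. bb (\<beta> + 1) * N $$ (\<beta>, j))"
      using assms(2) ij(2) unfolding acts_def by blast
    ultimately show ?thesis by (rule trans[OF sym])
  qed
  have re: "(\<Sum>\<beta><r. bb (\<beta> + 1) * f \<beta>) = (\<Sum>\<alpha>\<in>{1..r}. bb \<alpha> * f (\<alpha> - 1))" for f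
    by (rule sum.reindex_bij_witness[of _ "\<lambda>\<alpha>. \<alpha> - 1" Suc]) auto
  have e: "e1 * M $$ (i, j) = M $$ (i, j)" "e1 * N $$ (i, j) = N $$ (i, j)"
    using assms ij by (auto simp: acts_def Mat_monoid_def A1_iff)
  show "M $$ (i, j) = N $$ (i, j)"
    using sum_bb_inj[OF eq[unfolded re], of "Suc i"] ij e by simp
qed (use assms in \<open>auto simp: acts_def Mat_monoid_def\<close>)

lemma N_mat_eq: "acts r \<psi> M \<Longrightarrow> N_mat r \<psi> = M"
  unfolding N_mat_def using acts_unique by (intro the_equality) (auto simp: acts_def)

text \<open>All matrix arguments take place over the type of complex polynomials, where degree,
  division with remainder and elementary row operations are available; evaluation carries the
  results to the path algebra.\<close>

definition peval_mat :: "complex poly mat \<Rightarrow> palg mat" where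
  "peval_mat = map_mat (\<lambda>p. peval p as)"

lemma peval_mat_mult:
  assumes "M \<in> carrier_mat r r" "N \<in> carrier_mat r r"
  shows "peval_mat (M * N) = peval_mat M * peval_mat N"
  using assms
  by (intro eq_matI)
    (auto simp: peval_mat_def mat_mult_index[where r = r] peval_sum peval_mult simp del: index_mult_mat(1))

lemma peval_mat_one: "peval_mat (1\<^sub>m r) = \<one>\<^bsub>Mat_monoid r A\<^esub>"
  by (intro eq_matI) (auto simp: peval_mat_def Mat_monoid_def)

lemma peval_mat_carrier: "M \<in> carrier_mat r r \<Longrightarrow> peval_mat M \<in> carrier (Mat_monoid r (poly_subring as))"
  by (auto simp: peval_mat_def Mat_monoid_def poly_subring_def)

lemma peval_mat_inj:
  assumes "M \<in> carrier_mat r r" "N \<in> carrier_mat r r" "peval_mat M = peval_mat N"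
  shows "M = N"
proof (rule eq_matI)
  fix i j assume "i < dim_row N" "j < dim_col N"
  then show "M $$ (i, j) = N $$ (i, j)"
    using arg_cong[OF assms(3), of "\<lambda>M. M $$ (i, j)"] assms(1,2)
    by (simp add: peval_mat_def peval_as_inj)
qed (use assms in auto)

lemma peval_mat_surj:
  assumes "M \<in> carrier (Mat_monoid r (poly_subring as))"
  obtains L where "L \<in> carrier_mat r r" "M = peval_mat L"
proof -
  have "\<forall>i j. \<exists>p. i < r \<longrightarrow> j < r \<longrightarrow> M $$ (i, j) = peval p as"
    using assms by (auto simp: Mat_monoid_def poly_subring_def image_iff)
  then obtain f where f: "\<And>i j. i < r \<Longrightarrow> j < r \<Longrightarrow> M $$ (i, j) = peval (f i j) as"
    by metis
  show ?thesis
  proof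
    show "mat r r (\<lambda>(i, j). f i j) \<in> carrier_mat r r" by simp
    show "M = peval_mat (mat r r (\<lambda>(i, j). f i j))"
      using assms f by (intro eq_matI) (auto simp: peval_mat_def Mat_monoid_def)
  qed
qed

text \<open>Injectivity of the evaluation turns the inverse equation over
  \<open>poly_subring as\<close> into one between polynomial matrices. A left inverse is what the
  row reduction starts from.\<close>

lemma Units_peval_mat:
  assumes "M \<in> carrier (GL r (poly_subring as))"
  obtains L L' where "L \<in> carrier_mat r r" "L' \<in> carrier_mat r r" "L' * L = 1\<^sub>m r" "M = peval_mat L"
proof -
  let ?P = "Mat_monoid r (poly_subring as)"
  obtain M' where M: "M \<in> carrier ?P" "M' \<in> carrier ?P" "M' \<otimes>\<^bsub>?P\<^esub> M = \<one>\<^bsub>?P\<^esub>"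
    using assms by (auto simp: GL_def units_of_def Units_def)
  obtain L where L: "L \<in> carrier_mat r r" "M = peval_mat L" using M(1) by (rule peval_mat_surj)
  obtain L' where L': "L' \<in> carrier_mat r r" "M' = peval_mat L'" using M(2) by (rule peval_mat_surj)
  have "peval_mat (L' * L) = peval_mat (1\<^sub>m r)"
    using M(3) L L' by (simp add: peval_mat_mult peval_mat_one[of r "poly_subring as"]) (simp add: Mat_monoid_def)
  then have "L' * L = 1\<^sub>m r" using L L' by (intro peval_mat_inj[of _ r]) auto
  then show ?thesis using L L' that by blast
qed

lemma peval_mat_GL:
  assumes "L \<in> carrier_mat r r" "L' \<in> carrier_mat r r" "L' * L = 1\<^sub>m r" "L * L' = 1\<^sub>m r"
  shows "peval_mat L \<in> carrier (GL r (poly_subring as))"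
proof -
  let ?P = "Mat_monoid r (poly_subring as)"
  have "peval_mat L' \<otimes>\<^bsub>?P\<^esub> peval_mat L = \<one>\<^bsub>?P\<^esub>" "peval_mat L \<otimes>\<^bsub>?P\<^esub> peval_mat L' = \<one>\<^bsub>?P\<^esub>"
    using peval_mat_mult[OF assms(2,1)] peval_mat_mult[OF assms(1,2)] assms(3,4)
    by (simp_all add: peval_mat_one[of r "poly_subring as"]) (simp_all add: Mat_monoid_def)
  then show ?thesis
    using peval_mat_carrier assms(1,2) unfolding GL_def units_of_def Units_def by auto
qed

section \<open>Row reduction of polynomial matrices\<close>

text \<open>\<open>G\<close> will be the set of polynomial matrices realised by
  \<open>P'_grp r\<close>. Scalings are by nonzero constants, the units of the polynomial ring; row
  exchanges are not among the operations.\<close>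

locale row_closed =
  fixes r :: nat and G :: "'a :: field poly mat set"
  assumes one: "1\<^sub>m r \<in> G"
    and addrow: "\<lbrakk>M \<in> carrier_mat r r; M \<in> G; i < r; j < r; i \<noteq> j\<rbrakk> \<Longrightarrow> addrow p i j M \<in> G"
    and multrow: "\<lbrakk>M \<in> carrier_mat r r; M \<in> G; i < r; c \<noteq> 0\<rbrakk> \<Longrightarrow> multrow i [:c:] M \<in> G"
begin

text \<open>The invariant of the reduction: the columns before \<open>k\<close> are finished. A left
  inverse is carried along because it makes the next column unimodular.\<close>

definition std :: "nat \<Rightarrow> 'a poly mat \<Rightarrow> bool" where
  "std k M \<longleftrightarrow> M \<in> carrier_mat r r \<and> (\<exists>L\<in>carrier_mat r r. L * M = 1\<^sub>m r) \<and>
     (\<forall>j<k. \<forall>i<r. M $$ (i, j) = (if i = j then 1 else 0))"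

text \<open>Row \<open>j\<close> with \<open>k \<le> j\<close> vanishes in the finished columns, so
  adding it to another row leaves them intact. The second claim runs backwards: membership in
  \<open>G\<close> is pulled back from the reduced matrix by the inverse operation.\<close>

lemma std_addrow:
  assumes M: "std k M" and ij: "i < r" "k \<le> j" "j < r" "i \<noteq> j"
  shows "std k (addrow p i j M)" and "addrow p i j M \<in> G \<Longrightarrow> M \<in> G"
proof -
  let ?E = "addrow_mat r p i j" and ?E' = "addrow_mat r (- p) i j"
  have M': "M \<in> carrier_mat r r" using M by (simp add: std_def)
  obtain L where L: "L \<in> carrier_mat r r" "L * M = 1\<^sub>m r" using M by (auto simp: std_def)
  have inv: "?E' * ?E = 1\<^sub>m r" using addrow_mat_inv[of i r j "- p"] ij by simp
  have eq: "addrow p i j M = ?E * M" by (rule addrow_mat[OF M']) (use ij in simp)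
  have "(L * ?E') * (?E * M) = L * (?E' * (?E * M))"
    by (rule assoc_mult_mat) (use L M' in auto)
  also have "?E' * (?E * M) = (?E' * ?E) * M"
    by (rule assoc_mult_mat[symmetric]) (use M' in auto)
  also have "L * ((?E' * ?E) * M) = 1\<^sub>m r" using L M' by (simp add: inv)
  finally have "\<exists>L\<in>carrier_mat r r. L * addrow p i j M = 1\<^sub>m r"
    unfolding eq using L(1) by (intro bexI[of _ "L * ?E'"]) auto
  then show "std k (addrow p i j M)"
    using M ij by (auto simp: std_def)
  have "addrow (- p) i j (addrow p i j M) = M"
    using M' ij by (intro eq_matI) (auto simp: algebra_simps)
  then show "M \<in> G" if "addrow p i j M \<in> G"
    using addrow[OF _ that ij(1,3,4), of "- p"] M' by simp
qed

lemma std_multrow: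
  assumes M: "std k M" and i: "k \<le> i" "i < r" and c: "c \<noteq> 0"
  shows "std k (multrow i [:c:] M)" and "multrow i [:c:] M \<in> G \<Longrightarrow> M \<in> G"
proof -
  let ?E = "multrow_mat r i [:c:]" and ?E' = "multrow_mat r i [:inverse c:]"
  have M': "M \<in> carrier_mat r r" using M by (simp add: std_def)
  obtain L where L: "L \<in> carrier_mat r r" "L * M = 1\<^sub>m r" using M by (auto simp: std_def)
  have "?E' * ?E = multrow i [:inverse c:] ?E" by (rule multrow_mat[symmetric, of _ _ r]) simp
  also have "\<dots> = 1\<^sub>m r" using i c by (intro eq_matI) (auto simp: one_pCons)
  finally have inv: "?E' * ?E = 1\<^sub>m r" .
  have eq: "multrow i [:c:] M = ?E * M" by (rule multrow_mat[OF M'])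
  have "(L * ?E') * (?E * M) = L * (?E' * (?E * M))"
    by (rule assoc_mult_mat) (use L M' in auto)
  also have "?E' * (?E * M) = (?E' * ?E) * M"
    by (rule assoc_mult_mat[symmetric]) (use M' in auto)
  also have "L * ((?E' * ?E) * M) = 1\<^sub>m r" using L M' by (simp add: inv)
  finally have "\<exists>L\<in>carrier_mat r r. L * multrow i [:c:] M = 1\<^sub>m r"
    unfolding eq using L(1) by (intro bexI[of _ "L * ?E'"]) auto
  then show "std k (multrow i [:c:] M)"
    using M i by (auto simp: std_def)
  have "multrow i [:inverse c:] (multrow i [:c:] M) = M"
    using M' i c by (intro eq_matI) (auto simp: one_pCons[symmetric])
  then show "M \<in> G" if "multrow i [:c:] M \<in> G"
    using multrow[OF _ that i(2), of "inverse c"] M' c by simp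
qed

text \<open>With pivot 1, multiples of row \<open>k\<close> clear the rest of the column, above the
  diagonal as well as below; each operation removes one nonzero entry.\<close>

lemma clear_column:
  assumes IH: "\<And>M. std (Suc k) M \<Longrightarrow> M \<in> G"
    and "k < r" "std k M" "M $$ (k, k) = 1"
  shows "M \<in> G"
  using assms(3,4)
proof (induction "card {i. i < r \<and> i \<noteq> k \<and> M $$ (i, k) \<noteq> 0}" arbitrary: M rule: less_induct)
  case less
  have M: "M \<in> carrier_mat r r" using less.prems by (simp add: std_def)
  show ?case
  proof (cases "\<exists>i<r. i \<noteq> k \<and> M $$ (i, k) \<noteq> 0")
    case True
    then obtain i where i: "i < r" "i \<noteq> k" "M $$ (i, k) \<noteq> 0" by blast
    let ?M = "addrow (- M $$ (i, k)) i k M"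
    let ?N = "\<lambda>M. {i. i < r \<and> i \<noteq> k \<and> M $$ (i, k) \<noteq> 0}"
    have "?M $$ (l, k) = (if l = i then 0 else M $$ (l, k))" if "l < r" for l
      using that M assms(2) less.prems(2) i(1) by simp
    then have "?N ?M = ?N M - {i}" by (auto simp del: index_mat_addrow split: if_splits)
    then have "card (?N ?M) < card (?N M)"
      using i by (simp only:) (intro card_Diff1_less, auto)
    moreover have "std k ?M" using std_addrow(1)[OF less.prems(1)] i assms(2) by simp
    moreover have "?M $$ (k, k) = 1" using i M assms(2) less.prems(2) by simp
    ultimately have "?M \<in> G" by (rule less.hyps)
    then show ?thesis by (rule std_addrow(2)[OF less.prems(1), rotated -1]) (use i assms(2) in auto)
  next
    case False
    then have "std (Suc k) M" using less.prems by (auto simp: std_def less_Suc_eq)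
    then show ?thesis by (rule IH)
  qed
qed

text \<open>Row \<open>k\<close> of a left inverse gives the combination. The finished columns force
  its entries before position \<open>k\<close> to vanish, so only the rows from \<open>k\<close> on
  take part.\<close>

lemma unimodular_column:
  assumes "std k M" "k < r"
  obtains f where "(\<Sum>i\<in>{k..<r}. f i * M $$ (i, k)) = 1"
proof -
  obtain L where L: "L \<in> carrier_mat r r" "L * M = 1\<^sub>m r" and M: "M \<in> carrier_mat r r"
    and col: "\<And>i j. j < k \<Longrightarrow> i < r \<Longrightarrow> M $$ (i, j) = (if i = j then 1 else 0)"
    using assms(1) by (auto simp: std_def)
  have LM: "(\<Sum>i\<in>{0..<r}. L $$ (k, i) * M $$ (i, j)) = (if k = j then 1 else 0)" if "j < r" for j
    using arg_cong[OF L(2), of "\<lambda>A. A $$ (k, j)"] L(1) M that assms(2)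
    by (simp add: scalar_prod_def)
  have "L $$ (k, j) = 0" if "j < k" for j
  proof -
    have "(\<Sum>i\<in>{0..<r}. L $$ (k, i) * M $$ (i, j)) = (\<Sum>i\<in>{0..<r}. if i = j then L $$ (k, i) else 0)"
      using col that by (intro sum.cong) auto
    then show ?thesis using LM[of j] that assms(2) by simp
  qed
  then have "(\<Sum>i\<in>{k..<r}. L $$ (k, i) * M $$ (i, k)) = (\<Sum>i\<in>{0..<r}. L $$ (k, i) * M $$ (i, k))"
    by (intro sum.mono_neutral_left) auto
  with LM[of k] assms(2) that show ?thesis by simp
qed

text \<open>The degree shifted by one, so that 0 weighs less than a nonzero constant and a vanishing
  remainder also counts as progress.\<close>

definition weight :: "'a poly \<Rightarrow> nat" where
  "weight p = (if p = 0 then 0 else Suc (degree p))"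

lemma weight_mod_less: "q \<noteq> 0 \<Longrightarrow> p \<noteq> 0 \<Longrightarrow> degree q \<le> degree p \<Longrightarrow> weight (p mod q) < weight p"
  using degree_mod_less[of q p] by (auto simp: weight_def)

text \<open>Euclid's algorithm on the entries of column \<open>k\<close> in the rows from
  \<open>k\<close> on: as long as two are nonzero, one is replaced by its remainder modulo the
  other. A single remaining entry divides 1 by \<open>unimodular_column\<close>, so it is a
  constant, which is scaled to 1 before \<open>clear_column\<close> applies.\<close>

lemma reduce_column:
  assumes IH: "\<And>M. std (Suc k) M \<Longrightarrow> M \<in> G" and "k < r" "std k M"
  shows "M \<in> G"
  using assms(3)
proof (induction "\<Sum>i\<in>{k..<r}. weight (M $$ (i, k))" arbitrary: M rule: less_induct)
  case less
  have M: "M \<in> carrier_mat r r" using less.prems by (simp add: std_def)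
  have step: "M \<in> G"
    if ij: "i \<in> {k..<r}" "j \<in> {k..<r}" "i \<noteq> j" "M $$ (i, k) \<noteq> 0" "M $$ (j, k) \<noteq> 0"
      "degree (M $$ (j, k)) \<le> degree (M $$ (i, k))" for i j
  proof -
    let ?M = "addrow (- (M $$ (i, k) div M $$ (j, k))) i j M"
    have eq: "?M $$ (l, k) = (if l = i then M $$ (i, k) mod M $$ (j, k) else M $$ (l, k))" if "l < r" for l
      using that ij M assms(2) by (auto simp: minus_div_mult_eq_mod[symmetric])
    have "(\<Sum>l\<in>{k..<r}. weight (?M $$ (l, k))) < (\<Sum>l\<in>{k..<r}. weight (M $$ (l, k)))"
    proof (rule sum_strict_mono_ex1)
      show "\<forall>l\<in>{k..<r}. weight (?M $$ (l, k)) \<le> weight (M $$ (l, k))"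
        using weight_mod_less[OF ij(5,4,6)] by (auto simp: eq simp del: index_mat_addrow)
      show "\<exists>l\<in>{k..<r}. weight (?M $$ (l, k)) < weight (M $$ (l, k))"
        using weight_mod_less[OF ij(5,4,6)] ij(1) by (intro bexI[of _ i]) (auto simp: eq simp del: index_mat_addrow)
    qed simp
    moreover have "std k ?M" using std_addrow(1)[OF less.prems] ij by simp
    ultimately have "?M \<in> G" by (rule less.hyps)
    then show ?thesis by (rule std_addrow(2)[OF less.prems, rotated -1]) (use ij in auto)
  qed
  show ?case
  proof (cases "\<exists>i\<in>{k..<r}. \<exists>j\<in>{k..<r}. i \<noteq> j \<and> M $$ (i, k) \<noteq> 0 \<and> M $$ (j, k) \<noteq> 0")
    case True
    then obtain i j where "i \<in> {k..<r}" "j \<in> {k..<r}" "i \<noteq> j" "M $$ (i, k) \<noteq> 0" "M $$ (j, k) \<noteq> 0" by blast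
    then show ?thesis using step[of i j] step[of j i]
      by (cases "degree (M $$ (j, k)) \<le> degree (M $$ (i, k))") auto
  next
    case False
    obtain f where f: "(\<Sum>i\<in>{k..<r}. f i * M $$ (i, k)) = 1"
      using unimodular_column[OF less.prems assms(2)] .
    have "\<exists>i\<in>{k..<r}. M $$ (i, k) \<noteq> 0"
    proof (rule ccontr)
      assume "\<not> ?thesis"
      then have "(\<Sum>i\<in>{k..<r}. f i * M $$ (i, k)) = 0" by (intro sum.neutral) auto
      then show False using f by simp
    qed
    then obtain i where i: "k \<le> i" "i < r" "M $$ (i, k) \<noteq> 0" by auto
    have zero: "M $$ (l, k) = 0" if "l \<in> {k..<r}" "l \<noteq> i" for l
      using False i that by (meson atLeastLessThan_iff)
    have "(\<Sum>i\<in>{k..<r}. f i * M $$ (i, k)) = (\<Sum>i\<in>{i}. f i * M $$ (i, k))"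
      using zero i by (intro sum.mono_neutral_right) auto
    then have "f i * M $$ (i, k) = 1" using f by simp
    then have "is_unit (M $$ (i, k))" by (metis dvd_triv_right)
    then obtain c where c: "M $$ (i, k) = [:c:]" "c \<noteq> 0"
      by (auto simp: is_unit_poly_iff dvd_field_iff)
    have diag: "A \<in> G" if "std k A" "A $$ (k, k) = [:c:]" for A
    proof -
      have A: "A \<in> carrier_mat r r" using that(1) by (simp add: std_def)
      have "multrow k [:inverse c:] A \<in> G"
      proof (rule clear_column[OF IH assms(2)])
        show "std k (multrow k [:inverse c:] A)"
          by (rule std_multrow) (use that assms(2) c in auto)
        show "multrow k [:inverse c:] A $$ (k, k) = 1"
          using that A assms(2) c by (simp add: one_pCons)
      qed
      then show ?thesis using std_multrow(2)[OF that(1), of k "inverse c"] assms(2) c by simp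
    qed
    show ?thesis
    proof (cases "i = k")
      case True
      then show ?thesis using diag[OF less.prems] c by simp
    next
      \<comment> \<open>The unit sits in another row than \<open>k\<close>. Adding that row to row
        \<open>k\<close>, whose entry is 0, puts the unit at the pivot, in place of a row
        exchange.\<close>
      case ne: False
      then have "M $$ (k, k) = 0" using zero assms(2) by auto
      then have "addrow 1 k i M $$ (k, k) = [:c:]" using c M assms(2) i by simp
      then have "addrow 1 k i M \<in> G"
        using std_addrow(1)[OF less.prems assms(2), of i 1] i ne by (intro diag) auto
      then show ?thesis using std_addrow(2)[OF less.prems assms(2), of i 1] i ne by simp
    qed
  qed
qed

lemma left_invertible_mem:
  assumes "M \<in> carrier_mat r r" "L \<in> carrier_mat r r" "L * M = 1\<^sub>m r"
  shows "M \<in> G"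
proof -
  have "M \<in> G" if "k \<le> r" "std k M" for k M
    using that
  proof (induction "r - k" arbitrary: k M)
    case 0
    then have "k = r" by simp
    then have "M \<in> carrier_mat r r" "\<forall>j<r. \<forall>i<r. M $$ (i, j) = (if i = j then 1 else 0)"
      using 0(3) by (auto simp: std_def)
    then have "M = 1\<^sub>m r" by (intro eq_matI) auto
    then show ?case using one by simp
  next
    case (Suc n)
    show ?case
      by (rule reduce_column[of k]) (use Suc.hyps(1)[of "Suc k"] Suc.hyps(2) Suc.prems in auto)
  qed
  from this[of 0 M] show ?thesis using assms by (auto simp: std_def)
qed

end

section \<open>Elementary symplectic automorphisms\<close>

text \<open>The cyclic derivative of \<open>p(x) b\<close> with respect to \<open>x\<close>.\<close>

definition nder :: "palg \<Rightarrow> palg \<Rightarrow> complex poly \<Rightarrow> palg" where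
  "nder x b p = (\<Sum>k\<le>degree p. Polynomial.coeff p k *\<^sub>C (\<Sum>j<k. e1 * x ^ (k - Suc j) * b * x ^ j))"

text \<open>Removing one \<open>La\<close> opens the cyclic word there: with \<open>j\<close>
  letters in front of it, the \<open>k - Suc j\<close> letters \<open>La\<close> behind it come
  first, then \<open>Lb\<close>, then those \<open>j\<close> letters.\<close>

lemma necklace_word_eq:
  "necklace_word v La (replicate k La @ [Lb]) = (\<Sum>j<k. e1 * v La ^ (k - Suc j) * v Lb * v La ^ j)"
proof -
  let ?w = "replicate k La @ [Lb]"
  have "{j. j < length ?w \<and> ?w ! j = La} = {..<k}"
    by (auto simp: nth_append less_Suc_eq)
  moreover have "word_val v (drop (Suc j) ?w @ take j ?w) = e1 * v La ^ (k - Suc j) * v Lb * v La ^ j"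
    if "j < k" for j
  proof -
    have "drop (Suc j) ?w @ take j ?w = replicate (k - Suc j) La @ [Lb] @ replicate j La"
      using that by (simp add: min_def)
    then show ?thesis by (simp add: word_val_def mult.assoc)
  qed
  ultimately show ?thesis by (simp add: necklace_word_def)
qed

text \<open>The words made of \<open>k\<close> letters \<open>La\<close> and one \<open>Lb\<close>
  are distinct for distinct \<open>k\<close>, so the coefficients of \<open>p\<close> do not merge
  in the formal sum.\<close>

lemma necklace_deriv_eq: "necklace_deriv v La (poly_times_Lb p) = nder (v La) (v Lb) p"
proof -
  let ?f = "\<lambda>k. replicate k La @ [Lb]"
  have inj: "?f k = ?f l \<longleftrightarrow> k = l" for k l
    by (metis append_same_eq length_replicate)
  have lookup: "Poly_Mapping.lookup (poly_times_Lb p) w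
      = (\<Sum>k\<le>degree p. Polynomial.coeff p k when ?f k = w)" for w
    unfolding poly_times_Lb_def lookup_sum lookup_single by simp
  have look: "Poly_Mapping.lookup (poly_times_Lb p) (?f k) = Polynomial.coeff p k" for k
    unfolding lookup inj by (auto simp: when_def coeff_eq_0)
  have keys: "Poly_Mapping.keys (poly_times_Lb p) \<subseteq> ?f ` {..degree p}"
  proof
    fix w assume "w \<in> Poly_Mapping.keys (poly_times_Lb p)"
    then have "(\<Sum>k\<le>degree p. Polynomial.coeff p k when ?f k = w) \<noteq> 0"
      by (simp add: in_keys_iff lookup)
    then obtain k where "k \<in> {..degree p}" "(Polynomial.coeff p k when ?f k = w) \<noteq> 0"
      by (rule sum.not_neutral_contains_not_neutral)
    then show "w \<in> ?f ` {..degree p}" by (auto simp: when_def split: if_splits)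
  qed
  have "necklace_deriv v La (poly_times_Lb p)
      = (\<Sum>w\<in>?f ` {..degree p}. Poly_Mapping.lookup (poly_times_Lb p) w *\<^sub>C necklace_word v La w)"
    unfolding necklace_deriv_def using keys
    by (intro sum.mono_neutral_left) (auto simp: in_keys_iff)
  also have "\<dots> = (\<Sum>k\<le>degree p. Poly_Mapping.lookup (poly_times_Lb p) (?f k) *\<^sub>C necklace_word v La (?f k))"
    by (rule sum.reindex_cong[of ?f]) (auto simp: inj_on_def inj)
  finally show ?thesis unfolding nder_def look necklace_word_eq .
qed

lemma nder_uminus: "nder x (- b) p = - nder x b p" "nder x b (- p) = - nder x b p"
  by (simp_all add: nder_def sum_negf)

text \<open>The identity that makes \<open>Lam\<close> symplectic. For a monomial, the derivative
  sum for \<open>Suc k\<close> is expanded twice, by splitting off its last summand and by splitting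
  off its first; the difference of the two expansions is the commutator with
  \<open>x\<close>.\<close>

lemma nder_comm:
  assumes x: "e1 * x = x" "x * e1 = x" and b: "e1 * b = b" "b * e1 = b"
  shows "x * nder x b p - nder x b p * x = peval p x * b - b * peval p x"
proof -
  have xk: "x * (e1 * x ^ k) = e1 * x ^ Suc k" "e1 * x ^ k * x = e1 * x ^ Suc k" for k
    using x by (metis mult.assoc power_Suc, metis mult.assoc power_Suc2)
  let ?D = "\<lambda>k. \<Sum>j<k. e1 * x ^ (k - Suc j) * b * x ^ j"
  have 1: "?D (Suc k) = x * ?D k + b * (e1 * x ^ k)" for k
  proof -
    have "x * ?D k = (\<Sum>j<k. e1 * x ^ (Suc k - Suc j) * b * x ^ j)"
      unfolding sum_distrib_left
    proof (intro sum.cong refl)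
      fix j assume "j \<in> {..<k}"
      then have "Suc k - Suc j = Suc (k - Suc j)" by auto
      then show "x * (e1 * x ^ (k - Suc j) * b * x ^ j) = e1 * x ^ (Suc k - Suc j) * b * x ^ j"
        using xk(1)[of "k - Suc j"] by (metis mult.assoc)
    qed
    moreover have "e1 * x ^ 0 * b * x ^ k = b * (e1 * x ^ k)"
      using b by (metis mult.assoc mult.right_neutral power_0)
    ultimately show ?thesis by simp
  qed
  have 2: "?D (Suc k) = ?D k * x + e1 * x ^ k * b" for k
  proof -
    have "?D k * x = (\<Sum>j<k. e1 * x ^ (Suc k - Suc (Suc j)) * b * x ^ Suc j)"
      unfolding sum_distrib_right
      by (intro sum.cong refl) (simp add: mult.assoc power_commutes)
    then show ?thesis by (subst sum.lessThan_Suc_shift) simp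
  qed
  have "x * ?D k - ?D k * x = e1 * x ^ k * b - b * (e1 * x ^ k)" for k
    using 1[of k] 2[of k] by (simp add: algebra_simps)
  then have "(\<Sum>k\<le>degree p. Polynomial.coeff p k *\<^sub>C (x * ?D k - ?D k * x))
     = (\<Sum>k\<le>degree p. Polynomial.coeff p k *\<^sub>C (e1 * x ^ k * b - b * (e1 * x ^ k)))"
    by simp
  then show ?thesis
    unfolding nder_def peval_def sum_distrib_left[where A = "{..degree p}"]
      sum_distrib_right[where A = "{..degree p}"] sum_subtractf[symmetric]
    by (simp only: cscale_mult_left cscale_mult_right cs.scale_right_diff_distrib[symmetric])
qed

lemma nder_e1: "e1 * x = x \<Longrightarrow> x * e1 = x \<Longrightarrow> b * e1 = b \<Longrightarrow> e1 * nder x b p = nder x b p \<and> nder x b p * e1 = nder x b p"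
proof
  assume x: "e1 * x = x" "x * e1 = x" and b: "b * e1 = b"
  show "e1 * nder x b p = nder x b p"
    by (simp add: nder_def sum_distrib_left mult.assoc)
  have "x ^ j * e1 = e1 * x ^ j" for j
    using power_commuting_commutes[of x e1 j] x by simp
  then have "b * (x ^ j * e1) = b * x ^ j" for j
    using b by (metis mult.assoc)
  then show "nder x b p * e1 = nder x b p"
    by (simp add: nder_def sum_distrib_right mult.assoc)
qed

lemma nder_CQ: "x \<in> CQ_carrier r \<Longrightarrow> b \<in> CQ_carrier r \<Longrightarrow> nder x b p \<in> CQ_carrier r"
  by (auto simp: nder_def intro!: CQ_sum CQ_cscale CQ_mult CQ_power)

lemma is_end_nder:
  assumes "is_end r \<psi>" "x \<in> CQ_carrier r" "b \<in> CQ_carrier r"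
  shows "\<psi> (nder x b p) = nder (\<psi> x) (\<psi> b) p"
proof -
  note * = is_endD[OF assms(1)]
  have "\<psi> (\<Sum>j<k. e1 * x ^ (k - Suc j) * b * x ^ j) = (\<Sum>j<k. e1 * \<psi> x ^ (k - Suc j) * \<psi> b * \<psi> x ^ j)" for k
    using assms(2,3)
    by (subst is_end_sum[OF assms(1)]) (auto simp: * is_end_power[OF assms(1,2)])
  moreover have "(\<Sum>j<k. e1 * x ^ (k - Suc j) * b * x ^ j) \<in> CQ_carrier r" for k
    using assms(2,3) by (intro CQ_sum) auto
  ultimately show ?thesis
    unfolding nder_def by (subst is_end_sum[OF assms(1)]) (auto simp: *)
qed

lemma I_ideal_sum: "(\<And>i. i \<in> A \<Longrightarrow> f i \<in> I_ideal r) \<Longrightarrow> sum f A \<in> I_ideal r"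
  by (induction A rule: infinite_finite_induct) (auto simp: I_ideal_add, auto simp: I_ideal_iff)

lemma nder_I_ideal: "x \<in> CQ_carrier r \<Longrightarrow> b \<in> I_ideal r \<Longrightarrow> nder x b p \<in> I_ideal r"
proof -
  assume *: "x \<in> CQ_carrier r" "b \<in> I_ideal r"
  have "e1 * x ^ (k - Suc j) * b * x ^ j \<in> I_ideal r" for k j
    using * by (intro I_ideal_mult) auto
  then have "(\<Sum>j<k. e1 * x ^ (k - Suc j) * b * x ^ j) \<in> I_ideal r" for k
    by (intro I_ideal_sum)
  moreover have "c *\<^sub>C y \<in> I_ideal r" if "y \<in> I_ideal r" for c y
    using that by (auto simp: I_ideal_iff)
  ultimately show ?thesis by (simp add: nder_def I_ideal_sum)
qed

section \<open>The first family of symplectic automorphisms\<close>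

lemma xy_simps: "xx (Suc 0) = - dd 1" "xs (Suc 0) = bb 1" "yy (Suc 0) = bb 2" "ys (Suc 0) = dd 2"
  by (simp_all add: xx_def xs_def yy_def ys_def)

text \<open>The minus signs come from \<open>xx 1 = - dd 1\<close>, which enters both the derivative
  and the correction of \<open>dd 2\<close>.\<close>

lemma Lam_arrow_simps:
  "Lam_arrow p Arr_a = aa"
  "Lam_arrow p Arr_as = as - nder aa (dd 1 * bb 2) p"
  "Lam_arrow p (Arr_b i) = (if i = 1 then bb 1 + bb 2 * peval p aa else bb i)"
  "Lam_arrow p (Arr_d i) = (if i = 2 then dd 2 - peval p aa * dd 1 else dd i)"
  by (simp_all add: Lam_arrow_def necklace_deriv_eq xy_simps nder_uminus)

lemma Lam'_arrow_simps:
  "Lam'_arrow p Arr_a = aa + nder as (dd 2 * bb 1) p"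
  "Lam'_arrow p Arr_as = as"
  "Lam'_arrow p (Arr_b i) = (if i = 2 then bb 2 + bb 1 * peval p as else bb i)"
  "Lam'_arrow p (Arr_d i) = (if i = 1 then dd 1 - peval p as * dd 2 else dd i)"
  by (simp_all add: Lam'_arrow_def necklace_deriv_eq xy_simps)

lemma peval_aa_e1: "peval p aa * e1 = peval p aa"
  using peval_commute[of aa e1 p] by (simp add: peval_e1)

lemma Lam_good:
  assumes "r \<ge> 2"
  shows "good_subst r (Lam_arrow p)"
  unfolding good_subst_def
proof
  fix g assume g: "g \<in> arrows r"
  have e: "e1 * (peval p aa * dd 1) = peval p aa * dd 1" "bb 2 * peval p aa * e1 = bb 2 * peval p aa"
    using peval_e1[of p aa] peval_aa_e1[of p] by (metis mult.assoc)+
  have n: "e1 * nder aa (dd 1 * bb 2) p = nder aa (dd 1 * bb 2) p"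
    "nder aa (dd 1 * bb 2) p * e1 = nder aa (dd 1 * bb 2) p"
    using nder_e1[of aa "dd 1 * bb 2" p] by (simp_all add: mult.assoc)
  show "Lam_arrow p g \<in> CQ_carrier r \<and> ee (tgt g) * Lam_arrow p g = Lam_arrow p g
      \<and> Lam_arrow p g * ee (src g) = Lam_arrow p g"
    using g assms e n
    by (cases rule: arrows_cases)
      (auto simp: Lam_arrow_simps nder_CQ distrib_left distrib_right right_diff_distrib left_diff_distrib mult.assoc)
qed

lemma Lam_end: "r \<ge> 2 \<Longrightarrow> is_end r (Lam r p)"
  unfolding Lam_def by (rule is_end_subst_end[OF Lam_good])

lemma Lam_arr: "r \<ge> 2 \<Longrightarrow> g \<in> arrows r \<Longrightarrow> Lam r p (arr g) = Lam_arrow p g"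
  unfolding Lam_def by (rule subst_end_arr[OF Lam_good])

text \<open>All corrections are built from \<open>aa\<close>, \<open>bb 2\<close> and
  \<open>dd 1\<close>, which are fixed, so the corrections for \<open>p\<close> and
  \<open>- p\<close> cancel.\<close>

lemma Lam_inverse:
  assumes r: "r \<ge> 2" and g: "g \<in> arrows r"
  shows "Lam r p (Lam r (- p) (arr g)) = arr g"
proof -
  note * = is_endD[OF Lam_end[OF r]]
  have [simp]: "Lam r p aa = aa" using r by (simp add: Lam_arr Lam_arrow_simps)
  show ?thesis
    using g r
    by (cases rule: arrows_cases)
      (auto simp: Lam_arr Lam_arrow_simps * is_end_nder[OF Lam_end] is_end_peval[OF Lam_end] nder_CQ
        nder_uminus peval_uminus CQ_mult)
qed

text \<open>The corrections of the pairs 1 and 2 cancel at vertex 2 and leave the commutator of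
  \<open>peval p aa\<close> with \<open>dd 1 * bb 2\<close> at vertex 1. By \<open>nder_comm\<close>
  the correction of \<open>as\<close> removes exactly this.\<close>

lemma Lam_c_elem:
  assumes r: "r \<ge> 2"
  shows "Lam r p (c_elem r) = c_elem r"
proof -
  let ?P = "peval p aa" and ?N = "nder aa (dd 1 * bb 2) p"
  let ?f = "\<lambda>\<alpha>. Lam r p (bb \<alpha>) * Lam r p (dd \<alpha>) - Lam r p (dd \<alpha>) * Lam r p (bb \<alpha>)"
  let ?h = "\<lambda>\<alpha>. bb \<alpha> * dd \<alpha> - dd \<alpha> * bb \<alpha>"
  have split: "{1..r} = {1, 2} \<union> {3..r}" using r by auto
  have sum: "sum f {1..r} = f 1 + f 2 + sum f {3..r}" for f :: "nat \<Rightarrow> palg"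
    unfolding split by (subst sum.union_disjoint) auto
  have rest: "sum ?f {3..r} = sum ?h {3..r}"
    using r by (intro sum.cong) (auto simp: Lam_arr Lam_arrow_simps)
  have f12: "?f 1 + ?f 2 = ?h 1 + ?h 2 + (?P * (dd 1 * bb 2) - dd 1 * bb 2 * ?P)"
    using r by (simp add: Lam_arr Lam_arrow_simps algebra_simps)
  have N: "aa * ?N - ?N * aa = ?P * (dd 1 * bb 2) - dd 1 * bb 2 * ?P"
    by (rule nder_comm) (simp_all add: mult.assoc)
  have "Lam r p (c_elem r) = comm aa (as - ?N) + (?f 1 + ?f 2 + sum ?f {3..r})"
    using is_end_c_elem[OF Lam_end[OF r], of p] r unfolding sum by (simp add: Lam_arr Lam_arrow_simps)
  also have "\<dots> = comm aa as - (aa * ?N - ?N * aa) + (?f 1 + ?f 2 + sum ?f {3..r})"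
    by (simp add: comm_def algebra_simps)
  also have "\<dots> = comm aa as + (?h 1 + ?h 2 + sum ?h {3..r})"
    unfolding f12 rest N by (simp add: algebra_simps)
  also have "\<dots> = c_elem r" unfolding c_elem_eq sum ..
  finally show ?thesis .
qed

lemma K_cI:
  assumes "is_end r \<psi>" "is_end r \<phi>"
    and "\<And>g. g \<in> arrows r \<Longrightarrow> \<psi> (\<phi> (arr g)) = arr g" "\<And>g. g \<in> arrows r \<Longrightarrow> \<phi> (\<psi> (arr g)) = arr g"
    and "\<psi> (c_elem r) = c_elem r" "\<psi> aa - aa \<in> I_ideal r" "\<psi> as - as \<in> I_ideal r"
  shows "\<psi> \<in> K_c r"
  using AutI[OF assms(1-4)] assms(5-7) is_reduced_iff[OF assms(1)] by (auto simp: K_c_def Symp_def)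

lemma zero_I_ideal [simp]: "0 \<in> I_ideal r"
  by (simp add: I_ideal_iff)

lemma Lam_K_c:
  assumes r: "r \<ge> 2"
  shows "Lam r p \<in> K_c r"
proof (rule K_cI[OF Lam_end[OF r] Lam_end[OF r, of "- p"]])
  show "Lam r (- p) (Lam r p (arr g)) = arr g" if "g \<in> arrows r" for g
    using Lam_inverse[OF r that, of "- p"] by simp
  have "dd 1 * bb 2 \<in> I_ideal r"
    using r by (auto simp: arr_def of_path_mult I_ideal_iff coeff_at_of_path)
  then have "nder aa (dd 1 * bb 2) p \<in> I_ideal r" by (intro nder_I_ideal) auto
  then show "Lam r p as - as \<in> I_ideal r"
    using r by (auto simp: Lam_arr Lam_arrow_simps I_ideal_iff)
  show "Lam r p aa - aa \<in> I_ideal r"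
    using r by (simp add: Lam_arr Lam_arrow_simps)
qed (use r in \<open>auto simp: Lam_inverse Lam_c_elem\<close>)

section \<open>Affine automorphisms given by monomial matrices\<close>

definition mono_arrow :: "(nat \<Rightarrow> nat) \<Rightarrow> (nat \<Rightarrow> complex) \<Rightarrow> arrow \<Rightarrow> palg" where
  "mono_arrow \<pi> c g = (case g of Arr_b \<alpha> \<Rightarrow> c \<alpha> *\<^sub>C bb (\<pi> \<alpha>) | Arr_d \<alpha> \<Rightarrow> inverse (c \<alpha>) *\<^sub>C dd (\<pi> \<alpha>) | _ \<Rightarrow> arr g)"

text \<open>Permutations carry one transvection to all positions off the diagonal, and scalings
  realise the constant row scalings; together with \<open>Lam'\<close> this suffices for the row
  reduction.\<close>

definition mono_auto :: "nat \<Rightarrow> (nat \<Rightarrow> nat) \<Rightarrow> (nat \<Rightarrow> complex) \<Rightarrow> palg \<Rightarrow> palg" where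
  "mono_auto r \<pi> c = subst_end r (mono_arrow \<pi> c)"

lemma mono_arr_end:
  assumes "\<pi> permutes {1..r}"
  shows "is_end r (mono_auto r \<pi> c)" "g \<in> arrows r \<Longrightarrow> mono_auto r \<pi> c (arr g) = mono_arrow \<pi> c g"
proof -
  have "1 \<le> \<pi> i" "\<pi> i \<le> r" if "1 \<le> i" "i \<le> r" for i
    using permutes_in_image[OF assms, of i] that by auto
  then have "good_subst r (mono_arrow \<pi> c)"
    unfolding good_subst_def by (auto simp: mono_arrow_def elim!: arrows_cases)
  then show "is_end r (mono_auto r \<pi> c)" "g \<in> arrows r \<Longrightarrow> mono_auto r \<pi> c (arr g) = mono_arrow \<pi> c g"
    unfolding mono_auto_def by (auto intro: is_end_subst_end subst_end_arr)
qed

lemma mono_inverse: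
  assumes "\<pi> permutes {1..r}" "\<And>i. c i \<noteq> 0" "g \<in> arrows r"
  shows "mono_auto r \<pi> c (mono_auto r (inv_into UNIV \<pi>) (\<lambda>i. inverse (c (inv_into UNIV \<pi> i))) (arr g)) = arr g"
    and "mono_auto r (inv_into UNIV \<pi>) (\<lambda>i. inverse (c (inv_into UNIV \<pi> i))) (mono_auto r \<pi> c (arr g)) = arr g"
proof -
  have p': "inv_into UNIV \<pi> permutes {1..r}" using assms(1) by (rule permutes_inv)
  have in1: "1 \<le> \<pi> i" "\<pi> i \<le> r" "1 \<le> inv_into UNIV \<pi> i" "inv_into UNIV \<pi> i \<le> r" if "1 \<le> i" "i \<le> r" for i
    using permutes_in_image[OF assms(1), of i] permutes_in_image[OF p', of i] that by auto
  note e = is_endD[OF mono_arr_end(1)[OF assms(1)]] is_endD[OF mono_arr_end(1)[OF p']]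
  note a = mono_arr_end(2)[OF assms(1)] mono_arr_end(2)[OF p']
  show "mono_auto r \<pi> c (mono_auto r (inv_into UNIV \<pi>) (\<lambda>i. inverse (c (inv_into UNIV \<pi> i))) (arr g)) = arr g"
    using assms(3) in1
    by (cases rule: arrows_cases) (auto simp: a mono_arrow_def e permutes_inverses[OF assms(1)] assms(2))
  show "mono_auto r (inv_into UNIV \<pi>) (\<lambda>i. inverse (c (inv_into UNIV \<pi> i))) (mono_auto r \<pi> c (arr g)) = arr g"
    using assms(3) in1
    by (cases rule: arrows_cases) (auto simp: a mono_arrow_def e permutes_inverses[OF assms(1)] assms(2))
qed

lemma mono_Aff:
  assumes "\<pi> permutes {1..r}" "\<And>i. c i \<noteq> 0"
  shows "mono_auto r \<pi> c \<in> Aff_red r"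
proof -
  have p': "inv_into UNIV \<pi> permutes {1..r}" using assms(1) by (rule permutes_inv)
  note a = mono_arr_end(2)[OF assms(1)]
  have "mono_auto r \<pi> c \<in> K_c r"
  proof (rule K_cI[OF mono_arr_end(1)[OF assms(1)] mono_arr_end(1)[OF p']])
    let ?h = "\<lambda>\<alpha>. bb \<alpha> * dd \<alpha> - dd \<alpha> * bb \<alpha>"
    have "(\<Sum>\<alpha>\<in>{1..r}. mono_auto r \<pi> c (bb \<alpha>) * mono_auto r \<pi> c (dd \<alpha>) - mono_auto r \<pi> c (dd \<alpha>) * mono_auto r \<pi> c (bb \<alpha>))
        = (\<Sum>\<alpha>\<in>{1..r}. ?h (\<pi> \<alpha>))"
      by (intro sum.cong) (auto simp: a mono_arrow_def assms(2))
    also have "\<dots> = sum ?h {1..r}"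
      by (rule sum.permute[OF assms(1), unfolded comp_def, symmetric])
    finally show "mono_auto r \<pi> c (c_elem r) = c_elem r"
      unfolding is_end_c_elem[OF mono_arr_end(1)[OF assms(1)]] unfolding c_elem_eq
      by (simp only:) (simp add: a mono_arrow_def)
  qed (use mono_inverse[OF assms] in \<open>auto simp: a mono_arrow_def\<close>)
  moreover have "is_affine r (mono_auto r \<pi> c)"
    unfolding is_affine_def
  proof (intro ballI)
    fix g p assume g: "g \<in> arrows r" "p \<in> supp (mono_auto r \<pi> c (arr g))"
    then have "p \<in> supp (mono_arrow \<pi> c g)" by (simp add: a)
    then show "case p of (t, w, s) \<Rightarrow> length w \<le> 1"
      by (cases g) (auto simp: mono_arrow_def supp_iff arr_def coeff_at_of_path split: if_splits)
  qed
  ultimately show ?thesis by (simp add: Aff_red_def)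
qed

section \<open>Complements in generated subgroups\<close>

context group
begin

lemma generate_set_mult:
  assumes "subgroup A G" "subgroup H G"
  shows "subgroup (generate G (A <#> H)) G" "A \<subseteq> generate G (A <#> H)" "H \<subseteq> generate G (A <#> H)"
proof -
  have AH: "A \<subseteq> carrier G" "H \<subseteq> carrier G" using assms by (auto dest: subgroup.subset)
  have one: "\<one> \<in> A" "\<one> \<in> H" using assms by (auto dest: subgroup.one_closed)
  have sub: "A <#> H \<subseteq> carrier G" using AH by (rule set_mult_closed)
  then show "subgroup (generate G (A <#> H)) G" by (rule generate_is_subgroup)
  have "a \<otimes> \<one> \<in> A <#> H" if "a \<in> A" for a using that one by (auto simp: set_mult_def)
  then have "A \<subseteq> A <#> H" using AH by fastforce
  then show "A \<subseteq> generate G (A <#> H)" by (auto intro: generate.incl)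
  have "\<one> \<otimes> h \<in> A <#> H" if "h \<in> H" for h using that one unfolding set_mult_def by blast
  then have "H \<subseteq> A <#> H" using AH by fastforce
  then show "H \<subseteq> generate G (A <#> H)" by (auto intro: generate.incl)
qed

lemma set_mult_subset_subgroup:
  assumes "subgroup L G" "A \<subseteq> L" "H \<subseteq> L"
  shows "A <#> H \<subseteq> L"
  using assms by (auto simp: set_mult_def intro: subgroup.m_closed)

text \<open>The \<open>A\<close>-conjugates of \<open>H\<close> generate a group normalised by
  \<open>A\<close>, so its set product with \<open>A\<close> is already a subgroup and exhausts the
  generated one. \<open>K\<close> bounds this group: it absorbs the conjugates and meets
  \<open>A\<close> trivially.\<close>

lemma internal_semidirect_generate:
  assumes A: "subgroup A G" and H: "subgroup H G" and K: "subgroup K G" "H \<subseteq> K"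
    and conj: "\<And>a k. a \<in> A \<Longrightarrow> k \<in> K \<Longrightarrow> a \<otimes> k \<otimes> inv a \<in> K"
    and triv: "K \<inter> A \<subseteq> {\<one>}"
  shows "internal_semidirect G (generate G (A <#> H))
    (generate G {a \<otimes> h \<otimes> inv a | a h. a \<in> A \<and> h \<in> H}) A"
proof -
  let ?L = "generate G (A <#> H)" and ?X = "{a \<otimes> h \<otimes> inv a | a h. a \<in> A \<and> h \<in> H}"
  let ?N = "generate G ?X"
  have A_c: "\<And>a. a \<in> A \<Longrightarrow> a \<in> carrier G" and H_c: "\<And>h. h \<in> H \<Longrightarrow> h \<in> carrier G"
    using A H by (auto dest: subgroup.mem_carrier)
  have one: "\<one> \<in> A" "\<one> \<in> H" using A H by (auto dest: subgroup.one_closed)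
  note L = generate_set_mult[OF A H]
  have cancel: "inv a \<otimes> (a \<otimes> z) = z" "a \<otimes> (inv a \<otimes> z) = z" if "a \<in> A" "z \<in> carrier G" for a z
    using A_c[OF that(1)] that(2) by (simp_all add: m_assoc[symmetric])
  have X: "?X \<subseteq> carrier G" using A_c H_c by auto
  then have N: "subgroup ?N G" by (rule generate_is_subgroup)
  note N_c = subgroup.mem_carrier[OF N]
  have NL: "?N \<subseteq> ?L"
  proof (rule generate_subgroup_incl[OF _ L(1)])
    show "?X \<subseteq> ?L"
      using L(2,3) by (auto intro!: subgroup.m_closed[OF L(1)] subgroup.m_inv_closed[OF L(1)])
  qed
  have NK: "?N \<subseteq> K"
    by (rule generate_subgroup_incl[OF _ K(1)]) (use conj K(2) in auto)
  have HN: "H \<subseteq> ?N"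
  proof
    fix h assume h: "h \<in> H"
    then have "\<one> \<otimes> h \<otimes> inv \<one> \<in> ?X" using one by blast
    then show "h \<in> ?N" using generate.incl[of "\<one> \<otimes> h \<otimes> inv \<one>" ?X G] H_c[OF h] by simp
  qed
  \<comment> \<open>Conjugation by \<open>a\<close> is multiplicative, so it is enough to treat the
    generators; there \<open>a\<close> merges with the conjugating element
    \<open>a'\<close>.\<close>
  have AN: "a \<otimes> n \<otimes> inv a \<in> ?N" if a: "a \<in> A" and n: "n \<in> ?N" for a n
    using n
  proof (induction n rule: generate.induct)
    case one
    then show ?case using A_c[OF a] generate.one[of G ?X] by simp
  next
    case (incl x)
    then obtain a' h where x: "x = a' \<otimes> h \<otimes> inv a'" "a' \<in> A" "h \<in> H" by blast
    have "a \<otimes> x \<otimes> inv a = (a \<otimes> a') \<otimes> h \<otimes> inv (a \<otimes> a')"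
      using A_c[OF a] A_c[OF x(2)] H_c[OF x(3)] by (simp add: x(1) m_assoc inv_mult_group)
    moreover have "a \<otimes> a' \<in> A" using a x(2) by (rule subgroup.m_closed[OF A])
    ultimately have "a \<otimes> x \<otimes> inv a \<in> ?X" using x(3) by blast
    then show ?case by (rule generate.incl)
  next
    case (inv x)
    then obtain a' h where x: "x = a' \<otimes> h \<otimes> inv a'" "a' \<in> A" "h \<in> H" by blast
    have "a \<otimes> inv x \<otimes> inv a = inv ((a \<otimes> a') \<otimes> h \<otimes> inv (a \<otimes> a'))"
      using A_c[OF a] A_c[OF x(2)] H_c[OF x(3)] by (simp add: x(1) m_assoc inv_mult_group)
    moreover have "a \<otimes> a' \<in> A" using a x(2) by (rule subgroup.m_closed[OF A])
    ultimately show ?case using x(3) generate.inv[of "(a \<otimes> a') \<otimes> h \<otimes> inv (a \<otimes> a')" ?X G] by auto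
  next
    case (eng x y)
    have c: "x \<in> carrier G" "y \<in> carrier G" using eng N_c by auto
    have "a \<otimes> (x \<otimes> y) \<otimes> inv a = (a \<otimes> x \<otimes> inv a) \<otimes> (a \<otimes> y \<otimes> inv a)"
      using A_c[OF a] c by (simp add: m_assoc cancel[OF a])
    then show ?case using generate.eng[OF eng.IH] by (simp only:)
  qed
  have S: "subgroup (A <#> ?N) G"
  proof (rule subgroupI)
    show "A <#> ?N \<subseteq> carrier G" using A_c N_c by (auto simp: set_mult_def)
    show "A <#> ?N \<noteq> {}" using one generate.one[of G ?X] by (auto simp: set_mult_def)
  next
    fix x assume "x \<in> A <#> ?N"
    then obtain a n where x: "x = a \<otimes> n" "a \<in> A" "n \<in> ?N" by (auto simp: set_mult_def)
    have a: "inv a \<in> A" using x(2) by (rule subgroup.m_inv_closed[OF A])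
    have n: "inv n \<in> ?N" using x(3) by (rule subgroup.m_inv_closed[OF N])
    \<comment> \<open>Moving the inverse of \<open>a\<close> to the front conjugates the inverse of
      \<open>n\<close>, which stays in the group by \<open>AN\<close>.\<close>
    have "inv x = inv a \<otimes> (a \<otimes> inv n \<otimes> inv a)"
      using A_c[OF x(2)] N_c[OF x(3)] by (simp add: x(1) inv_mult_group m_assoc[symmetric])
    then show "inv x \<in> A <#> ?N" using a AN[OF x(2) n] by (auto simp: set_mult_def)
  next
    fix x y assume "x \<in> A <#> ?N" "y \<in> A <#> ?N"
    then obtain a n b m where x: "x = a \<otimes> n" "a \<in> A" "n \<in> ?N" and y: "y = b \<otimes> m" "b \<in> A" "m \<in> ?N"
      by (auto simp: set_mult_def)
    have b: "inv b \<in> A" using y(2) by (rule subgroup.m_inv_closed[OF A])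
    have n: "inv b \<otimes> n \<otimes> b \<in> ?N" using AN[OF b x(3)] A_c[OF y(2)] by simp
    have "x \<otimes> y = (a \<otimes> b) \<otimes> ((inv b \<otimes> n \<otimes> b) \<otimes> m)"
      using A_c[OF x(2)] A_c[OF y(2)] N_c[OF x(3)] N_c[OF y(3)]
      by (simp add: x(1) y(1) m_assoc cancel[OF y(2)])
    moreover have "a \<otimes> b \<in> A" using x(2) y(2) by (rule subgroup.m_closed[OF A])
    moreover have "(inv b \<otimes> n \<otimes> b) \<otimes> m \<in> ?N" using n y(3) by (rule subgroup.m_closed[OF N])
    ultimately show "x \<otimes> y \<in> A <#> ?N" by (auto simp: set_mult_def)
  qed
  have AS: "A <#> H \<subseteq> A <#> ?N" using HN by (auto simp: set_mult_def)
  have SL: "A <#> ?N = ?L"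
  proof
    show "A <#> ?N \<subseteq> ?L" by (rule set_mult_subset_subgroup[OF L(1) L(2) NL])
    show "?L \<subseteq> A <#> ?N" by (rule generate_subgroup_incl[OF AS S])
  qed
  have normal: "l \<otimes> n \<otimes> inv l \<in> ?N" if l: "l \<in> ?L" and n: "n \<in> ?N" for l n
  proof -
    have "l \<in> A <#> ?N" using l by (simp only: SL)
    then obtain a m where x: "l = a \<otimes> m" "a \<in> A" "m \<in> ?N" by (auto simp: set_mult_def)
    have "m \<otimes> n \<otimes> inv m \<in> ?N"
      using x(3) n by (intro subgroup.m_closed[OF N] subgroup.m_inv_closed[OF N])
    from AN[OF x(2) this] show ?thesis
      using A_c[OF x(2)] N_c[OF x(3)] N_c[OF n] by (simp add: x(1) m_assoc inv_mult_group)
  qed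
  have GL: "group (G\<lparr>carrier := ?L\<rparr>)" using L(1) is_group by (rule subgroup.subgroup_is_group)
  have "?N \<lhd> G\<lparr>carrier := ?L\<rparr>"
    unfolding group.normal_inv_iff[OF GL]
    using subgroup_incl[OF N L(1) NL] normal m_inv_consistent[OF L(1)] by simp
  moreover have "?N \<inter> A = {\<one>}" using triv NK one(1) generate.one[of G ?X] by auto
  ultimately show ?thesis
    unfolding internal_semidirect_def using L(1) subgroup_incl[OF A L(1) L(2)] SL by blast
qed

end

section \<open>The automorphisms of the free algebra on the loops\<close>

lemma Free2_simps [simp]: "monoid.mult Free2 = (*)" "add Free2 = (+)" "\<one>\<^bsub>Free2\<^esub> = e1"
  by (simp_all add: Free2_def)

lemma Free2_iff: "x \<in> carrier Free2 \<longleftrightarrow>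
    (\<forall>t w s. coeff_at x (t, w, s) \<noteq> 0 \<longrightarrow> t = V1 \<and> s = V1 \<and> w \<in> lists {Arr_a, Arr_as})"
  by (auto simp add: Free2_def supp_iff[symmetric])

lemma Free2_closed:
  shows "e1 \<in> carrier Free2" "aa \<in> carrier Free2" "as \<in> carrier Free2" "0 \<in> carrier Free2"
    and "x \<in> carrier Free2 \<Longrightarrow> y \<in> carrier Free2 \<Longrightarrow> x + y \<in> carrier Free2"
    and "x \<in> carrier Free2 \<Longrightarrow> c *\<^sub>C x \<in> carrier Free2"
    and "x \<in> carrier Free2 \<Longrightarrow> - x \<in> carrier Free2"
proof -
  show "x + y \<in> carrier Free2" if "x \<in> carrier Free2" "y \<in> carrier Free2"
    using that unfolding Free2_iff coeff_at_add by (metis add.right_neutral)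
qed (auto simp: Free2_iff ee_def arr_def coeff_at_of_path split: if_splits)

lemma Free2_mult:
  assumes "x \<in> carrier Free2" "y \<in> carrier Free2"
  shows "x * y \<in> carrier Free2"
proof (induction x rule: palg_induct)
  case (path c p)
  then obtain u where p: "p = (V1, u, V1)" "u \<in> lists {Arr_a, Arr_as}"
    using assms(1) by (cases p) (auto simp: Free2_iff supp_iff)
  show ?case
  proof (induction y rule: palg_induct)
    case (path d q)
    then obtain v where q: "q = (V1, v, V1)" "v \<in> lists {Arr_a, Arr_as}"
      using assms(2) by (cases q) (auto simp: Free2_iff supp_iff)
    have "of_path (V1, u @ v, V1) \<in> carrier Free2"
      using p q by (auto simp: Free2_iff coeff_at_of_path)
    then show ?case by (simp add: p q of_path_mult Free2_closed)
  qed (auto simp: algebra_simps Free2_closed simp del: mult_zero_right)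
qed (auto simp: algebra_simps Free2_closed)

lemma Free2_CQ: "x \<in> carrier Free2 \<Longrightarrow> x \<in> CQ_carrier r"
proof -
  assume x: "x \<in> carrier Free2"
  have "is_path r (V1, w, V1)" if "w \<in> lists {Arr_a, Arr_as}" for w
    using that by (induction w) auto
  then have "is_path r (t, w, s)" if "coeff_at x (t, w, s) \<noteq> 0" for t w s
    using x that unfolding Free2_iff by blast
  then show ?thesis by (auto simp: CQ_iff)
qed

lemma Free2_e1: "x \<in> carrier Free2 \<Longrightarrow> e1 * x = x" "x \<in> carrier Free2 \<Longrightarrow> x * e1 = x"
  by (auto simp: ee_left_iff ee_right_iff Free2_iff supp_iff)

lemma Free2_induct [consumes 1, case_names unit left add scale]:
  assumes "x \<in> carrier Free2" "P e1"
    "\<And>g x. g \<in> {Arr_a, Arr_as} \<Longrightarrow> x \<in> carrier Free2 \<Longrightarrow> P x \<Longrightarrow> P (arr g * x)"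
    "\<And>x y. x \<in> carrier Free2 \<Longrightarrow> y \<in> carrier Free2 \<Longrightarrow> P x \<Longrightarrow> P y \<Longrightarrow> P (x + y)"
    "\<And>c x. x \<in> carrier Free2 \<Longrightarrow> P x \<Longrightarrow> P (c *\<^sub>C x)"
  shows "P x"
proof -
  have pth: "of_path (V1, w, V1) \<in> carrier Free2 \<and> P (of_path (V1, w, V1))"
    if "w \<in> lists {Arr_a, Arr_as}" for w
    using that
  proof (induction w)
    case Nil
    then show ?case using assms(2) Free2_closed(1) by (simp add: of_path_Nil)
  next
    case (Cons g w)
    then have "of_path (V1, g # w, V1) = arr g * of_path (V1, w, V1)"
      using of_path_Cons[of g w V1] by auto
    moreover have "arr g \<in> carrier Free2" using Cons.hyps Free2_closed by auto
    ultimately show ?case using Cons assms(3) by (simp add: Free2_mult)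
  qed
  have P0: "P 0" using assms(5)[of e1 0] assms(2) Free2_closed(1) by simp
  have "x \<in> carrier Free2 \<and> P x"
  proof (induction x rule: palg_induct)
    case (path c p)
    then obtain w where "p = (V1, w, V1)" "w \<in> lists {Arr_a, Arr_as}"
      using assms(1) by (cases p) (auto simp: Free2_iff supp_iff)
    then show ?case using pth assms(5) Free2_closed by auto
  qed (auto intro: P0 assms(4) Free2_closed)
  then show ?thesis ..
qed

lemma Free2_is_end_closed:
  assumes "is_end r \<psi>" "\<psi> aa \<in> carrier Free2" "\<psi> as \<in> carrier Free2" "x \<in> carrier Free2"
  shows "\<psi> x \<in> carrier Free2"
  using assms(4)
proof (induction x rule: Free2_induct)
  case (left g x)
  then have "\<psi> (arr g * x) = \<psi> (arr g) * \<psi> x" using is_endD(4)[OF assms(1)] Free2_CQ by auto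
  then show ?case using left assms(2,3) by (auto intro: Free2_mult)
qed (auto simp: is_endD[OF assms(1)] Free2_CQ Free2_closed)

lemma Aut_Free2_D:
  assumes "\<phi> \<in> Aut_Free2"
  shows "bij_betw \<phi> (carrier Free2) (carrier Free2)" "\<phi> \<in> extensional (carrier Free2)"
    and "\<And>x y. x \<in> carrier Free2 \<Longrightarrow> y \<in> carrier Free2 \<Longrightarrow> \<phi> (x + y) = \<phi> x + \<phi> y"
    and "\<And>x y. x \<in> carrier Free2 \<Longrightarrow> y \<in> carrier Free2 \<Longrightarrow> \<phi> (x * y) = \<phi> x * \<phi> y"
    and "\<And>c x. x \<in> carrier Free2 \<Longrightarrow> \<phi> (c *\<^sub>C x) = c *\<^sub>C \<phi> x"
    and "\<phi> e1 = e1" "\<phi> (comm aa as) = comm aa as"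
    and "\<And>x. x \<in> carrier Free2 \<Longrightarrow> \<phi> x \<in> carrier Free2"
  using assms by (auto simp: Aut_Free2_def alg_auto_def Bij_def Ring.ring_hom_def clinear_on_def)

lemma comm_Free2: "comm aa as \<in> carrier Free2"
  unfolding comm_def using Free2_mult Free2_closed by (metis diff_conv_add_uminus)

abbreviation loop_arrow :: "(palg \<Rightarrow> palg) \<Rightarrow> arrow \<Rightarrow> palg" where
  "loop_arrow \<phi> \<equiv> \<lambda>g. if g \<in> {Arr_a, Arr_as} then \<phi> (arr g) else arr g"

lemma embed0_end:
  assumes "\<phi> aa \<in> carrier Free2" "\<phi> as \<in> carrier Free2"
  shows "is_end r (embed0 r \<phi>)" "g \<in> arrows r \<Longrightarrow> embed0 r \<phi> (arr g) = loop_arrow \<phi> g"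
proof -
  have "good_subst r (loop_arrow \<phi>)"
    unfolding good_subst_def using assms Free2_CQ Free2_e1 by (auto elim!: arrows_cases)
  then show "is_end r (embed0 r \<phi>)" "g \<in> arrows r \<Longrightarrow> embed0 r \<phi> (arr g) = loop_arrow \<phi> g"
    unfolding embed0_def by (auto intro!: is_end_subst_end simp: subst_end_arr)
qed

text \<open>The embedding extends \<phi>: both are multiplicative on the free algebra and agree on
  the two loops.\<close>

lemma embed0_Free2:
  assumes "\<phi> \<in> Aut_Free2" "x \<in> carrier Free2"
  shows "embed0 r \<phi> x = \<phi> x"
proof -
  note \<phi> = Aut_Free2_D[OF assms(1)]
  note e = embed0_end[where r = r, OF \<phi>(8)[OF Free2_closed(2)] \<phi>(8)[OF Free2_closed(3)]]
  note i = is_endD[OF e(1)]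
  show ?thesis using assms(2)
  proof (induction x rule: Free2_induct)
    case (left g x)
    have "arr g \<in> carrier Free2" "g \<in> arrows r" using left Free2_closed by auto
    then show ?case using left e(2)[of g] by (simp add: i \<phi> Free2_CQ)
  qed (simp_all add: i \<phi> Free2_CQ)
qed

lemma inv_Aut_Free2:
  assumes "\<phi> \<in> Aut_Free2"
  shows "restrict (inv_into (carrier Free2) \<phi>) (carrier Free2) \<in> Aut_Free2"
proof -
  note \<phi> = Aut_Free2_D[OF assms]
  let ?i = "inv_into (carrier Free2) \<phi>"
  have i: "?i y \<in> carrier Free2" "\<phi> (?i y) = y" if "y \<in> carrier Free2" for y
    using \<phi>(1) that by (auto simp: bij_betw_def inv_into_into f_inv_into_f)
  have inv: "?i y = x" if "\<phi> x = y" "x \<in> carrier Free2" for x y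
    using \<phi>(1) that by (auto simp: bij_betw_def)
  have "restrict ?i (carrier Free2) \<in> Bij (carrier Free2)"
    by (rule restrict_inv_into_Bij) (use \<phi> in \<open>simp add: Bij_def\<close>)
  then show ?thesis
    by (auto simp: Aut_Free2_def alg_auto_def Ring.ring_hom_def clinear_on_def i \<phi> Free2_closed Free2_mult
        comm_Free2 intro!: inv)
qed

lemma embed0_Symp:
  assumes "\<phi> \<in> Aut_Free2"
  shows "embed0 r \<phi> \<in> Symp r"
proof -
  let ?F = "carrier Free2"
  let ?i = "restrict (inv_into ?F \<phi>) ?F"
  note \<phi> = Aut_Free2_D[OF assms]
  have i: "?i \<in> Aut_Free2" using assms by (rule inv_Aut_Free2)
  note \<iota> = Aut_Free2_D[OF i]
  have li: "\<phi> (?i x) = x" "?i (\<phi> x) = x" if "x \<in> ?F" for x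
    using \<phi>(1,8) that by (auto simp: bij_betw_def f_inv_into_f)
  note e = embed0_end[where r = r, OF \<phi>(8)[OF Free2_closed(2)] \<phi>(8)[OF Free2_closed(3)]]
  note e' = embed0_end[where r = r, OF \<iota>(8)[OF Free2_closed(2)] \<iota>(8)[OF Free2_closed(3)]]
  have "embed0 r \<phi> \<in> Aut r"
  proof (rule AutI[OF e(1) e'(1)])
    fix g assume g: "g \<in> arrows r"
    have F: "arr g \<in> ?F" if "g \<in> {Arr_a, Arr_as}" using that Free2_closed by auto
    show "embed0 r \<phi> (embed0 r ?i (arr g)) = arr g"
      using g F li \<iota>(8) by (cases "g \<in> {Arr_a, Arr_as}")
        (simp_all add: e(2) e'(2) embed0_Free2[OF assms] del: restrict_apply)
    show "embed0 r ?i (embed0 r \<phi> (arr g)) = arr g"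
      using g F li \<phi>(8) by (cases "g \<in> {Arr_a, Arr_as}")
        (simp_all add: e(2) e'(2) embed0_Free2[OF i] del: restrict_apply)
  qed
  moreover have "embed0 r \<phi> (c_elem r) = c_elem r"
  proof -
    have c: "comm (embed0 r \<phi> aa) (embed0 r \<phi> as) = embed0 r \<phi> (comm aa as)"
      by (simp add: comm_def is_endD[OF e(1)])
    also have "\<dots> = comm aa as" by (simp add: embed0_Free2[OF assms] comm_Free2 \<phi>)
    finally have "comm (\<phi> aa) (\<phi> as) = comm aa as" by (simp add: e(2))
    then show ?thesis unfolding is_end_c_elem[OF e(1)] unfolding c_elem_eq by (simp add: e(2))
  qed
  ultimately show ?thesis by (simp add: Symp_def)
qed

text \<open>An intrinsic description from which closure under products and inverses follows by
  comparing images of sets. Equality of the images, not mere inclusion, makes the restriction of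
  \<psi> to the free algebra surjective.\<close>

lemma Aut0_iff:
  "\<psi> \<in> Aut0 r \<longleftrightarrow> \<psi> \<in> Symp r \<and> (\<forall>g\<in>arrows r - {Arr_a, Arr_as}. \<psi> (arr g) = arr g)
     \<and> \<psi> ` carrier Free2 = carrier Free2"
proof
  assume "\<psi> \<in> Aut0 r"
  then obtain \<phi> where \<phi>: "\<phi> \<in> Aut_Free2" "\<psi> = embed0 r \<phi>" by (auto simp: Aut0_def)
  note D = Aut_Free2_D[OF \<phi>(1)]
  note e = embed0_end[where r = r, OF D(8)[OF Free2_closed(2)] D(8)[OF Free2_closed(3)]]
  have "\<psi> ` carrier Free2 = \<phi> ` carrier Free2"
    using embed0_Free2[OF \<phi>(1)] by (auto simp: \<phi>(2))
  then show "\<psi> \<in> Symp r \<and> (\<forall>g\<in>arrows r - {Arr_a, Arr_as}. \<psi> (arr g) = arr g)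
     \<and> \<psi> ` carrier Free2 = carrier Free2"
    using D(1) embed0_Symp[OF \<phi>(1)] e(2) by (auto simp: \<phi>(2) bij_betw_def)
next
  assume *: "\<psi> \<in> Symp r \<and> (\<forall>g\<in>arrows r - {Arr_a, Arr_as}. \<psi> (arr g) = arr g)
     \<and> \<psi> ` carrier Free2 = carrier Free2"
  let ?\<phi> = "restrict \<psi> (carrier Free2)"
  have e: "is_end r \<psi>" using * by (simp add: Symp_iff)
  note i = is_endD[OF e]
  have F: "\<psi> aa \<in> carrier Free2" "\<psi> as \<in> carrier Free2" using * Free2_closed by auto
  have fixes_arr: "\<psi> (bb \<alpha>) = bb \<alpha>" "\<psi> (dd \<alpha>) = dd \<alpha>" if "\<alpha> \<in> {1..r}" for \<alpha> using * that by auto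
  have c: "\<psi> (c_elem r) = c_elem r" using * by (simp add: Symp_iff)
  have "comm (\<psi> aa) (\<psi> as) = comm aa as"
  proof -
    have "(\<Sum>\<alpha>\<in>{1..r}. \<psi> (bb \<alpha>) * \<psi> (dd \<alpha>) - \<psi> (dd \<alpha>) * \<psi> (bb \<alpha>)) = (\<Sum>\<alpha>\<in>{1..r}. bb \<alpha> * dd \<alpha> - dd \<alpha> * bb \<alpha>)"
      using fixes_arr by (intro sum.cong) auto
    then show ?thesis using c[unfolded is_end_c_elem[OF e], unfolded c_elem_eq] by simp
  qed
  moreover have "inj_on \<psi> (carrier Free2)"
    using * Free2_CQ by (auto simp: Symp_iff bij_betw_def intro: inj_on_subset)
  ultimately have "?\<phi> \<in> Aut_Free2"
    using * by (auto simp: Aut_Free2_def alg_auto_def Bij_def bij_betw_def Ring.ring_hom_def clinear_on_def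
        i Free2_closed Free2_mult Free2_CQ comm_Free2 inj_on_def) (auto simp: comm_def i)
  moreover have "embed0 r ?\<phi> = \<psi>"
    unfolding embed0_def by (rule subst_end_eqI(1)[OF e]) (use * Free2_closed in auto)
  ultimately show "\<psi> \<in> Aut0 r" unfolding Aut0_def by (metis image_eqI)
qed

lemma Aut0_Symp: "Aut0 r \<subseteq> Symp r"
  by (auto simp: Aut0_iff)

lemma Aut0_subgroup: "subgroup (Aut0 r) (SympGrp r)"
proof (rule group.subgroupI[OF group_SympGrp])
  have "\<one>\<^bsub>SympGrp r\<^esub> \<in> Symp r"
    using monoid.one_closed[OF group.is_monoid[OF group_SympGrp[of r]]] by simp
  then have "\<one>\<^bsub>SympGrp r\<^esub> \<in> Aut0 r"
    unfolding Aut0_iff one_SympGrp using Free2_CQ by (auto simp: image_iff)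
  then show "Aut0 r \<noteq> {}" by blast
next
  fix \<psi> assume \<psi>: "\<psi> \<in> Aut0 r"
  then have S: "\<psi> \<in> Symp r" using Aut0_Symp by blast
  let ?i = "inv\<^bsub>SympGrp r\<^esub> \<psi>"
  have fixes_arr: "?i (arr g) = arr g" if "g \<in> arrows r - {Arr_a, Arr_as}" for g
    using \<psi> that inv_SympGrp_apply(1)[OF S, of "arr g"] by (auto simp: Aut0_iff)
  have "\<psi> ` carrier Free2 = carrier Free2" using \<psi> by (simp add: Aut0_iff)
  then have "?i ` carrier Free2 = ?i ` (\<psi> ` carrier Free2)" by simp
  also have "\<dots> = carrier Free2"
    using inv_SympGrp_apply(1)[OF S Free2_CQ] by (auto simp: image_iff)
  finally show "?i \<in> Aut0 r" unfolding Aut0_iff using fixes_arr inv_Symp[OF S] by blast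
next
  fix \<psi> \<phi> assume *: "\<psi> \<in> Aut0 r" "\<phi> \<in> Aut0 r"
  then have S: "\<psi> \<in> Symp r" "\<phi> \<in> Symp r" using Aut0_Symp by blast+
  have "(\<psi> \<otimes>\<^bsub>SympGrp r\<^esub> \<phi>) ` carrier Free2 = \<psi> ` (\<phi> ` carrier Free2)"
    using mult_SympGrp_apply[OF S Free2_CQ] by (auto simp: image_iff)
  then show "\<psi> \<otimes>\<^bsub>SympGrp r\<^esub> \<phi> \<in> Aut0 r"
    using * S unfolding Aut0_iff by (auto simp: mult_Symp mult_SympGrp_apply)
qed (use Aut0_Symp in auto)

text \<open>For a loop \<open>g\<close>, the difference \<open>\<psi> (arr g) - arr g\<close> lies
  in the free algebra on the loops and in \<open>I_ideal r\<close>; these two meet only in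
  0.\<close>

lemma K_c_Aut0: "K_c r \<inter> Aut0 r \<subseteq> {\<one>\<^bsub>SympGrp r\<^esub>}"
proof
  fix \<psi> assume *: "\<psi> \<in> K_c r \<inter> Aut0 r"
  then have e: "is_end r \<psi>" by (simp add: K_c_def Symp_iff)
  have loop: "\<psi> (arr g) = arr g" if g: "g \<in> {Arr_a, Arr_as}" for g
  proof -
    have F: "arr g \<in> carrier Free2" using g Free2_closed by auto
    then have "\<psi> (arr g) \<in> carrier Free2" using * by (auto simp: Aut0_iff)
    then have "\<psi> (arr g) + - arr g \<in> carrier Free2" using F Free2_closed by blast
    moreover have "\<psi> (arr g) - arr g \<in> I_ideal r"
      using * g by (auto simp: K_c_def is_reduced_def)
    ultimately have "coeff_at (\<psi> (arr g) - arr g) (t, w, s) = 0" for t w s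
      unfolding I_ideal_iff Free2_iff by (metis uminus_add_conv_diff add.commute)
    then have "\<psi> (arr g) - arr g = 0"
      by (intro palg_eqI) (metis coeff_at_0 prod_cases3)
    then show ?thesis by simp
  qed
  have "\<psi> = \<one>\<^bsub>SympGrp r\<^esub>" unfolding one_SympGrp
  proof (rule is_end_eqI[OF e is_end_id])
    fix g assume "g \<in> arrows r"
    then show "\<psi> (arr g) = restrict (\<lambda>x. x) (CQ_carrier r) (arr g)"
      using loop * by (cases "g \<in> {Arr_a, Arr_as}") (auto simp: Aut0_iff)
  qed
  then show "\<psi> \<in> {\<one>\<^bsub>SympGrp r\<^esub>}" by simp
qed

section \<open>The Fourier automorphism exchanges the two families\<close>

text \<open>A quarter turn of the plane spanned by the two loops; the sign preserves their
  commutator.\<close>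

definition fourier :: "nat \<Rightarrow> palg \<Rightarrow> palg" where
  "fourier r = subst_end r (\<lambda>g. if g = Arr_a then as else if g = Arr_as then - aa else arr g)"

definition fourier_inv :: "nat \<Rightarrow> palg \<Rightarrow> palg" where
  "fourier_inv r = subst_end r (\<lambda>g. if g = Arr_a then - as else if g = Arr_as then aa else arr g)"

lemma fourier_end:
  "is_end r (fourier r)"
  "g \<in> arrows r \<Longrightarrow> fourier r (arr g) = (if g = Arr_a then as else if g = Arr_as then - aa else arr g)"
  "is_end r (fourier_inv r)"
  "g \<in> arrows r \<Longrightarrow> fourier_inv r (arr g) = (if g = Arr_a then - as else if g = Arr_as then aa else arr g)"
proof -
  have "good_subst r (\<lambda>g. if g = Arr_a then as else if g = Arr_as then - aa else arr g)"
    "good_subst r (\<lambda>g. if g = Arr_a then - as else if g = Arr_as then aa else arr g)"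
    by (auto simp: good_subst_def)
  then show "is_end r (fourier r)"
    "g \<in> arrows r \<Longrightarrow> fourier r (arr g) = (if g = Arr_a then as else if g = Arr_as then - aa else arr g)"
    "is_end r (fourier_inv r)"
    "g \<in> arrows r \<Longrightarrow> fourier_inv r (arr g) = (if g = Arr_a then - as else if g = Arr_as then aa else arr g)"
    unfolding fourier_def fourier_inv_def by (simp_all add: is_end_subst_end subst_end_arr)
qed

lemma fourier_fourier_inv:
  assumes "g \<in> arrows r"
  shows "fourier r (fourier_inv r (arr g)) = arr g" "fourier_inv r (fourier r (arr g)) = arr g"
  using assms by (auto simp: fourier_end is_endD[OF fourier_end(1)] is_endD[OF fourier_end(3)])

lemma fourier_Symp: "fourier r \<in> Symp r" "fourier_inv r \<in> Symp r"
proof -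
  have "comm as (- aa) = comm aa as" "comm (- as) aa = comm aa as" by (simp_all add: comm_def)
  then have "fourier r (c_elem r) = c_elem r" "fourier_inv r (c_elem r) = c_elem r"
    unfolding is_end_c_elem[OF fourier_end(1)] is_end_c_elem[OF fourier_end(3)]
    unfolding c_elem_eq by (simp_all add: fourier_end)
  then show "fourier r \<in> Symp r" "fourier_inv r \<in> Symp r"
    using AutI[OF fourier_end(1) fourier_end(3)] AutI[OF fourier_end(3) fourier_end(1)]
    by (auto simp: Symp_def fourier_fourier_inv)
qed

lemma inv_fourier: "inv\<^bsub>SympGrp r\<^esub> fourier r = fourier_inv r"
proof -
  interpret group "SympGrp r" by (rule group_SympGrp)
  have "fourier_inv r \<otimes>\<^bsub>SympGrp r\<^esub> fourier r = \<one>\<^bsub>SympGrp r\<^esub>"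
    unfolding mult_SympGrp[OF fourier_Symp(2,1)] one_SympGrp
    by (rule is_end_eqI[OF is_end_compose[OF fourier_end(3,1)] is_end_id])
      (simp add: compose_eq fourier_fourier_inv)
  then show ?thesis using fourier_Symp by (intro inv_equality) auto
qed

lemma fourier_Aut0: "fourier r \<in> Aut0 r" "fourier_inv r \<in> Aut0 r"
proof -
  have closed: "fourier r x \<in> carrier Free2" "fourier_inv r x \<in> carrier Free2" if "x \<in> carrier Free2" for x
    using that Free2_is_end_closed[OF fourier_end(1)] Free2_is_end_closed[OF fourier_end(3)] Free2_closed
    by (auto simp: fourier_end)
  have "fourier r (fourier_inv r x) = x" if "x \<in> carrier Free2" for x
    using inv_SympGrp_apply(2)[OF fourier_Symp(1) Free2_CQ[OF that], of r] by (simp add: inv_fourier)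
  then have "fourier r ` carrier Free2 = carrier Free2"
    using closed by (metis (no_types, lifting) image_eqI image_subsetI subset_antisym subsetI)
  then show F: "fourier r \<in> Aut0 r"
    using fourier_Symp(1) by (auto simp: Aut0_iff fourier_end)
  show "fourier_inv r \<in> Aut0 r"
    using subgroup.m_inv_closed[OF Aut0_subgroup F] by (simp add: inv_fourier)
qed

text \<open>\<open>Lam\<close> adds a multiple of \<open>bb 2\<close> to \<open>bb 1\<close>, while
  \<open>Lam'\<close> adds a multiple of \<open>bb 1\<close> to \<open>bb 2\<close>. The quarter
  turn exchanges the loops only, so the indices have to be exchanged separately.\<close>

definition swap12 :: "nat \<Rightarrow> palg \<Rightarrow> palg" where
  "swap12 r = mono_auto r (Transposition.transpose 1 2) (\<lambda>_. 1)"

lemma swap12_Aff: "r \<ge> 2 \<Longrightarrow> swap12 r \<in> Aff_red r"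
  unfolding swap12_def by (rule mono_Aff) (auto intro: permutes_swap_id)

lemma Aff_K_c: "Aff_red r \<subseteq> K_c r"
  by (auto simp: Aff_red_def)

lemma K_c_Symp: "K_c r \<subseteq> Symp r"
  by (auto simp: K_c_def)

text \<open>As \<open>swap12 r\<close> is its own inverse, the right-hand side is a conjugate of
  \<open>Lam r p\<close>. Only values on arrows are compared; that \<open>Lam'\<close> is well
  defined and symplectic is then inherited from \<open>Lam\<close> without a second
  computation.\<close>

lemma Lam'_conj:
  assumes r: "r \<ge> 2"
  shows "Lam' r p = (fourier r \<otimes>\<^bsub>SympGrp r\<^esub> swap12 r) \<otimes>\<^bsub>SympGrp r\<^esub> Lam r p
    \<otimes>\<^bsub>SympGrp r\<^esub> (swap12 r \<otimes>\<^bsub>SympGrp r\<^esub> fourier_inv r)" (is "_ = ?\<psi>")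
    and "is_end r (Lam' r p)" "g \<in> arrows r \<Longrightarrow> Lam' r p (arr g) = Lam'_arrow p g"
proof -
  let ?s = "swap12 r"
  have s: "?s \<in> Symp r" using swap12_Aff[OF r] Aff_K_c K_c_Symp by blast
  have L: "Lam r p \<in> Symp r" using Lam_K_c[OF r] K_c_Symp by blast
  have m: "fourier r \<otimes>\<^bsub>SympGrp r\<^esub> ?s \<in> Symp r" "?s \<otimes>\<^bsub>SympGrp r\<^esub> fourier_inv r \<in> Symp r"
    "(fourier r \<otimes>\<^bsub>SympGrp r\<^esub> ?s) \<otimes>\<^bsub>SympGrp r\<^esub> Lam r p \<in> Symp r"
    using s L fourier_Symp by (auto intro!: mult_Symp)
  have \<psi>: "is_end r ?\<psi>" by (rule Symp_end[OF mult_Symp[OF m(3,2)]])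
  note F = is_endD[OF fourier_end(1)[of r]] and F' = is_endD[OF fourier_end(3)[of r]]
    and S = is_endD[OF Symp_end[OF s]] and D = is_endD[OF Symp_end[OF L]]
  have perm: "Transposition.transpose 1 2 permutes {1..r}" using r by (intro permutes_swap_id) auto
  have s_arr: "?s (arr g) = mono_arrow (Transposition.transpose 1 2) (\<lambda>_. 1) g" if "g \<in> arrows r" for g
    unfolding swap12_def using mono_arr_end(2)[OF perm that] .
  have apply_eq: "?\<psi> x = fourier r (?s (Lam r p (?s (fourier_inv r x))))" if "x \<in> CQ_carrier r" for x
    using that m s L fourier_Symp F'(2) S(2) D(2) by (simp add: mult_SympGrp_apply)
  have "?\<psi> (arr g) = Lam'_arrow p g" if g: "g \<in> arrows r" for g
  proof -
    have [simp]: "?s aa = aa" "?s as = as" "?s (bb 1) = bb 2" "?s (bb 2) = bb 1" "?s (dd 1) = dd 2" "?s (dd 2) = dd 1"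
      "?s (bb (Suc 0)) = bb 2" "?s (dd (Suc 0)) = dd 2"
      using r by (simp_all add: s_arr mono_arrow_def Transposition.transpose_def)
    have other: "?s (bb i) = bb i" "?s (dd i) = dd i" if "i \<noteq> 1" "i \<noteq> 2" "1 \<le> i" "i \<le> r" for i
      using that by (simp_all add: s_arr mono_arrow_def Transposition.transpose_def)
    have [simp]: "nder aa (dd (Suc 0) * bb 2) p \<in> CQ_carrier r" "nder aa (dd 2 * bb (Suc 0)) p \<in> CQ_carrier r"
      using r by (auto intro!: nder_CQ)
    from g show ?thesis
    proof (cases rule: arrows_cases)
      case (b i)
      then show ?thesis using r
        by (cases "i = 1"; cases "i = 2") (simp_all add: apply_eq fourier_end Lam_arr Lam_arrow_simps
          Lam'_arrow_simps other F S D is_end_peval[OF fourier_end(1)] is_end_peval[OF Symp_end[OF s]])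
    next
      case (d i)
      then show ?thesis using r
        by (cases "i = 1"; cases "i = 2") (simp_all add: apply_eq fourier_end Lam_arr Lam_arrow_simps
          Lam'_arrow_simps other F S D is_end_peval[OF fourier_end(1)] is_end_peval[OF Symp_end[OF s]])
    qed (use r in \<open>simp_all add: apply_eq fourier_end Lam_arr Lam_arrow_simps Lam'_arrow_simps F S D
        is_end_nder[OF fourier_end(1)] is_end_nder[OF Symp_end[OF s]]\<close>)
  qed
  note * = subst_end_eqI[OF \<psi> this]
  show "Lam' r p = ?\<psi>" unfolding Lam'_def by (rule *(1))
  then show "is_end r (Lam' r p)" using \<psi> by simp
  show "g \<in> arrows r \<Longrightarrow> Lam' r p (arr g) = Lam'_arrow p g"
    unfolding Lam'_def by (rule subst_end_arr[OF *(2)])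
qed

lemma Lam'_K_c:
  assumes r: "r \<ge> 2"
  shows "Lam' r p \<in> K_c r"
proof -
  interpret G: group "SympGrp r" by (rule group_SympGrp)
  interpret K: subgroup "K_c r" "SympGrp r" by (rule K_c_subgroup)
  let ?s = "swap12 r"
  have K: "?s \<in> K_c r" "Lam r p \<in> K_c r"
    using swap12_Aff[OF r] Aff_K_c Lam_K_c[OF r] by auto
  then have "?s \<otimes>\<^bsub>SympGrp r\<^esub> Lam r p \<otimes>\<^bsub>SympGrp r\<^esub> ?s \<in> K_c r" by blast
  from K_c_conj[OF fourier_Symp(1) this] have
    "fourier r \<otimes>\<^bsub>SympGrp r\<^esub> (?s \<otimes>\<^bsub>SympGrp r\<^esub> Lam r p \<otimes>\<^bsub>SympGrp r\<^esub> ?s) \<otimes>\<^bsub>SympGrp r\<^esub> fourier_inv r \<in> K_c r"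
    by (simp add: inv_fourier)
  then show ?thesis
    unfolding Lam'_conj(1)[OF r] using K[THEN subsetD[OF K_c_Symp]] fourier_Symp
    by (simp add: G.m_assoc mult_Symp)
qed

text \<open>The conjugating factors lie in \<open>H\<close>, so each family is carried to the other
  without leaving \<open>H\<close>.\<close>

lemma subgroup_Lam'_iff:
  assumes "r \<ge> 2" "subgroup H (SympGrp r)" "Aut0 r \<subseteq> H" "Aff_red r \<subseteq> H"
  shows "Lam' r p \<in> H \<longleftrightarrow> Lam r p \<in> H"
proof -
  interpret G: group "SympGrp r" by (rule group_SympGrp)
  interpret H: subgroup H "SympGrp r" by fact
  define u where "u = fourier r \<otimes>\<^bsub>SympGrp r\<^esub> swap12 r"
  define v where "v = swap12 r \<otimes>\<^bsub>SympGrp r\<^esub> fourier_inv r"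
  have uv: "u \<in> H" "v \<in> H"
    using swap12_Aff[OF assms(1)] fourier_Aut0[of r] assms(3,4) unfolding u_def v_def by blast+
  have L: "Lam r p \<in> Symp r" using Lam_K_c[OF assms(1)] K_c_Symp by blast
  have uvS: "u \<in> Symp r" "v \<in> Symp r" using uv H.subset by auto
  have eq: "Lam' r p = u \<otimes>\<^bsub>SympGrp r\<^esub> Lam r p \<otimes>\<^bsub>SympGrp r\<^esub> v"
    unfolding u_def v_def by (rule Lam'_conj(1)[OF assms(1)])
  have "Lam r p = inv\<^bsub>SympGrp r\<^esub> u \<otimes>\<^bsub>SympGrp r\<^esub> Lam' r p \<otimes>\<^bsub>SympGrp r\<^esub> inv\<^bsub>SympGrp r\<^esub> v"
    unfolding eq using uvS L by (simp add: G.m_assoc mult_Symp inv_Symp) (simp add: G.m_assoc[symmetric] mult_Symp inv_Symp)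
  then show ?thesis using eq uv by (metis H.m_closed H.m_inv_closed)
qed

section \<open>The matrices of the generators\<close>

lemma peval_const: "peval [:c:] x = c *\<^sub>C e1"
  by (simp add: peval_def)

lemma sum_shift: "sum f {Suc 0..r} = (\<Sum>k<r. f (Suc k))"
  by (rule sum.reindex_bij_witness[of _ Suc "\<lambda>k. k - 1"]) auto

text \<open>A cycle at vertex 1 of length at most one is trivial or a loop. The difference of
  \<open>\<psi> as\<close> and \<open>as\<close> therefore involves only words in the loops, and
  these have coefficient 0 in the ideal.\<close>

lemma Aff_fixes_as:
  assumes "\<psi> \<in> Aff_red r"
  shows "\<psi> as = as"
proof -
  have e: "is_end r \<psi>" and red: "\<psi> as - as \<in> I_ideal r" and aff: "\<And>t w s. (t, w, s) \<in> supp (\<psi> as) \<Longrightarrow> length w \<le> 1"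
    using assms by (auto simp: Aff_red_def K_c_def Symp_iff is_reduced_def is_affine_def)
  have z: "e1 * (\<psi> as - as) = \<psi> as - as" "(\<psi> as - as) * e1 = \<psi> as - as"
    by (simp_all add: right_diff_distrib left_diff_distrib is_end_ee_left[OF e] is_end_ee_right[OF e])
  have "coeff_at (\<psi> as - as) (t, w, s) = 0" for t w s
  proof (rule ccontr)
    assume nz: "coeff_at (\<psi> as - as) (t, w, s) \<noteq> 0"
    have ts: "t = V1" "s = V1"
      using coeff_ee_mult[of V1 "\<psi> as - as" t w s] coeff_mult_ee[of "\<psi> as - as" V1 t w s] nz
      unfolding z by (auto split: if_splits)
    have path: "is_path r (V1, w, V1)"
      using red nz unfolding I_ideal_iff CQ_iff ts by blast
    have "length w \<le> 1"
    proof (rule ccontr)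
      assume long: "\<not> length w \<le> 1"
      then have "coeff_at (\<psi> as) (t, w, s) = 0" using aff by (auto simp: supp_iff)
      moreover have "coeff_at as (t, w, s) = 0" using long by (auto simp: arr_def coeff_at_of_path)
      ultimately show False using nz by simp
    qed
    then have "w = [] \<or> (\<exists>g. w = [g])" by (cases w) auto
    then have "w \<in> lists {Arr_a, Arr_as}"
      using path by (auto simp: arrows_def)
    then show False using red nz by (auto simp: I_ideal_iff ts)
  qed
  then have "\<psi> as - as = 0" by (intro palg_eqI) (metis coeff_at_0 prod_cases3)
  then show ?thesis by simp
qed

lemma Aff_b:
  assumes "\<psi> \<in> Aff_red r" "\<alpha> \<in> {1..r}"
  shows "\<psi> (bb \<alpha>) = (\<Sum>\<beta>\<in>{1..r}. coeff_at (\<psi> (bb \<alpha>)) (V2, [Arr_b \<beta>], V1) *\<^sub>C bb \<beta>)" (is "?x = _")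
proof (rule palg_eqI)
  have e: "is_end r \<psi>" and aff: "\<And>t w s. (t, w, s) \<in> supp ?x \<Longrightarrow> length w \<le> 1"
    using assms by (auto simp: Aff_red_def K_c_def Symp_iff is_affine_def)
  have g: "Arr_b \<alpha> \<in> arrows r" using assms(2) by simp
  have z: "e2 * ?x = ?x" "?x * e1 = ?x"
    using is_end_ee_left[OF e g, of V2] is_end_ee_right[OF e g, of V1] by simp_all
  have xC: "?x \<in> CQ_carrier r" using is_endD(2)[OF e] g by simp
  fix p :: path
  obtain t w s where p: "p = (t, w, s)" by (cases p)
  have rhs: "coeff_at (\<Sum>\<beta>\<in>{1..r}. coeff_at ?x (V2, [Arr_b \<beta>], V1) *\<^sub>C bb \<beta>) p
      = (\<Sum>\<beta>\<in>{1..r}. if p = (V2, [Arr_b \<beta>], V1) then coeff_at ?x p else 0)"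
    by (simp only: coeff_at_sum coeff_at_cscale) (intro sum.cong, auto simp: arr_def coeff_at_of_path)
  show "coeff_at ?x p = coeff_at (\<Sum>\<beta>\<in>{1..r}. coeff_at ?x (V2, [Arr_b \<beta>], V1) *\<^sub>C bb \<beta>) p"
  proof (cases "coeff_at ?x p = 0")
    case True
    show ?thesis unfolding rhs True by simp
  next
    case False
    have ts: "t = V2" "s = V1"
      using coeff_ee_mult[of V2 ?x t w s] coeff_mult_ee[of ?x V1 t w s] False
      unfolding z p by (auto split: if_splits)
    have path: "is_path r (V2, w, V1)" using xC False unfolding CQ_iff p ts by blast
    have "length w \<le> 1" using aff[of t w s] False by (simp add: p supp_iff)
    then have "w = [] \<or> (\<exists>g. w = [g])" by (cases w) auto
    then obtain \<beta> where "w = [Arr_b \<beta>]" "\<beta> \<in> {1..r}" using path by (auto simp: arrows_def)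
    then show ?thesis unfolding rhs unfolding p ts by simp
  qed
qed

lemma peval_mat_const:
  "L \<in> carrier_mat r r \<Longrightarrow> i < r \<Longrightarrow> j < r \<Longrightarrow> peval_mat (map_mat (\<lambda>c. [:c:]) L) $$ (i, j) = L $$ (i, j) *\<^sub>C e1"
  by (simp add: peval_mat_def peval_const)

lemma map_mat_const_mult:
  assumes "A \<in> carrier_mat r r" "B \<in> carrier_mat r r" "A * B = 1\<^sub>m r"
  shows "map_mat (\<lambda>c::complex. [:c:]) A * map_mat (\<lambda>c. [:c:]) B = 1\<^sub>m r"
proof -
  have sum: "(\<Sum>k\<in>K. [:f k:]) = [:sum f K:]" for K and f :: "nat \<Rightarrow> complex"
    by (induction K rule: infinite_finite_induct) auto
  have "map_mat (\<lambda>c. [:c:]) A * map_mat (\<lambda>c. [:c:]) B = map_mat (\<lambda>c. [:c:]) (A * B)"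
    using assms(1,2) by (intro eq_matI) (auto simp: mat_mult_index[where r = r] sum mult.commute simp del: index_mult_mat(1))
  then show ?thesis unfolding assms(3) by (intro eq_matI) (auto simp: assms one_pCons)
qed

lemma poly_A1: "M \<in> carrier_mat r r \<Longrightarrow> peval_mat M \<in> carrier (Mat_monoid r (A1 r))"
  using peval_mat_carrier[of M r] poly_subring_subset_A1[of r] by (auto simp: Mat_monoid_def)

text \<open>The matrix form of an affine automorphism has to be extracted, including invertibility.
  Comparing coefficients of the \<open>bb \<beta>\<close> in \<open>Symp_bd\<close> expresses each
  \<open>dd \<beta>\<close> through the images of the \<open>dd \<alpha>\<close>; this is a right
  inverse of the coefficient matrix, and over a field it is two-sided.\<close>

lemma Aff_acts:
  assumes "\<psi> \<in> Aff_red r"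
  obtains L L' where "L \<in> carrier_mat r r" "L' \<in> carrier_mat r r" "L' * L = 1\<^sub>m r" "L * L' = 1\<^sub>m r"
    "acts r \<psi> (peval_mat L)"
proof -
  have S: "\<psi> \<in> Symp r" using assms Aff_K_c K_c_Symp by blast
  have e: "is_end r \<psi>" using S by (rule Symp_end)
  define t where "t = (\<lambda>\<beta> \<alpha>. coeff_at (\<psi> (bb \<alpha>)) (V2, [Arr_b \<beta>], V1))"
  define s where "s = (\<lambda>\<alpha> \<gamma>. coeff_at (\<psi> (dd \<alpha>)) (V1, [Arr_d \<gamma>], V2))"
  have b: "\<psi> (bb \<alpha>) = (\<Sum>\<beta>\<in>{1..r}. t \<beta> \<alpha> *\<^sub>C bb \<beta>)" if "\<alpha> \<in> {1..r}" for \<alpha>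
    unfolding t_def by (rule Aff_b[OF assms that])
  have "(\<Sum>\<alpha>\<in>{1..r}. bb \<alpha> * dd \<alpha>) = (\<Sum>\<alpha>\<in>{1..r}. \<Sum>\<beta>\<in>{1..r}. bb \<beta> * (t \<beta> \<alpha> *\<^sub>C \<psi> (dd \<alpha>)))"
    unfolding Symp_bd[OF S, symmetric] by (intro sum.cong refl) (simp add: b sum_distrib_right)
  also have "\<dots> = (\<Sum>\<beta>\<in>{1..r}. bb \<beta> * (\<Sum>\<alpha>\<in>{1..r}. t \<beta> \<alpha> *\<^sub>C \<psi> (dd \<alpha>)))"
    by (subst sum.swap) (simp add: sum_distrib_left)
  finally have eq: "(\<Sum>\<alpha>\<in>{1..r}. bb \<alpha> * dd \<alpha>) = (\<Sum>\<beta>\<in>{1..r}. bb \<beta> * (\<Sum>\<alpha>\<in>{1..r}. t \<beta> \<alpha> *\<^sub>C \<psi> (dd \<alpha>)))" .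
  have d: "dd \<beta> = (\<Sum>\<alpha>\<in>{1..r}. t \<beta> \<alpha> *\<^sub>C \<psi> (dd \<alpha>))" if "\<beta> \<in> {1..r}" for \<beta>
    using that by (intro sum_bb_inj[OF eq]) (auto simp: sum_distrib_left is_end_ee_left[OF e])
  have ts: "(\<Sum>\<alpha>\<in>{1..r}. t \<beta> \<alpha> * s \<alpha> \<gamma>) = (if \<beta> = \<gamma> then 1 else 0)" if "\<beta> \<in> {1..r}" for \<beta> \<gamma>
    using arg_cong[OF d[OF that], of "\<lambda>x. coeff_at x (V1, [Arr_d \<gamma>], V2)"]
    by (simp add: s_def) (auto simp: arr_def coeff_at_of_path)
  let ?T = "mat r r (\<lambda>(i, j). t (i + 1) (j + 1))" and ?S = "mat r r (\<lambda>(i, j). s (i + 1) (j + 1))"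
  have TS: "?T * ?S = 1\<^sub>m r"
  proof (rule eq_matI)
    fix i j assume "i < dim_row (1\<^sub>m r :: complex mat)" "j < dim_col (1\<^sub>m r :: complex mat)"
    then show "(?T * ?S) $$ (i, j) = 1\<^sub>m r $$ (i, j)"
      using ts[of "i + 1" "j + 1"] by (simp add: mat_mult_index[where r = r] sum_shift del: index_mult_mat(1))
  qed auto
  have ST: "?S * ?T = 1\<^sub>m r" by (rule mat_mult_left_right_inverse[OF _ _ TS]) auto
  show ?thesis
  proof
    let ?c = "map_mat (\<lambda>c. [:c:]) :: complex mat \<Rightarrow> complex poly mat"
    show "?c ?S * ?c ?T = 1\<^sub>m r" by (rule map_mat_const_mult[OF _ _ ST]) auto
    show "?c ?T * ?c ?S = 1\<^sub>m r" by (rule map_mat_const_mult[OF _ _ TS]) auto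
    show "acts r \<psi> (peval_mat (?c ?T))"
      unfolding acts_def
    proof (intro conjI allI impI poly_A1)
      fix \<alpha> assume \<alpha>: "\<alpha> < r"
      then have "\<psi> (bb (\<alpha> + 1)) = (\<Sum>\<beta><r. t (\<beta> + 1) (\<alpha> + 1) *\<^sub>C bb (\<beta> + 1))"
        using b[of "\<alpha> + 1"] by (simp add: sum_shift)
      then show "\<psi> (bb (\<alpha> + 1)) = (\<Sum>\<beta><r. bb (\<beta> + 1) * peval_mat (?c ?T) $$ (\<beta>, \<alpha>))"
        using \<alpha> by (simp add: peval_mat_const[where r = r])
    qed auto
  qed auto
qed

section \<open>The group generated by the second family\<close>

text \<open>The entries of \<open>peval_mat N\<close> are polynomials in \<open>as\<close>, which
  \<psi> fixes; so \<psi> acts on the \<open>bb \<beta>\<close> alone and columns are multiplied by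
  \<open>L\<close> from the left.\<close>

lemma acts_peval_apply:
  assumes "is_end r \<psi>" "\<psi> as = as" "acts r \<psi> (peval_mat L)" "L \<in> carrier_mat r r" "N \<in> carrier_mat r r" "\<alpha> < r"
  shows "\<psi> (\<Sum>\<beta><r. bb (\<beta> + 1) * peval_mat N $$ (\<beta>, \<alpha>)) = (\<Sum>\<beta><r. bb (\<beta> + 1) * peval_mat (L * N) $$ (\<beta>, \<alpha>))"
proof -
  note i = is_endD[OF assms(1)]
  have N: "peval_mat N $$ (\<beta>, \<alpha>) = peval (N $$ (\<beta>, \<alpha>)) as" if "\<beta> < r" for \<beta>
    using that assms by (simp add: peval_mat_def)
  have "\<psi> (\<Sum>\<beta><r. bb (\<beta> + 1) * peval_mat N $$ (\<beta>, \<alpha>)) = (\<Sum>\<beta><r. \<psi> (bb (\<beta> + 1)) * peval_mat N $$ (\<beta>, \<alpha>))"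
    by (subst is_end_sum[OF assms(1)])
      (auto simp: N i is_end_peval[OF assms(1)] assms(2) intro!: sum.cong)
  also have "\<dots> = (\<Sum>\<beta><r. \<Sum>\<gamma><r. bb (\<gamma> + 1) * (peval_mat L $$ (\<gamma>, \<beta>) * peval_mat N $$ (\<beta>, \<alpha>)))"
    using assms(3) by (intro sum.cong refl) (simp add: acts_def sum_distrib_right mult.assoc)
  also have "\<dots> = (\<Sum>\<gamma><r. bb (\<gamma> + 1) * peval_mat (L * N) $$ (\<gamma>, \<alpha>))"
    using assms(4-6) peval_mat_carrier[of L r] peval_mat_carrier[of N r] unfolding peval_mat_mult[OF assms(4,5)]
    by (subst sum.swap)
      (simp add: mat_mult_index[where r = r] sum_distrib_left Mat_monoid_def del: index_mult_mat(1))
  finally show ?thesis .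
qed

text \<open>The properties shared by all generators of \<open>P'_grp r\<close> that survive products
  and inverses. Both inverse equations are kept because inversion exchanges \<open>L\<close> and
  \<open>L'\<close>.\<close>

definition poly_type :: "nat \<Rightarrow> (palg \<Rightarrow> palg) set" where
  "poly_type r = {\<psi> \<in> K_c r. \<psi> as = as \<and> (\<exists>L\<in>carrier_mat r r. \<exists>L'\<in>carrier_mat r r.
     L' * L = 1\<^sub>m r \<and> L * L' = 1\<^sub>m r \<and> acts r \<psi> (peval_mat L))}"

lemma acts_mult:
  assumes "\<psi> \<in> Symp r" "\<phi> \<in> Symp r" "\<psi> as = as"
    "acts r \<psi> (peval_mat L)" "acts r \<phi> (peval_mat N)" "L \<in> carrier_mat r r" "N \<in> carrier_mat r r"
  shows "acts r (\<psi> \<otimes>\<^bsub>SympGrp r\<^esub> \<phi>) (peval_mat (L * N))"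
  unfolding acts_def
proof (intro conjI allI impI poly_A1)
  show "L * N \<in> carrier_mat r r" using assms by simp
  fix \<alpha> assume \<alpha>: "\<alpha> < r"
  have "(\<psi> \<otimes>\<^bsub>SympGrp r\<^esub> \<phi>) (bb (\<alpha> + 1)) = \<psi> (\<Sum>\<beta><r. bb (\<beta> + 1) * peval_mat N $$ (\<beta>, \<alpha>))"
    using assms(5) \<alpha> by (simp add: mult_SympGrp_apply[OF assms(1,2)] acts_def)
  also have "\<dots> = (\<Sum>\<beta><r. bb (\<beta> + 1) * peval_mat (L * N) $$ (\<beta>, \<alpha>))"
    by (rule acts_peval_apply[OF Symp_end[OF assms(1)] assms(3,4,6,7) \<alpha>])
  finally show "(\<psi> \<otimes>\<^bsub>SympGrp r\<^esub> \<phi>) (bb (\<alpha> + 1)) = (\<Sum>\<beta><r. bb (\<beta> + 1) * peval_mat (L * N) $$ (\<beta>, \<alpha>))" .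
qed

lemma sum_peval_mat_one:
  "\<alpha> < r \<Longrightarrow> (\<Sum>\<beta><r. bb (\<beta> + 1) * peval_mat (1\<^sub>m r) $$ (\<beta>, \<alpha>)) = bb (\<alpha> + 1)"
proof -
  assume \<alpha>: "\<alpha> < r"
  have "(\<Sum>\<beta><r. bb (\<beta> + 1) * peval_mat (1\<^sub>m r) $$ (\<beta>, \<alpha>)) = (\<Sum>\<beta><r. if \<beta> = \<alpha> then bb (\<beta> + 1) else 0)"
    using \<alpha> by (intro sum.cong) (auto simp: peval_mat_def)
  then show ?thesis using \<alpha> by simp
qed

lemma acts_one: "acts r \<one>\<^bsub>SympGrp r\<^esub> (peval_mat (1\<^sub>m r))"
  unfolding acts_def using sum_peval_mat_one by (simp add: poly_A1 one_SympGrp del: One_nat_def)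

lemma poly_type_subgroup: "subgroup (poly_type r) (SympGrp r)"
proof -
  interpret G: group "SympGrp r" by (rule group_SympGrp)
  interpret K: subgroup "K_c r" "SympGrp r" by (rule K_c_subgroup)
  show ?thesis
  proof (rule G.subgroupI)
    show "poly_type r \<subseteq> carrier (SympGrp r)" using K_c_Symp by (auto simp: poly_type_def)
    have "\<one>\<^bsub>SympGrp r\<^esub> \<in> poly_type r"
      unfolding poly_type_def
    proof (intro CollectI conjI bexI[of _ "1\<^sub>m r"])
      show "\<one>\<^bsub>SympGrp r\<^esub> as = as" by (simp add: one_SympGrp)
      show "acts r \<one>\<^bsub>SympGrp r\<^esub> (peval_mat (1\<^sub>m r))" by (rule acts_one)
    qed auto
    then show "poly_type r \<noteq> {}" by blast
  next
    fix \<psi> assume "\<psi> \<in> poly_type r"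
    then obtain L L' where \<psi>: "\<psi> \<in> K_c r" "\<psi> as = as" "L \<in> carrier_mat r r" "L' \<in> carrier_mat r r"
      "L' * L = 1\<^sub>m r" "L * L' = 1\<^sub>m r" "acts r \<psi> (peval_mat L)" by (auto simp: poly_type_def)
    have S: "\<psi> \<in> Symp r" using \<psi>(1) K_c_Symp by blast
    let ?i = "inv\<^bsub>SympGrp r\<^esub> \<psi>"
    have "acts r ?i (peval_mat L')"
      unfolding acts_def
    proof (intro conjI allI impI poly_A1 \<psi>)
      fix \<alpha> assume \<alpha>: "\<alpha> < r"
      \<comment> \<open>The expected value of the inverse on \<open>bb (\<alpha> + 1)\<close>:
        \<psi> maps it back to that arrow since \<open>L * L'\<close> is the identity.\<close>
      let ?x = "\<Sum>\<beta><r. bb (\<beta> + 1) * peval_mat L' $$ (\<beta>, \<alpha>)"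
      have "\<psi> ?x = bb (\<alpha> + 1)"
        using acts_peval_apply[OF Symp_end[OF S] \<psi>(2,7,3,4) \<alpha>] sum_peval_mat_one[OF \<alpha>] by (simp only: \<psi>(6))
      moreover have "?x \<in> CQ_carrier r"
        using \<psi>(4) \<alpha> by (intro CQ_sum) (auto simp: peval_mat_def)
      ultimately show "?i (bb (\<alpha> + 1)) = ?x" using inv_SympGrp_apply(1)[OF S, of ?x] by simp
    qed
    moreover have "?i as = as" using inv_SympGrp_apply(1)[OF S, of "as"] \<psi>(2) by simp
    ultimately show "?i \<in> poly_type r"
      using \<psi> unfolding poly_type_def by blast
  next
    fix \<psi> \<phi> assume *: "\<psi> \<in> poly_type r" "\<phi> \<in> poly_type r"
    then obtain L L' N N' where \<psi>: "\<psi> \<in> K_c r" "\<psi> as = as" "L \<in> carrier_mat r r" "L' \<in> carrier_mat r r"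
      "L' * L = 1\<^sub>m r" "L * L' = 1\<^sub>m r" "acts r \<psi> (peval_mat L)"
      and \<phi>: "\<phi> \<in> K_c r" "\<phi> as = as" "N \<in> carrier_mat r r" "N' \<in> carrier_mat r r"
      "N' * N = 1\<^sub>m r" "N * N' = 1\<^sub>m r" "acts r \<phi> (peval_mat N)" by (auto simp: poly_type_def)
    have S: "\<psi> \<in> Symp r" "\<phi> \<in> Symp r" using \<psi>(1) \<phi>(1) K_c_Symp by blast+
    have inv: "A * B * (C * D) = 1\<^sub>m r" if "A \<in> carrier_mat r r" "B \<in> carrier_mat r r" "C \<in> carrier_mat r r"
      "D \<in> carrier_mat r r" "B * C = 1\<^sub>m r" "A * D = 1\<^sub>m r" for A B C D :: "complex poly mat"
    proof -
      have "A * B * (C * D) = A * (B * (C * D))" by (rule assoc_mult_mat) (use that in auto)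
      also have "B * (C * D) = B * C * D" by (rule assoc_mult_mat[symmetric]) (use that in auto)
      finally show ?thesis using that by simp
    qed
    have "acts r (\<psi> \<otimes>\<^bsub>SympGrp r\<^esub> \<phi>) (peval_mat (L * N))"
      by (rule acts_mult[OF S \<psi>(2,7) \<phi>(7) \<psi>(3) \<phi>(3)])
    moreover have "(\<psi> \<otimes>\<^bsub>SympGrp r\<^esub> \<phi>) as = as" using \<psi>(2) \<phi>(2) by (simp add: mult_SympGrp_apply[OF S])
    moreover have "N' * L' * (L * N) = 1\<^sub>m r" "L * N * (N' * L') = 1\<^sub>m r"
      using \<psi> \<phi> by (auto intro!: inv)
    moreover have "L * N \<in> carrier_mat r r" "N' * L' \<in> carrier_mat r r" using \<psi> \<phi> by auto
    ultimately show "\<psi> \<otimes>\<^bsub>SympGrp r\<^esub> \<phi> \<in> poly_type r"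
      unfolding poly_type_def using K.m_closed[OF \<psi>(1) \<phi>(1)] by blast
  qed
qed

text \<open>\<open>Lam' r p\<close> realises an elementary transvection; sending \<open>bb 2\<close>
  to \<open>bb 2 + bb 1 * peval p as\<close> puts \<open>p\<close> in row 0 and column 1.\<close>

lemma Lam'_acts:
  assumes r: "r \<ge> 2"
  shows "acts r (Lam' r p) (peval_mat (addrow_mat r p 0 1))"
  unfolding acts_def
proof (intro conjI allI impI poly_A1)
  fix \<alpha> assume \<alpha>: "\<alpha> < r"
  have "(\<Sum>\<beta><r. bb (\<beta> + 1) * peval_mat (addrow_mat r p 0 1) $$ (\<beta>, \<alpha>))
      = (\<Sum>\<beta><r. (if \<beta> = \<alpha> then bb (\<beta> + 1) else 0) + (if \<beta> = 0 \<and> \<alpha> = 1 then bb (\<beta> + 1) * peval p as else 0))"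
    using \<alpha> by (intro sum.cong refl) (auto simp: peval_mat_def peval_add)
  also have "\<dots> = bb (\<alpha> + 1) + (if \<alpha> = 1 then bb 1 * peval p as else 0)"
    using \<alpha> r by (auto simp: sum.distrib)
  also have "\<dots> = Lam' r p (bb (\<alpha> + 1))"
    using \<alpha> r by (auto simp: Lam'_conj(3)[OF r] Lam'_arrow_simps numeral_2_eq_2)
  finally show "Lam' r p (bb (\<alpha> + 1)) = (\<Sum>\<beta><r. bb (\<beta> + 1) * peval_mat (addrow_mat r p 0 1) $$ (\<beta>, \<alpha>))" ..
qed simp

lemma P'_grp_poly_type: "P'_grp r \<subseteq> poly_type r"
proof -
  interpret G: group "SympGrp r" by (rule group_SympGrp)
  have "\<psi> \<in> poly_type r" if "\<psi> \<in> Aff_red r" for \<psi>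
    using Aff_acts[OF that] Aff_fixes_as[OF that] Aff_K_c that unfolding poly_type_def by blast
  moreover have "Lam' r p \<in> poly_type r" if r: "r \<ge> 2" for p
  proof -
    have "addrow_mat r p 0 1 * addrow_mat r (- p) 0 1 = 1\<^sub>m r" "addrow_mat r (- p) 0 1 * addrow_mat r p 0 1 = 1\<^sub>m r"
      using addrow_mat_inv[of 0 r 1 p] addrow_mat_inv[of 0 r 1 "- p"] r by simp_all
    moreover have "Lam' r p as = as" using Lam'_conj(3)[OF r, of Arr_as] by (simp add: Lam'_arrow_simps)
    ultimately show ?thesis unfolding poly_type_def
      using Lam'_K_c[OF r] Lam'_acts[OF r] addrow_mat_carrier by blast
  qed
  ultimately show ?thesis
    unfolding P'_grp_def by (intro G.generate_subgroup_incl[OF _ poly_type_subgroup]) auto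
qed

lemma generators_Symp:
  "Aff_red r \<union> (if r \<ge> 2 then range (Lam r) else {}) \<subseteq> carrier (SympGrp r)"
  "Aff_red r \<union> (if r \<ge> 2 then range (Lam' r) else {}) \<subseteq> carrier (SympGrp r)"
  using Aff_K_c[of r] K_c_Symp[of r] Lam_K_c[of r] Lam'_K_c[of r] by (auto split: if_splits)

lemma P_grp_subgroup: "subgroup (P_grp r) (SympGrp r)" "subgroup (P'_grp r) (SympGrp r)"
  unfolding P_grp_def P'_grp_def
  by (rule group.generate_is_subgroup[OF group_SympGrp generators_Symp(1)],
      rule group.generate_is_subgroup[OF group_SympGrp generators_Symp(2)])

lemma P_grp_generators:
  "Aff_red r \<subseteq> P_grp r" "Aff_red r \<subseteq> P'_grp r"
  "r \<ge> 2 \<Longrightarrow> Lam r p \<in> P_grp r" "r \<ge> 2 \<Longrightarrow> Lam' r p \<in> P'_grp r"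
  unfolding P_grp_def P'_grp_def by (auto intro!: generate.incl)

lemma N_mat_P':
  assumes "\<psi> \<in> P'_grp r"
  obtains L where "L \<in> carrier_mat r r" "acts r \<psi> (peval_mat L)" "N_mat r \<psi> = peval_mat L"
    "peval_mat L \<in> carrier (GL r (poly_subring as))"
proof -
  obtain L L' where "L \<in> carrier_mat r r" "L' \<in> carrier_mat r r" "L' * L = 1\<^sub>m r" "L * L' = 1\<^sub>m r"
    "acts r \<psi> (peval_mat L)"
    using subsetD[OF P'_grp_poly_type assms] by (auto simp: poly_type_def)
  then show ?thesis using that N_mat_eq peval_mat_GL by blast
qed

lemma P'_fixes: "\<psi> \<in> P'_grp r \<Longrightarrow> \<psi> as = as" "P'_grp r \<subseteq> K_c r" "P'_grp r \<subseteq> Symp r"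
  using P'_grp_poly_type K_c_Symp by (auto simp: poly_type_def)

lemma exists_permutes_pair:
  assumes "i \<in> {1..r}" "j \<in> {1..r}" "i \<noteq> j" "r \<ge> 2"
  obtains \<pi> where "\<pi> permutes {1..r}" "\<pi> 1 = i" "\<pi> (2::nat) = j"
proof
  let ?t = "Transposition.transpose 1 i"
  \<comment> \<open>The outer transposition sends 1 to \<open>i\<close>. The inner one moves 2 to
    the preimage of \<open>j\<close> beforehand and leaves 1 alone, because
    \<open>i \<noteq> j\<close> keeps that preimage away from 1.\<close>
  let ?\<pi> = "?t \<circ> Transposition.transpose 2 (?t j)"
  have t: "?t permutes {1..r}" using assms by (intro permutes_swap_id) auto
  have "?t j \<in> {1..r}" using permutes_in_image[OF t] assms by blast
  then have "Transposition.transpose 2 (?t j) permutes {1..r}" using assms by (intro permutes_swap_id) auto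
  then show "?\<pi> permutes {1..r}" using t by (rule permutes_compose)
  have "?t j \<noteq> 1" using assms by (auto simp: Transposition.transpose_def)
  then show "?\<pi> 1 = i" by (simp add: Transposition.transpose_def)
  show "?\<pi> 2 = j" by (simp add: Transposition.transpose_def)
qed

text \<open>Conjugating \<open>Lam' r p\<close> by a permutation of the pairs of arrows moves its
  entry from row 0, column 1 to any position off the diagonal, and such permutations are
  affine.\<close>

lemma addrow_mat_P':
  assumes "i < r" "j < r" "i \<noteq> j"
  obtains \<psi> where "\<psi> \<in> P'_grp r" "acts r \<psi> (peval_mat (addrow_mat r p i j))"
proof -
  have r: "r \<ge> 2" using assms by auto
  obtain \<pi> where \<pi>: "\<pi> permutes {1..r}" "\<pi> 1 = i + 1" "\<pi> 2 = j + 1"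
    using exists_permutes_pair[of "i + 1" r "j + 1"] assms r by auto
  define \<rho> where "\<rho> = inv_into UNIV \<pi>"
  have \<rho>: "\<rho> permutes {1..r}" unfolding \<rho>_def using \<pi>(1) by (rule permutes_inv)
  have inv: "\<pi> (\<rho> k) = k" "\<rho> (\<pi> k) = k" for k
    unfolding \<rho>_def using permutes_inverses[OF \<pi>(1)] by auto
  have in1: "1 \<le> \<pi> k" "\<pi> k \<le> r" "1 \<le> \<rho> k" "\<rho> k \<le> r" if "1 \<le> k" "k \<le> r" for k
    using permutes_in_image[OF \<pi>(1), of k] permutes_in_image[OF \<rho>, of k] that by auto
  let ?A = "mono_auto r \<pi> (\<lambda>_. 1)" and ?B = "mono_auto r \<rho> (\<lambda>_. 1)"
  have P: "?A \<in> P'_grp r" "?B \<in> P'_grp r" "Lam' r p \<in> P'_grp r"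
    using P_grp_generators(4)[OF r] mono_Aff[OF \<pi>(1)] mono_Aff[OF \<rho>]
    by (auto intro!: subsetD[OF P_grp_generators(2)])
  have S: "?A \<in> Symp r" "?B \<in> Symp r" "Lam' r p \<in> Symp r" using P by (auto intro!: subsetD[OF P'_fixes(3)])
  let ?\<psi> = "?A \<otimes>\<^bsub>SympGrp r\<^esub> (Lam' r p \<otimes>\<^bsub>SympGrp r\<^esub> ?B)"
  have "?\<psi> \<in> P'_grp r" using P by (intro subgroup.m_closed[OF P_grp_subgroup(2)])
  moreover have "acts r ?\<psi> (peval_mat (addrow_mat r p i j))"
    unfolding acts_def
  proof (intro conjI allI impI poly_A1)
    fix \<alpha> assume \<alpha>: "\<alpha> < r"
    have a: "?A (bb k) = bb (\<pi> k)" "?B (bb k) = bb (\<rho> k)" if "1 \<le> k" "k \<le> r" for k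
      using that by (simp_all add: mono_arr_end(2)[OF \<pi>(1)] mono_arr_end(2)[OF \<rho>] mono_arrow_def)
    note A = is_endD[OF Symp_end[OF S(1)]] and B = is_endD[OF Symp_end[OF S(2)]]
      and L = is_endD[OF Symp_end[OF S(3)]]
    have k: "1 \<le> \<rho> (\<alpha> + 1)" "\<rho> (\<alpha> + 1) \<le> r" using in1(3,4)[of "\<alpha> + 1"] \<alpha> by auto
    have "?\<psi> (bb (\<alpha> + 1)) = ?A (Lam' r p (?B (bb (\<alpha> + 1))))"
      using \<alpha> S B(2)[of "bb (\<alpha> + 1)"] by (simp add: mult_SympGrp_apply mult_Symp)
    also have "\<dots> = ?A (Lam'_arrow p (Arr_b (\<rho> (\<alpha> + 1))))"
      using \<alpha> k by (simp add: a Lam'_conj(3)[OF r])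
    also have "\<dots> = bb (\<alpha> + 1) + (if \<alpha> = j then bb (i + 1) * peval p as else 0)"
    proof (cases "\<alpha> = j")
      case True
      then have "\<rho> (\<alpha> + 1) = 2" using inv(2)[of 2] \<pi>(3) by simp
      moreover have "?A as = as" using P'_fixes(1)[OF P(1)] .
      ultimately show ?thesis
        using True r \<pi>(2,3) by (simp add: Lam'_arrow_simps A is_end_peval[OF Symp_end[OF S(1)]] a)
    next
      case False
      then have "\<rho> (\<alpha> + 1) \<noteq> 2" using inv(1)[of "\<alpha> + 1"] \<pi>(3) by auto
      then show ?thesis using False k a(1)[OF k] inv(1) by (simp add: Lam'_arrow_simps)
    qed
    also have "\<dots> = (\<Sum>\<beta><r. (if \<beta> = \<alpha> then bb (\<beta> + 1) else 0) + (if \<beta> = i then if \<alpha> = j then bb (\<beta> + 1) * peval p as else 0 else 0))"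
      using \<alpha> assms by (simp add: sum.distrib)
    also have "\<dots> = (\<Sum>\<beta><r. bb (\<beta> + 1) * peval_mat (addrow_mat r p i j) $$ (\<beta>, \<alpha>))"
      using \<alpha> assms by (intro sum.cong refl) (auto simp: peval_mat_def peval_add)
    finally show "?\<psi> (bb (\<alpha> + 1)) = (\<Sum>\<beta><r. bb (\<beta> + 1) * peval_mat (addrow_mat r p i j) $$ (\<beta>, \<alpha>))" .
  qed simp
  ultimately show ?thesis using that by blast
qed

lemma multrow_mat_P':
  assumes "k < r" "c \<noteq> 0"
  obtains \<psi> where "\<psi> \<in> P'_grp r" "acts r \<psi> (peval_mat (multrow_mat r k [:c:]))"
proof -
  \<comment> \<open>Row \<open>k\<close> belongs to the arrow \<open>bb (k + 1)\<close>; the value 1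
    elsewhere keeps all scalars nonzero.\<close>
  let ?c = "\<lambda>i. if i = k + 1 then c else 1"
  let ?\<psi> = "mono_auto r id ?c"
  have "?\<psi> \<in> P'_grp r"
    using mono_Aff[OF permutes_id, of ?c] assms(2) by (intro subsetD[OF P_grp_generators(2)]) auto
  moreover have "acts r ?\<psi> (peval_mat (multrow_mat r k [:c:]))"
    unfolding acts_def
  proof (intro conjI allI impI poly_A1)
    fix \<alpha> assume \<alpha>: "\<alpha> < r"
    have "?\<psi> (bb (\<alpha> + 1)) = ?c (\<alpha> + 1) *\<^sub>C bb (\<alpha> + 1)"
      using \<alpha> by (simp add: mono_arr_end(2)[OF permutes_id] mono_arrow_def)
    also have "\<dots> = (\<Sum>\<beta><r. if \<beta> = \<alpha> then ?c (\<beta> + 1) *\<^sub>C bb (\<beta> + 1) else 0)"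
      using \<alpha> by simp
    also have "\<dots> = (\<Sum>\<beta><r. bb (\<beta> + 1) * peval_mat (multrow_mat r k [:c:]) $$ (\<beta>, \<alpha>))"
      using \<alpha> by (intro sum.cong refl) (auto simp: peval_mat_def peval_const)
    finally show "?\<psi> (bb (\<alpha> + 1)) = (\<Sum>\<beta><r. bb (\<beta> + 1) * peval_mat (multrow_mat r k [:c:]) $$ (\<beta>, \<alpha>))" .
  qed simp
  ultimately show ?thesis using that by blast
qed

text \<open>The matrices realised by \<open>P'_grp r\<close> satisfy \<open>row_closed\<close>: an
  elementary row operation is left multiplication by a realised matrix, and products are realised by
  \<open>acts_mult\<close>.\<close>

lemma acts_surj:
  assumes "L \<in> carrier_mat r r" "L' \<in> carrier_mat r r" "L' * L = 1\<^sub>m r"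
  shows "\<exists>\<psi>\<in>P'_grp r. acts r \<psi> (peval_mat L)"
proof -
  let ?G = "{L. \<exists>\<psi>\<in>P'_grp r. acts r \<psi> (peval_mat L)}"
  have mult: "E * M \<in> ?G"
    if prems: "\<psi> \<in> P'_grp r" "acts r \<psi> (peval_mat E)" "E \<in> carrier_mat r r" "M \<in> carrier_mat r r" "M \<in> ?G" for \<psi> E M
  proof -
    obtain \<phi> where \<phi>: "\<phi> \<in> P'_grp r" "acts r \<phi> (peval_mat M)" using prems(5) by blast
    have "acts r (\<psi> \<otimes>\<^bsub>SympGrp r\<^esub> \<phi>) (peval_mat (E * M))"
      using prems \<phi> by (intro acts_mult P'_fixes(1) subsetD[OF P'_fixes(3)])
    then show ?thesis using subgroup.m_closed[OF P_grp_subgroup(2) prems(1) \<phi>(1)] by blast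
  qed
  have "row_closed r ?G"
  proof
    show "1\<^sub>m r \<in> ?G" using subgroup.one_closed[OF P_grp_subgroup(2)] acts_one by blast
  next
    fix M :: "complex poly mat" and i j p
    assume *: "M \<in> carrier_mat r r" "M \<in> ?G" "i < r" "j < r" "i \<noteq> j"
    obtain \<psi> where "\<psi> \<in> P'_grp r" "acts r \<psi> (peval_mat (addrow_mat r p i j))"
      using addrow_mat_P'[OF *(3-5)] .
    from mult[OF this _ *(1,2)] show "addrow p i j M \<in> ?G" using addrow_mat[OF *(1,4), of p i] by simp
  next
    fix M :: "complex poly mat" and i and c :: complex
    assume *: "M \<in> carrier_mat r r" "M \<in> ?G" "i < r" "c \<noteq> 0"
    obtain \<psi> where "\<psi> \<in> P'_grp r" "acts r \<psi> (peval_mat (multrow_mat r i [:c:]))"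
      using multrow_mat_P'[OF *(3,4)] .
    from mult[OF this _ *(1,2)] show "multrow i [:c:] M \<in> ?G" using multrow_mat[OF *(1), of i "[:c:]"] by simp
  qed
  then have "L \<in> ?G" using assms by (rule row_closed.left_invertible_mem)
  then show ?thesis by blast
qed

lemma N_mat_iso: "N_mat r \<in> iso ((SympGrp r)\<lparr>carrier := P'_grp r\<rparr>) (GL r (poly_subring as))"
proof (rule isoI)
  show "N_mat r \<in> hom ((SympGrp r)\<lparr>carrier := P'_grp r\<rparr>) (GL r (poly_subring as))"
  proof (rule homI)
    fix \<psi> assume "\<psi> \<in> carrier ((SympGrp r)\<lparr>carrier := P'_grp r\<rparr>)"
    then have "\<psi> \<in> P'_grp r" by simp
    then obtain L where "N_mat r \<psi> = peval_mat L" "peval_mat L \<in> carrier (GL r (poly_subring as))"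
      by (rule N_mat_P')
    then show "N_mat r \<psi> \<in> carrier (GL r (poly_subring as))" by simp
  next
    fix \<psi> \<phi> assume "\<psi> \<in> carrier ((SympGrp r)\<lparr>carrier := P'_grp r\<rparr>)" "\<phi> \<in> carrier ((SympGrp r)\<lparr>carrier := P'_grp r\<rparr>)"
    then have *: "\<psi> \<in> P'_grp r" "\<phi> \<in> P'_grp r" by simp_all
    obtain L where L: "L \<in> carrier_mat r r" "acts r \<psi> (peval_mat L)" "N_mat r \<psi> = peval_mat L"
      using *(1) by (rule N_mat_P')
    obtain M where M: "M \<in> carrier_mat r r" "acts r \<phi> (peval_mat M)" "N_mat r \<phi> = peval_mat M"
      using *(2) by (rule N_mat_P')
    have "acts r (\<psi> \<otimes>\<^bsub>SympGrp r\<^esub> \<phi>) (peval_mat (L * M))"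
      using * L M by (intro acts_mult P'_fixes(1) subsetD[OF P'_fixes(3)])
    then have "N_mat r (\<psi> \<otimes>\<^bsub>SympGrp r\<^esub> \<phi>) = peval_mat L * peval_mat M"
      using N_mat_eq peval_mat_mult[OF L(1) M(1)] by simp
    then show "N_mat r (\<psi> \<otimes>\<^bsub>(SympGrp r)\<lparr>carrier := P'_grp r\<rparr>\<^esub> \<phi>) = N_mat r \<psi> \<otimes>\<^bsub>GL r (poly_subring as)\<^esub> N_mat r \<phi>"
      by (simp add: L M GL_def units_of_def Mat_monoid_def)
  qed
  have inj: "\<psi> = \<phi>" if *: "\<psi> \<in> P'_grp r" "\<phi> \<in> P'_grp r" "N_mat r \<psi> = N_mat r \<phi>" for \<psi> \<phi>
  proof -
    obtain L where L: "L \<in> carrier_mat r r" "acts r \<psi> (peval_mat L)" "N_mat r \<psi> = peval_mat L"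
      using *(1) by (rule N_mat_P')
    obtain M where M: "M \<in> carrier_mat r r" "acts r \<phi> (peval_mat M)" "N_mat r \<phi> = peval_mat M"
      using *(2) by (rule N_mat_P')
    have eq: "peval_mat M = peval_mat L" using L M *(3) by simp
    show ?thesis
    proof (rule K_c_eqI)
      show "\<psi> \<in> K_c r" "\<phi> \<in> K_c r" using * P'_fixes(2) by auto
      show "\<psi> as = as" "\<phi> as = as" using * P'_fixes(1) by auto
      fix \<alpha> assume "\<alpha> \<in> {1..r}"
      then have \<alpha>: "\<alpha> - 1 < r" "\<alpha> = \<alpha> - 1 + 1" by auto
      show "\<psi> (bb \<alpha>) = \<phi> (bb \<alpha>)"
        using L(2) M(2) \<alpha>(1) unfolding acts_def eq by (subst (1 2) \<alpha>(2)) simp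
    qed
  qed
  show "bij_betw (N_mat r) (carrier ((SympGrp r)\<lparr>carrier := P'_grp r\<rparr>)) (carrier (GL r (poly_subring as)))"
  proof (rule bij_betwI')
    fix M assume "M \<in> carrier (GL r (poly_subring as))"
    then obtain L L' where L: "L \<in> carrier_mat r r" "L' \<in> carrier_mat r r" "L' * L = 1\<^sub>m r" "M = peval_mat L"
      by (rule Units_peval_mat)
    then obtain \<psi> where "\<psi> \<in> P'_grp r" "acts r \<psi> (peval_mat L)" using acts_surj by blast
    then show "\<exists>\<psi>\<in>carrier ((SympGrp r)\<lparr>carrier := P'_grp r\<rparr>). M = N_mat r \<psi>"
      using N_mat_eq L(4) by (intro bexI[of _ \<psi>]) auto
  next
    fix \<psi> assume "\<psi> \<in> carrier ((SympGrp r)\<lparr>carrier := P'_grp r\<rparr>)"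
    then have "\<psi> \<in> P'_grp r" by simp
    then obtain L where "N_mat r \<psi> = peval_mat L" "peval_mat L \<in> carrier (GL r (poly_subring as))"
      by (rule N_mat_P')
    then show "N_mat r \<psi> \<in> carrier (GL r (poly_subring as))" by simp
  qed (auto intro: inj)
qed

text \<open>Both generated groups contain \<open>Aut0 r\<close> and the affine automorphisms, so
  each contains the other family by \<open>subgroup_Lam'_iff\<close>.\<close>

lemma replaced_P'_grp:
  assumes r: "r \<ge> 2"
  shows "P'_grp r \<subseteq> P_cal r" "P_cal r = replaced r (P'_grp r)"
proof -
  interpret G: group "SympGrp r" by (rule group_SympGrp)
  note P = G.generate_set_mult[OF Aut0_subgroup[of r] P_grp_subgroup(1)[of r], folded replaced_def]
  note P' = G.generate_set_mult[OF Aut0_subgroup[of r] P_grp_subgroup(2)[of r], folded replaced_def]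
  have "Lam' r p \<in> replaced r (P_grp r)" for p
    using subgroup_Lam'_iff[OF r P(1,2)] P(3) P_grp_generators(1,3) r by blast
  then have 1: "P'_grp r \<subseteq> replaced r (P_grp r)"
    unfolding P'_grp_def using P(3) P_grp_generators(1) r
    by (intro G.generate_subgroup_incl[OF _ P(1)]) auto
  have "Lam r p \<in> replaced r (P'_grp r)" for p
    using subgroup_Lam'_iff[OF r P'(1,2)] P'(3) P_grp_generators(2,4) r by blast
  then have 2: "P_grp r \<subseteq> replaced r (P'_grp r)"
    unfolding P_grp_def using P'(3) P_grp_generators(2) r
    by (intro G.generate_subgroup_incl[OF _ P'(1)]) auto
  show "P'_grp r \<subseteq> P_cal r" using 1 by (simp add: P_cal_def)
  have "replaced r (P'_grp r) \<subseteq> replaced r (P_grp r)"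
    unfolding replaced_def[of r "P'_grp r"]
    by (rule G.generate_subgroup_incl[OF G.set_mult_subset_subgroup[OF P(1,2) 1] P(1)])
  moreover have "replaced r (P_grp r) \<subseteq> replaced r (P'_grp r)"
    unfolding replaced_def[of r "P_grp r"]
    by (rule G.generate_subgroup_incl[OF G.set_mult_subset_subgroup[OF P'(1,2) 2] P'(1)])
  ultimately show "P_cal r = replaced r (P'_grp r)" by (simp add: P_cal_def)
qed

theorem mainTheorem3:
  fixes r :: nat
  assumes "r \<ge> 1"
  shows "subgroup (carrier (GL r (poly_subring as))) (GL r (A1 r))
       \<and> N_mat r \<in> iso ((SympGrp r)\<lparr>carrier := P'_grp r\<rparr>) (GL r (poly_subring as))
       \<and> (r \<ge> 2 \<longrightarrow>
            P'_grp r \<subseteq> P_cal r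
          \<and> P'_grp r \<subseteq> K_c r
          \<and> P_cal r = replaced r (P'_grp r)
          \<and> internal_semidirect (SympGrp r) (P_cal r) (stable_hull r (P'_grp r)) (Aut0 r))"
proof (intro conjI impI)
  show "subgroup (carrier (GL r (poly_subring as))) (GL r (A1 r))" by (rule GL_subgroup)
  show "N_mat r \<in> iso ((SympGrp r)\<lparr>carrier := P'_grp r\<rparr>) (GL r (poly_subring as))" by (rule N_mat_iso)
  assume r: "r \<ge> 2"
  show "P'_grp r \<subseteq> P_cal r" "P_cal r = replaced r (P'_grp r)" by (rule replaced_P'_grp[OF r])+
  show "P'_grp r \<subseteq> K_c r" by (rule P'_fixes(2))
  show "internal_semidirect (SympGrp r) (P_cal r) (stable_hull r (P'_grp r)) (Aut0 r)"
    \<comment> \<open>Writing \<open>P_cal r\<close> through \<open>P'_grp r\<close> makes the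
      stable hull of \<open>P'_grp r\<close> the normal factor, with \<open>K_c r\<close> as the
      bounding group.\<close>
    unfolding replaced_P'_grp(2)[OF r] replaced_def stable_hull_def
    by (rule group.internal_semidirect_generate[OF group_SympGrp Aut0_subgroup P_grp_subgroup(2) K_c_subgroup P'_fixes(2)])
      (use K_c_conj Aut0_Symp K_c_Aut0 in blast)+
qed

end
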